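(* There exists an absolute constant $C>0$ such that for every $N\ge1$, every $1\le p<\infty$ and every $u\in\dot W^{1,p}(\mathbb R^N)$: (a) if $\gamma>0$, then $\sup_{\lambda>0}\lambda^p\nu_\gamma(E_{\lambda,\gamma/p}[u])\le C\,\sigma_{N-1}\frac{5^\gamma}{\gamma}\|\nabla u\|_{L^p(\mathbb R^N)}^p$; (b) if $\gamma<-1$, then $\sup_{\lambda>0}\lambda^p\nu_\gamma(E_{\lambda,\gamma/p}[u])\le \frac{C\,\sigma_{N-1}}{|\gamma|}\Big(1+\frac{1}{|\gamma+1|}\Big)\|\nabla u\|_{L^p(\mathbb R^N)}^p$. When $p=1$, both assertions hold for all $u\in\dot{BV}(\mathbb R^N)$ with $\|\nabla u\|_{L^1}$ replaced by $\|\nabla u\|_{\mathcal M}$.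
   Context: $\sigma_{N-1}$ is the surface area of $\mathbb S^{N-1}$. For $\gamma\in\mathbb R$, $\nu_\gamma(E)=\iint_{(x,y)\in E,\,x\ne y}|x-y|^{\gamma-N}\,dx\,dy$. For measurable $u$ and $b\in\mathbb R$, $E_{\lambda,b}[u]=\{(x,y):x\ne y,\ \frac{|u(x)-u(y)|}{|x-y|^{1+b}}>\lambda\}$. $\dot W^{1,p}(\mathbb R^N)$: locally integrable functions with distributional gradient in $L^p$. $\dot{BV}(\mathbb R^N)$: locally integrable $u$ with distributional gradient a finite vector-valued Borel measure, $\|\nabla u\|_{\mathcal M}$ its total variation. *)

theory Defs
  imports "HOL-Analysis.Analysis"
begin

text \<open>Points of R^N are represented as extensional functions nat => real on {..<N}.\<close>

definition sp :: "nat \<Rightarrow> (nat \<Rightarrow> real) set" where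
  "sp N = PiE {..<N} (\<lambda>_. UNIV)"

definition BN :: "nat \<Rightarrow> (nat \<Rightarrow> real) measure" where
  "BN N = PiM {..<N} (\<lambda>_. lborel)"

definition LN :: "nat \<Rightarrow> (nat \<Rightarrow> real) measure" where
  "LN N = completion (BN N)"

definition rdist :: "nat \<Rightarrow> (nat \<Rightarrow> real) \<Rightarrow> (nat \<Rightarrow> real) \<Rightarrow> real" where
  "rdist N x y = sqrt (\<Sum>i<N. (x i - y i)^2)"

definition sphere_area :: "nat \<Rightarrow> real" where
  "sphere_area N = 2 * pi powr (real N / 2) / Gamma (real N / 2)"

definition nu :: "nat \<Rightarrow> real \<Rightarrow> ((nat \<Rightarrow> real) \<times> (nat \<Rightarrow> real)) set \<Rightarrow> ennreal" where
  "nu N \<gamma> E = (\<integral>\<^sup>+ x. \<integral>\<^sup>+ y. indicator E (x, y) * indicator {q. fst q \<noteq> snd q} (x, y)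
        * ennreal (rdist N x y powr (\<gamma> - real N)) \<partial>LN N \<partial>LN N)"

definition Elev :: "nat \<Rightarrow> ((nat \<Rightarrow> real) \<Rightarrow> real) \<Rightarrow> real \<Rightarrow> real
     \<Rightarrow> ((nat \<Rightarrow> real) \<times> (nat \<Rightarrow> real)) set" where
  "Elev N u lam b = {(x, y). x \<in> sp N \<and> y \<in> sp N \<and> x \<noteq> y \<and>
       \<bar>u x - u y\<bar> / rdist N x y powr (1 + b) > lam}"

definition pd :: "nat \<Rightarrow> ((nat \<Rightarrow> real) \<Rightarrow> real) \<Rightarrow> (nat \<Rightarrow> real) \<Rightarrow> real" where
  "pd i f x = deriv (\<lambda>t. f (x(i := t))) (x i)"

coinductive smooth :: "nat \<Rightarrow> ((nat \<Rightarrow> real) \<Rightarrow> real) \<Rightarrow> bool" for N where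
  "continuous_on (sp N) f \<Longrightarrow>
   (\<forall>i<N. \<forall>x\<in>sp N. (\<lambda>t. f (x(i := t))) differentiable (at (x i))) \<Longrightarrow>
   (\<forall>i<N. smooth N (pd i f)) \<Longrightarrow> smooth N f"

definition test :: "nat \<Rightarrow> ((nat \<Rightarrow> real) \<Rightarrow> real) \<Rightarrow> bool" where
  "test N \<phi> \<longleftrightarrow> smooth N \<phi> \<and> (\<exists>R. \<forall>x\<in>sp N. rdist N x (\<lambda>_. 0) > R \<longrightarrow> \<phi> x = 0)"

definition locint :: "nat \<Rightarrow> ((nat \<Rightarrow> real) \<Rightarrow> real) \<Rightarrow> bool" where
  "locint N u \<longleftrightarrow> u \<in> borel_measurable (LN N) \<and>
     (\<forall>R. set_integrable (LN N) {x \<in> sp N. rdist N x (\<lambda>_. 0) \<le> R} u)"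

definition W1p :: "nat \<Rightarrow> real \<Rightarrow> ((nat \<Rightarrow> real) \<Rightarrow> real) \<Rightarrow> (nat \<Rightarrow> (nat \<Rightarrow> real) \<Rightarrow> real) \<Rightarrow> bool" where
  "W1p N p u g \<longleftrightarrow> locint N u \<and>
     (\<forall>i<N. g i \<in> borel_measurable (LN N) \<and> (\<integral>\<^sup>+ x. ennreal (\<bar>g i x\<bar> powr p) \<partial>LN N) < \<infinity>) \<and>
     (\<forall>\<phi>. test N \<phi> \<longrightarrow> (\<forall>i<N. (\<integral>x. u x * pd i \<phi> x \<partial>LN N) = - (\<integral>x. g i x * \<phi> x \<partial>LN N)))"

definition gradnorm :: "nat \<Rightarrow> real \<Rightarrow> (nat \<Rightarrow> (nat \<Rightarrow> real) \<Rightarrow> real) \<Rightarrow> ennreal" where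
  "gradnorm N p g = (\<integral>\<^sup>+ x. ennreal ((sqrt (\<Sum>i<N. (g i x)^2)) powr p) \<partial>LN N)"

text \<open>u in homogeneous BV: distributional gradient is the finite vector Borel measure whose
  i-th component is the signed measure P i - Q i (P i, Q i finite Borel measures).\<close>
definition BVgrad :: "nat \<Rightarrow> ((nat \<Rightarrow> real) \<Rightarrow> real) \<Rightarrow> (nat \<Rightarrow> (nat \<Rightarrow> real) measure)
     \<Rightarrow> (nat \<Rightarrow> (nat \<Rightarrow> real) measure) \<Rightarrow> bool" where
  "BVgrad N u P Q \<longleftrightarrow> locint N u \<and>
     (\<forall>i<N. sets (P i) = sets (BN N) \<and> sets (Q i) = sets (BN N) \<and>
            finite_measure (P i) \<and> finite_measure (Q i)) \<and>
     (\<forall>\<phi>. test N \<phi> \<longrightarrow> (\<forall>i<N. (\<integral>x. u x * pd i \<phi> x \<partial>LN N) =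
            - ((\<integral>x. \<phi> x \<partial>P i) - (\<integral>x. \<phi> x \<partial>Q i))))"

definition TV :: "nat \<Rightarrow> (nat \<Rightarrow> (nat \<Rightarrow> real) measure) \<Rightarrow> (nat \<Rightarrow> (nat \<Rightarrow> real) measure) \<Rightarrow> ennreal" where
  "TV N P Q = (SUP mA \<in> {(m::nat, A::nat \<Rightarrow> (nat \<Rightarrow> real) set). (\<forall>k<m. A k \<in> sets (BN N)) \<and> disjoint_family_on A {..<m}}.
      ennreal (\<Sum>k<fst mA. sqrt (\<Sum>i<N. (measure (P i) (snd mA k) - measure (Q i) (snd mA k))^2)))"

end

theory Submission
  imports Defs "HOL-Probability.Probability"
begin

text \<open>For almost every \<open>x\<close> one has
  \<open>|u (x + z) - u x|^p \<le> |z|^p \<integral> |\<nabla>u|^p (x + r z) dr\<close> over \<open>r \<in> [0, 1]\<close>, so everything reduces to the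
  sets of segments whose integral of \<open>w = |\<nabla>u|^p\<close> is large. For segments on a line these are estimated by the
  Vitali covering lemma if \<open>\<gamma> > 0\<close>, and by a chain of shortest admissible intervals if \<open>\<gamma> < -1\<close>.
  Averaging over translations and dilations replaces polar coordinates in the passage from lines to
  the whole space. The increment formula is obtained from the definition of the weak gradient with
  products of bump functions that converge to indicators of boxes. For \<open>u\<close> of bounded variation the
  averages of \<open>u\<close> over small boxes satisfy the same inequality with gradients bounded in \<open>L^1\<close> by the total variation,
  and they converge to \<open>u\<close> almost everywhere.\<close>

text \<open>The choice b = \<gamma> / p makes the power p disappear: a pair in the level set
  satisfies lam^p |z|^\<gamma> < \<integral> |\<nabla>u|^p (x + r z) dr. On a line this says that a
  segment of length t carries more mass than a multiple of t powr (\<gamma> + 1). The sign of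
  \<gamma> + 1 decides how such segments are counted: for \<gamma> > 0 long segments need much mass
  and disjoint ones are selected, while for \<gamma> < -1 the requirement weakens with the length
  and the shortest segments control all others. The constant must not depend on N. The ball of
  radius 1 + 1 / N has at most e times the volume of the unit ball, and the relative width 1 / (N +
  1) of the shell between them costs a factor N + 1, which turns the volume of the ball into the
  area of the sphere. A gradient that is only a measure cannot be restricted to single lines.
  Increments of u are therefore compared with the gradient measure averaged along z, first on open
  boxes and then on all measurable sets; line integrals appear only after a density is available or
  the measure has been averaged over boxes.\<close>

lemma indicator_mult_ennreal: "indicator A x * ennreal y = ennreal (indicator A x * y)"
  by (simp add: indicator_def)

lemma nn_integral_powr_Ioc:
  fixes a b :: real
  assumes "a > 0" "b > 0"
  shows "(\<integral>\<^sup>+t. indicator {0<..b} t * ennreal (t powr (a - 1)) \<partial>lborel) = ennreal (b powr a / a)"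
proof -
  have "((\<lambda>t. t powr (a - 1)) has_integral (b powr (a - 1 + 1) / (a - 1 + 1))) {0..b}"
    using assms by (intro has_integral_powr_from_0) auto
  hence "(\<integral>\<^sup>+t. indicator {0..b} t * ennreal (t powr (a - 1)) \<partial>lborel) = ennreal (b powr a / a)"
    using nn_integral_has_integral_lebesgue[of "{0..b}" "\<lambda>t. t powr (a - 1)" "b powr a / a"]
    by (simp add: nn_integral_completion indicator_mult_ennreal)
  moreover have "(\<integral>\<^sup>+t. indicator {0<..b} t * ennreal (t powr (a - 1)) \<partial>lborel)
      = (\<integral>\<^sup>+t. indicator {0..b} t * ennreal (t powr (a - 1)) \<partial>lborel)"
    by (intro nn_integral_cong) (auto simp: indicator_def)
  ultimately show ?thesis by simp
qed

lemma nn_integral_powr_atLeast: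
  fixes a b :: real
  assumes "a < 0" "b > 0"
  shows "(\<integral>\<^sup>+t. indicator {b..} t * ennreal (t powr (a - 1)) \<partial>lborel) = ennreal (b powr a / \<bar>a\<bar>)"
proof -
  have "(\<integral>\<^sup>+t. ennreal (t powr (a - 1)) * indicator {b..} t \<partial>lborel) = ennreal (0 - b powr a / a)"
  proof (rule nn_integral_FTC_atLeast)
    show "DERIV (\<lambda>t. t powr a / a) x :> x powr (a - 1)" if "b \<le> x" for x
      using that assms by (auto intro!: derivative_eq_intros)
    have "((\<lambda>t::real. t powr a) \<longlongrightarrow> 0) at_top"
      using assms by (intro tendsto_neg_powr filterlim_ident) auto
    then show "((\<lambda>t::real. t powr a / a) \<longlongrightarrow> 0) at_top"
      using tendsto_divide[of "\<lambda>t. t powr a" 0 at_top "\<lambda>_. a" a] assms by auto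
  qed auto
  also have "0 - b powr a / a = b powr a / \<bar>a\<bar>" using assms by simp
  finally show ?thesis by (simp add: mult.commute)
qed

subsection \<open>The one-dimensional estimates\<close>

text \<open>In polar coordinates z = t k the weight |z| powr (\<gamma> - N) together with t ^ (N -
  1) leaves t powr (\<gamma> - 1), and the level condition compares the mass of the segment of
  length t starting at s with t powr (\<gamma> + 1).\<close>

abbreviation (input) seg_weight :: "real \<Rightarrow> (real \<Rightarrow> ennreal) \<Rightarrow> real \<Rightarrow> real \<Rightarrow> ennreal" where
  "seg_weight \<gamma> h s t \<equiv> (if ennreal (t powr (\<gamma> + 1)) < (\<integral>\<^sup>+r\<in>{s..s+t}. h r \<partial>lborel) then ennreal (t powr (\<gamma> - 1)) else 0)"

text \<open>The cut-off at T bounds the radii for the covering lemma and keeps all segments inside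
  [0, 2 * T]. T tends to infinity in \<open>direction_estimate\<close>.\<close>

abbreviation (input) seg_energy :: "real \<Rightarrow> real \<Rightarrow> (real \<Rightarrow> ennreal) \<Rightarrow> ennreal" where
  "seg_energy \<gamma> T h \<equiv> (\<integral>\<^sup>+s. indicator {0..T} s * (\<integral>\<^sup>+t. indicator {0<..T} t * seg_weight \<gamma> h s t \<partial>lborel) \<partial>lborel)"

text \<open>Vitali selects disjoint admissible segments such that every admissible (s, t) lies in
  the fivefold enlargement of a selected segment, of length t' say. Then s ranges over an interval
  of length 5 t', and t \<le> 5 t', which gives at most 5 t' * (5 t') powr \<gamma> / \<gamma>.
  Admissibility of the selected segment bounds t' powr (\<gamma> + 1) by its mass, and the disjoint
  masses add up to at most the mass of [0, 2 * T].\<close>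

lemma one_dim_pos:
  fixes h :: "real \<Rightarrow> ennreal"
  assumes [measurable]: "h \<in> borel_measurable borel" and \<gamma>: "\<gamma> > 0" and T: "T > 0"
  shows "seg_energy \<gamma> T h
    \<le> ennreal (5 * 5 powr \<gamma> / \<gamma>) * (\<integral>\<^sup>+r\<in>{0..2*T}. h r \<partial>lborel)"
proof -
  define K where "K = {(s, t). 0 \<le> s \<and> s \<le> T \<and> 0 < t \<and> t \<le> T \<and> ennreal (t powr (\<gamma> + 1)) < (\<integral>\<^sup>+r\<in>{s..s+t}. h r \<partial>lborel)}"
  define a where "a = (\<lambda>(s::real, t::real). s + t / 2)"
  define \<rho> where "\<rho> = (\<lambda>(s::real, t::real). t / 2)"
  define I where "I = (\<lambda>j. cball (a j) (\<rho> j))"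
  have I_eq: "I j = {fst j..fst j + snd j}" for j
    by (cases j) (auto simp: I_def a_def \<rho>_def cball_eq_atLeastAtMost)
  obtain C where C: "countable C" "C \<subseteq> K" "pairwise (\<lambda>i j. disjnt (I i) (I j)) C"
     and cov: "\<And>i. i \<in> K \<Longrightarrow> \<exists>j. j \<in> C \<and> \<not> disjnt (I i) (I j) \<and> I i \<subseteq> ball (a j) (5 * \<rho> j)"
  proof -
    have "0 < \<rho> j \<and> \<rho> j \<le> T / 2" if "j \<in> K" for j
      using that by (auto simp: K_def \<rho>_def)
    from Vitali_covering_lemma_cballs_balls[of K \<rho> "T/2" a, OF this]
    show ?thesis using that unfolding I_def by blast
  qed
  \<comment> \<open>\<open>F j\<close> majorises the weight of all segments assigned to j: starts in
    the enlarged ball, lengths up to five times that of j.\<close>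
  define F where "F = (\<lambda>j s t. indicator (ball (a j) (5 * \<rho> j)) s * (indicator {0<..5 * snd j} t * ennreal (t powr (\<gamma> - 1))))"
  have [measurable]: "(\<lambda>(s, t). F j s t) \<in> borel_measurable (lborel \<Otimes>\<^sub>M lborel)" for j
    unfolding F_def ball_eq_greaterThanLessThan by measurable
  have bound: "indicator {0..T} s * (indicator {0<..T} t *
      seg_weight \<gamma> h s t)
    \<le> (\<integral>\<^sup>+j. F j s t \<partial>count_space C)" for s t
  proof (cases "(s, t) \<in> K")
    case True
    then obtain j where j: "j \<in> C" "I (s, t) \<subseteq> ball (a j) (5 * \<rho> j)" using cov by blast
    have st: "0 \<le> s" "s \<le> T" "0 < t" "t \<le> T" using True by (auto simp: K_def)
    have "s \<in> ball (a j) (5 * \<rho> j)" "s + t \<in> ball (a j) (5 * \<rho> j)"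
      using subsetD[OF j(2), of s] subsetD[OF j(2), of "s + t"] st by (simp_all add: I_eq)
    hence "t \<le> 5 * snd j" "s \<in> ball (a j) (5 * \<rho> j)"
      by (auto simp: ball_eq_greaterThanLessThan \<rho>_def split: prod.splits)
    hence "F j s t = ennreal (t powr (\<gamma> - 1))" using st by (simp add: F_def)
    with nn_integral_ge_point[OF j(1), of "\<lambda>j. F j s t"] show ?thesis
      by (auto simp: indicator_def)
  next
    case False
    then show ?thesis by (auto simp: K_def indicator_def)
  qed
  have "seg_energy \<gamma> T h
    \<le> (\<integral>\<^sup>+s. (\<integral>\<^sup>+t. (\<integral>\<^sup>+j. F j s t \<partial>count_space C) \<partial>lborel) \<partial>lborel)"
  proof (intro nn_integral_mono)
    fix s :: real
    show "indicator {0..T} s * (\<integral>\<^sup>+t. indicator {0<..T} t *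
      seg_weight \<gamma> h s t \<partial>lborel)
      \<le> (\<integral>\<^sup>+t. (\<integral>\<^sup>+j. F j s t \<partial>count_space C) \<partial>lborel)"
    proof (cases "s \<in> {0..T}")
      case True
      then show ?thesis using bound[of s] by (auto intro!: nn_integral_mono)
    qed auto
  qed
  also have "\<dots> = (\<integral>\<^sup>+s. (\<integral>\<^sup>+j. (\<integral>\<^sup>+t. F j s t \<partial>lborel) \<partial>count_space C) \<partial>lborel)"
    by (intro nn_integral_cong nn_integral_count_space_nn_integral C) measurable
  also have "\<dots> = (\<integral>\<^sup>+j. (\<integral>\<^sup>+s. (\<integral>\<^sup>+t. F j s t \<partial>lborel) \<partial>lborel) \<partial>count_space C)"
    by (intro nn_integral_count_space_nn_integral C) measurable
  also have "\<dots> \<le> (\<integral>\<^sup>+j. ennreal (5 * 5 powr \<gamma> / \<gamma>) * (\<integral>\<^sup>+r\<in>I j. h r \<partial>lborel) \<partial>count_space C)"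
  proof (rule nn_integral_mono)
    fix j assume "j \<in> space (count_space C)"
    hence jK: "j \<in> K" using C by auto
    obtain s t where j: "j = (s, t)" by force
    have t: "t > 0" using jK by (auto simp: K_def j)
    have "(\<integral>\<^sup>+s. (\<integral>\<^sup>+t. F j s t \<partial>lborel) \<partial>lborel)
        = (\<integral>\<^sup>+s. indicator (ball (a j) (5 * \<rho> j)) s * ennreal ((5 * t) powr \<gamma> / \<gamma>) \<partial>lborel)"
      unfolding F_def using t \<gamma> by (simp add: nn_integral_cmult nn_integral_powr_Ioc j)
    also have "\<dots> = ennreal (5 * t) * ennreal ((5 * t) powr \<gamma> / \<gamma>)"
      using t by (subst nn_integral_multc) (auto simp: j \<rho>_def ball_eq_greaterThanLessThan)
    also have "\<dots> = ennreal (5 * 5 powr \<gamma> / \<gamma>) * ennreal (t powr (\<gamma> + 1))"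
      using t \<gamma> by (simp add: ennreal_mult[symmetric] powr_add powr_mult)
    also have "\<dots> \<le> ennreal (5 * 5 powr \<gamma> / \<gamma>) * (\<integral>\<^sup>+r\<in>I j. h r \<partial>lborel)"
      using jK by (intro mult_left_mono) (auto simp: K_def j I_eq)
    finally show "(\<integral>\<^sup>+s. (\<integral>\<^sup>+t. F j s t \<partial>lborel) \<partial>lborel) \<le> ennreal (5 * 5 powr \<gamma> / \<gamma>) * (\<integral>\<^sup>+r\<in>I j. h r \<partial>lborel)" .
  qed
  also have "\<dots> = ennreal (5 * 5 powr \<gamma> / \<gamma>) * (\<integral>\<^sup>+j. emeasure (density lborel h) (I j) \<partial>count_space C)"
    by (subst nn_integral_cmult[symmetric]) (auto simp: emeasure_density I_def)
  also have "(\<integral>\<^sup>+j. emeasure (density lborel h) (I j) \<partial>count_space C) = emeasure (density lborel h) (\<Union>j\<in>C. I j)"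
    using C by (intro emeasure_UN_countable[symmetric])
      (auto simp: I_def disjoint_family_on_def pairwise_def disjnt_def)
  also have "\<dots> \<le> emeasure (density lborel h) {0..2*T}"
    using C by (intro emeasure_mono) (force simp: I_eq K_def)+
  also have "\<dots> = (\<integral>\<^sup>+r\<in>{0..2*T}. h r \<partial>lborel)" by (simp add: emeasure_density)
  finally show ?thesis by (simp add: mult_left_mono)
qed

text \<open>The inner integral is max R (b - s) powr \<gamma> / |\<gamma>|. Up to the factor 1 /
  |\<gamma>|, the starts within R of b contribute R powr (\<gamma> + 1), and those farther away
  contribute the tail R powr (\<gamma> + 1) / |\<gamma> + 1|, which converges because \<gamma> < -1.
  This is the origin of 1 + 1 / |\<gamma> + 1|.\<close>

lemma nn_integral_truncated_powr:
  fixes R b \<gamma> :: real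
  assumes "R > 0" "\<gamma> < -1"
  shows "(\<integral>\<^sup>+s. indicator {..<b} s * (\<integral>\<^sup>+t. indicator {max R (b - s)..} t * ennreal (t powr (\<gamma> - 1)) \<partial>lborel) \<partial>lborel)
    \<le> ennreal (1 / \<bar>\<gamma>\<bar> * (1 + 1 / \<bar>\<gamma> + 1\<bar>) * R powr (\<gamma> + 1))"
proof -
  have "(\<integral>\<^sup>+s. indicator {..<b} s * (\<integral>\<^sup>+t. indicator {max R (b - s)..} t * ennreal (t powr (\<gamma> - 1)) \<partial>lborel) \<partial>lborel)
    = (\<integral>\<^sup>+s. indicator {..<b} s * ennreal (max R (b - s) powr \<gamma> / \<bar>\<gamma>\<bar>) \<partial>lborel)"
    using assms by (subst nn_integral_powr_atLeast) auto
  also have "\<dots> \<le> (\<integral>\<^sup>+s. indicator {b - R..b} s * ennreal (R powr \<gamma> / \<bar>\<gamma>\<bar>)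
       + ennreal (1 / \<bar>\<gamma>\<bar>) * (indicator {R..} (b - s) * ennreal ((b - s) powr ((\<gamma> + 1) - 1))) \<partial>lborel)"
    using assms by (intro nn_integral_mono) (auto simp: indicator_def max_def ennreal_mult[symmetric])
  also have "\<dots> = ennreal R * ennreal (R powr \<gamma> / \<bar>\<gamma>\<bar>)
       + ennreal (1 / \<bar>\<gamma>\<bar>) * (\<integral>\<^sup>+s. indicator {R..} (b - s) * ennreal ((b - s) powr ((\<gamma> + 1) - 1)) \<partial>lborel)"
    using assms by (simp add: nn_integral_add nn_integral_multc nn_integral_cmult)
  also have "(\<integral>\<^sup>+s. indicator {R..} (b - s) * ennreal ((b - s) powr ((\<gamma> + 1) - 1)) \<partial>lborel)
      = (\<integral>\<^sup>+v. indicator {R..} v * ennreal (v powr ((\<gamma> + 1) - 1)) \<partial>lborel)"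
    using nn_integral_real_affine[of "\<lambda>v. indicator {R..} v * ennreal (v powr ((\<gamma> + 1) - 1))" "-1" b] by simp
  also have "\<dots> = ennreal (R powr (\<gamma> + 1) / \<bar>\<gamma> + 1\<bar>)"
    using assms by (intro nn_integral_powr_atLeast) auto
  also have "ennreal R * ennreal (R powr \<gamma> / \<bar>\<gamma>\<bar>) + ennreal (1 / \<bar>\<gamma>\<bar>) * ennreal (R powr (\<gamma> + 1) / \<bar>\<gamma> + 1\<bar>)
      = ennreal (1 / \<bar>\<gamma>\<bar> * (1 + 1 / \<bar>\<gamma> + 1\<bar>) * R powr (\<gamma> + 1))"
  proof -
    have "R powr (\<gamma> + 1) = R powr \<gamma> * R" using assms by (simp add: powr_add)
    then have "R * (R powr \<gamma> / \<bar>\<gamma>\<bar>) + 1 / \<bar>\<gamma>\<bar> * (R powr (\<gamma> + 1) / \<bar>\<gamma> + 1\<bar>)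
        = 1 / \<bar>\<gamma>\<bar> * (1 + 1 / \<bar>\<gamma> + 1\<bar>) * R powr (\<gamma> + 1)"
      by (simp add: algebra_simps)
    then show ?thesis
      using assms by (simp only: ennreal_mult'[symmetric] ennreal_plus[symmetric] divide_nonneg_nonneg mult_nonneg_nonneg
          abs_ge_zero powr_ge_zero less_imp_le zero_le_one)
  qed
  finally show ?thesis .
qed

text \<open>For \<open>\<gamma> < -1\<close> admissibility of an interval is inherited by larger intervals. So, moving from
  \<open>a\<close> to the end point \<open>b\<close> of the shortest admissible interval starting at \<open>a\<close>, and from \<open>b\<close>
  to \<open>b'\<close> in the same way, each admissible interval starting in \<open>[a, b)\<close> contains \<open>b\<close> and has
  length at least \<open>(V b' - V a) powr (1 / (\<gamma> + 1))\<close>.\<close>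

lemma one_dim_neg_chain:
  fixes V :: "real \<Rightarrow> real"
  assumes \<gamma>: "\<gamma> < -1" and V: "continuous_on {0..S} V" "mono_on {0..S} V" and S: "S > 0"
  defines "adm \<equiv> \<lambda>s t. 0 < t \<and> 0 \<le> s \<and> s + t \<le> S \<and> t powr (\<gamma> + 1) < V (s + t) - V s"
  shows "(\<integral>\<^sup>+s. (\<integral>\<^sup>+t. (if adm s t then ennreal (t powr (\<gamma> - 1)) else 0) \<partial>lborel) \<partial>lborel)
    \<le> ennreal (1 / \<bar>\<gamma>\<bar> * (1 + 1 / \<bar>\<gamma> + 1\<bar>) * (2 * (V S - V 0)))"
proof -
  define c where "c = 1 / \<bar>\<gamma>\<bar> * (1 + 1 / \<bar>\<gamma> + 1\<bar>)"
  have c: "c > 0" using \<gamma> by (simp only: c_def) (intro mult_pos_pos add_pos_pos; simp)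
  \<comment> \<open>The weak inequality, in contrast to the strict one in \<open>adm\<close>, makes
    \<open>Y a\<close> closed, so that a first end point exists.\<close>
  define Y where "Y = (\<lambda>a. {y. a < y \<and> y \<le> S \<and> (y - a) powr (\<gamma> + 1) \<le> V y - V a})"
  \<comment> \<open>A lower bound for the length of every interval from a to a point of
    \<open>Y a\<close>; the summand 1 keeps it positive when V is constant. It forces the chain to
    end after finitely many links.\<close>
  define \<rho> where "\<rho> = (V S - V 0 + 1) powr (1 / (\<gamma> + 1))"
  have Vmono: "V x \<le> V y" if "0 \<le> x" "x \<le> y" "y \<le> S" for x y
    using V(2) that by (auto simp: mono_on_def)
  have root: "M powr (1 / (\<gamma> + 1)) \<le> t \<and> M > 0" if "t powr (\<gamma> + 1) \<le> M" "t > 0" for t M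
  proof -
    have M: "M > 0" using that by (smt (verit) powr_gt_zero)
    have "M powr (1 / (\<gamma> + 1)) \<le> (t powr (\<gamma> + 1)) powr (1 / (\<gamma> + 1))"
      using that \<gamma> by (intro powr_mono2') (auto simp: divide_nonneg_neg divide_nonpos_neg)
    also have "\<dots> = t" using that \<gamma> by (simp add: powr_powr)
    finally show ?thesis using M by simp
  qed
  have \<rho>: "\<rho> > 0" using Vmono[of 0 S] S by (simp add: \<rho>_def)
  have Y_far: "a + \<rho> \<le> y" if "y \<in> Y a" "0 \<le> a" for a y
    using that root[of "y - a" "V S - V 0 + 1"] Vmono[of 0 a] Vmono[of y S]
    by (auto simp: Y_def \<rho>_def)
  \<comment> \<open>If no end point is admissible, the chain jumps to S.\<close>
  have ex: "\<exists>b. a \<le> b \<and> b \<le> S \<and> (\<forall>y\<in>Y a. b \<le> y) \<and> (b \<in> Y a \<or> (Y a = {} \<and> b = S))" if a: "0 \<le> a" "a \<le> S" for a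
  proof (cases "Y a = {}")
    case True
    with a show ?thesis by auto
  next
    case False
    have Yeq: "Y a = {a + \<rho>..S} \<inter> (\<lambda>y. V y - V a - (y - a) powr (\<gamma> + 1)) -` {0..}"
      using Y_far[OF _ a(1)] \<rho> by (auto simp: Y_def)
    have "continuous_on {a + \<rho>..S} (\<lambda>y. V y - V a - (y - a) powr (\<gamma> + 1))"
      using a \<rho> by (intro continuous_intros continuous_on_subset[OF V(1)]) auto
    hence "closed (Y a)" unfolding Yeq by (intro continuous_closed_preimage) auto
    hence "compact (Y a)" using Yeq by (metis bounded_Int bounded_closed_interval compact_eq_bounded_closed)
    from compact_attains_inf[OF this False] obtain b where "b \<in> Y a" "\<forall>y\<in>Y a. b \<le> y" by auto
    then show ?thesis by (auto simp: Y_def intro!: exI[of _ b])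
  qed
  define nxt where "nxt = (\<lambda>a. SOME b. a \<le> b \<and> b \<le> S \<and> (\<forall>y\<in>Y a. b \<le> y) \<and> (b \<in> Y a \<or> (Y a = {} \<and> b = S)))"
  have nxt: "a \<le> nxt a \<and> nxt a \<le> S \<and> (\<forall>y\<in>Y a. nxt a \<le> y) \<and> (nxt a \<in> Y a \<or> (Y a = {} \<and> nxt a = S))"
    if "0 \<le> a" "a \<le> S" for a
    unfolding nxt_def by (rule someI_ex) (rule ex[OF that])
  \<comment> \<open>Enlarging an interval to the left lowers its length powr (\<gamma> + 1), as
    \<gamma> + 1 < 0, and does not lower the increment of V.\<close>
  have adm_Y: "s + t \<in> Y a" if "adm s t" "0 \<le> a" "a \<le> s" for a s t
  proof -
    have "(s + t - a) powr (\<gamma> + 1) \<le> t powr (\<gamma> + 1)"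
      using that \<gamma> by (intro powr_mono2') (auto simp: adm_def)
    moreover have "V a \<le> V s" using that by (intro Vmono) (auto simp: adm_def)
    ultimately show ?thesis using that by (auto simp: Y_def adm_def)
  qed
  define G where "G = (\<lambda>s t. if adm s t then ennreal (t powr (\<gamma> - 1)) else 0)"
  define \<Phi> where "\<Phi> = (\<lambda>a. (\<integral>\<^sup>+s. indicator {a..} s * (\<integral>\<^sup>+t. G s t \<partial>lborel) \<partial>lborel))"
  \<comment> \<open>The constant extension beyond [0, S] makes the integrand measurable on the whole
    plane.\<close>
  define V' where "V' = (\<lambda>x. V (max 0 (min S x)))"
  have "continuous_on UNIV V'" unfolding V'_def
    by (rule continuous_on_compose2[OF V(1)]) (use S in \<open>auto intro!: continuous_intros\<close>)
  hence [measurable]: "V' \<in> borel_measurable borel" by (rule borel_measurable_continuous_onI)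
  have G': "G = (\<lambda>s t. if 0 < t \<and> 0 \<le> s \<and> s + t \<le> S \<and> t powr (\<gamma> + 1) < V' (s + t) - V' s then ennreal (t powr (\<gamma> - 1)) else 0)"
    by (intro ext) (auto simp: G_def adm_def V'_def)
  have [measurable]: "(\<lambda>(s, t). G s t) \<in> borel_measurable (lborel \<Otimes>\<^sub>M lborel)"
    unfolding G' by measurable
  have step: "(\<integral>\<^sup>+s. indicator {a..<nxt a} s * (\<integral>\<^sup>+t. G s t \<partial>lborel) \<partial>lborel) \<le> ennreal (c * (V (nxt (nxt a)) - V a))"
    if a: "0 \<le> a" "a \<le> S" for a
  proof -
    define b b' M where "b = nxt a" and "b' = nxt b" and "M = V b' - V a"
    have b: "a \<le> b" "b \<le> S" using nxt[OF a] by (auto simp: b_def)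
    have b': "b \<le> b'" "b' \<le> S" "b' \<in> Y b \<or> b' = S" using nxt[of b] a b by (auto simp: b'_def)
    have len: "M powr (1 / (\<gamma> + 1)) \<le> t \<and> M > 0 \<and> b - s \<le> t" if st: "adm s t" "a \<le> s" "s < b" for s t
    proof -
      have t: "t > 0" "s + t \<le> S" using st by (auto simp: adm_def)
      have "b \<le> s + t" using nxt[OF a] adm_Y[OF st(1) a(1) st(2)] by (auto simp: b_def)
      \<comment> \<open>Either the interval ends no later than b', and then its increment is at most
        M; or it passes b', which forces b' into \<open>Y b\<close>, makes the interval longer than
        b' - b, and the increment over [b, b'] is at most M. Both times a length powr (\<gamma> + 1)
        bounded by M is inverted by \<open>root\<close>.\<close>
      moreover have "M powr (1 / (\<gamma> + 1)) \<le> t \<and> M > 0"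
      proof (cases "s + t \<le> b'")
        case True
        have "t powr (\<gamma> + 1) \<le> M"
          using st True Vmono[of a s] Vmono[of "s + t" b'] a b b' by (auto simp: adm_def M_def)
        then show ?thesis using root t by blast
      next
        case False
        with b'(3) t have bY: "b' \<in> Y b" by auto
        have "(b' - b) powr (\<gamma> + 1) \<le> M" using bY Vmono[of a b] a b by (auto simp: Y_def M_def)
        moreover have "b' - b > 0" using bY by (auto simp: Y_def)
        ultimately have "M powr (1 / (\<gamma> + 1)) \<le> b' - b \<and> M > 0" using root by blast
        then show ?thesis using False st(3) by auto
      qed
      ultimately show ?thesis by auto
    qed
    show ?thesis
    proof (cases "M > 0")
      case True
      define R where "R = M powr (1 / (\<gamma> + 1))"
      have R: "R > 0" using True by (simp add: R_def)
      have "(\<integral>\<^sup>+s. indicator {a..<nxt a} s * (\<integral>\<^sup>+t. G s t \<partial>lborel) \<partial>lborel)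
        \<le> (\<integral>\<^sup>+s. indicator {..<b} s * (\<integral>\<^sup>+t. indicator {max R (b - s)..} t * ennreal (t powr (\<gamma> - 1)) \<partial>lborel) \<partial>lborel)"
      proof (rule nn_integral_mono)
        fix s :: real
        show "indicator {a..<nxt a} s * (\<integral>\<^sup>+t. G s t \<partial>lborel)
          \<le> indicator {..<b} s * (\<integral>\<^sup>+t. indicator {max R (b - s)..} t * ennreal (t powr (\<gamma> - 1)) \<partial>lborel)"
        proof (cases "s \<in> {a..<b}")
          case True
          have "G s t \<le> indicator {max R (b - s)..} t * ennreal (t powr (\<gamma> - 1))" for t
            using len[of s t] True by (auto simp: G_def R_def)
          then show ?thesis using True by (auto simp: b_def intro!: nn_integral_mono)
        qed (auto simp: b_def)
      qed
      also have "\<dots> \<le> ennreal (1 / \<bar>\<gamma>\<bar> * (1 + 1 / \<bar>\<gamma> + 1\<bar>) * R powr (\<gamma> + 1))"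
        by (rule nn_integral_truncated_powr[OF R \<gamma>])
      also have "R powr (\<gamma> + 1) = M" using True \<gamma> by (simp add: R_def powr_powr)
      finally show ?thesis by (simp add: c_def M_def b_def b'_def)
    next
      case False
      have "indicator {a..<nxt a} s * (\<integral>\<^sup>+t. G s t \<partial>lborel) = 0" for s
      proof (cases "s \<in> {a..<b}")
        case True
        then have "G s t = 0" for t using len[of s t] False by (auto simp: G_def)
        then show ?thesis by simp
      qed (auto simp: b_def)
      then show ?thesis by (simp only: nn_integral_const) simp
    qed
  qed
  \<comment> \<open>\<open>step\<close> charges the starts in one link to the increment of V over
    two links, so the bounds telescope as two overlapping sums; hence the factor 2 in the
    conclusion. The number n bounds how many links of length at least \<rho> fit between a and
    S.\<close>
  have claim: "\<Phi> a \<le> ennreal (c * (V S - V a + (V S - V (nxt a))))" if "0 \<le> a" "a \<le> S" "S - a < real n * \<rho>" for n a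
    using that
  proof (induction n arbitrary: a)
    case 0
    then show ?case by auto
  next
    case (Suc n)
    show ?case
    proof (cases "Y a = {}")
      case True
      have "indicator {a..} s * (\<integral>\<^sup>+t. G s t \<partial>lborel) = 0" for s
      proof (cases "a \<le> s")
        case a: True
        then have "G s t = 0" for t using adm_Y[of s t a] True Suc.prems by (auto simp: G_def)
        then show ?thesis by simp
      qed auto
      then show ?thesis unfolding \<Phi>_def by (simp only: nn_integral_const) simp
    next
      case False
      define b where "b = nxt a"
      have b: "b \<in> Y a" "b \<le> S" using False nxt[of a] Suc.prems by (auto simp: b_def)
      have b2: "a + \<rho> \<le> b" using Y_far b Suc.prems by auto
      have nb: "b \<le> nxt b" "nxt b \<le> S" using nxt[of b] b b2 Suc.prems \<rho> by auto
      have "\<Phi> a = (\<integral>\<^sup>+s. indicator {a..<b} s * (\<integral>\<^sup>+t. G s t \<partial>lborel) + indicator {b..} s * (\<integral>\<^sup>+t. G s t \<partial>lborel) \<partial>lborel)"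
        unfolding \<Phi>_def using b2 \<rho> by (intro nn_integral_cong) (auto simp: indicator_def)
      also have "\<dots> = (\<integral>\<^sup>+s. indicator {a..<b} s * (\<integral>\<^sup>+t. G s t \<partial>lborel) \<partial>lborel) + \<Phi> b"
        unfolding \<Phi>_def by (subst nn_integral_add) auto
      also have "\<dots> \<le> ennreal (c * (V (nxt b) - V a)) + ennreal (c * (V S - V b + (V S - V (nxt b))))"
        using step[of a] Suc.prems b b2 \<rho> by (intro add_mono Suc.IH) (auto simp: b_def algebra_simps)
      also have "\<dots> = ennreal (c * (V (nxt b) - V a) + c * (V S - V b + (V S - V (nxt b))))"
        using c Vmono[of a "nxt b"] Vmono[of b S] Vmono[of "nxt b" S] Suc.prems b b2 \<rho> nb
        by (intro ennreal_plus[symmetric] mult_nonneg_nonneg) auto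
      also have "\<dots> = ennreal (c * (V S - V a + (V S - V b)))" by (simp add: algebra_simps)
      finally show ?thesis by (simp add: b_def)
    qed
  qed
  obtain n where n: "S < real n * \<rho>" using reals_Archimedean3[OF \<rho>] by blast
  have "(\<integral>\<^sup>+s. (\<integral>\<^sup>+t. (if adm s t then ennreal (t powr (\<gamma> - 1)) else 0) \<partial>lborel) \<partial>lborel) = \<Phi> 0"
    unfolding \<Phi>_def G_def by (intro nn_integral_cong) (auto simp: indicator_def adm_def)
  also have "\<dots> \<le> ennreal (c * (V S - V 0 + (V S - V (nxt 0))))"
    using n S by (intro claim[of 0 n]) auto
  also have "\<dots> \<le> ennreal (c * (2 * (V S - V 0)))"
    using c nxt[of 0] S Vmono[of 0 "nxt 0"] by (intro ennreal_leI mult_left_mono) auto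
  finally show ?thesis by (simp add: c_def)
qed

text \<open>The chain argument is run with V the distribution function of h restricted to
  [0, 2 * T]. A measure with a density has no atoms, so V is continuous, and first admissible end
  points exist. If the mass is infinite, so is the right side.\<close>

lemma one_dim_neg:
  fixes h :: "real \<Rightarrow> ennreal"
  assumes [measurable]: "h \<in> borel_measurable borel" and \<gamma>: "\<gamma> < -1" and T: "T > 0"
  shows "seg_energy \<gamma> T h
    \<le> ennreal (2 / \<bar>\<gamma>\<bar> * (1 + 1 / \<bar>\<gamma> + 1\<bar>)) * (\<integral>\<^sup>+r\<in>{0..2*T}. h r \<partial>lborel)"
proof -
  define m where "m = (\<integral>\<^sup>+r\<in>{0..2*T}. h r \<partial>lborel)"
  have c: "2 / \<bar>\<gamma>\<bar> * (1 + 1 / \<bar>\<gamma> + 1\<bar>) > 0"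
    using \<gamma> by (intro mult_pos_pos add_pos_pos; simp)
  show ?thesis
  proof (cases "m = \<infinity>")
    case True
    moreover have "ennreal (2 / \<bar>\<gamma>\<bar> * (1 + 1 / \<bar>\<gamma> + 1\<bar>)) \<noteq> 0"
      using c unfolding ennreal_eq_0_iff by linarith
    ultimately have "ennreal (2 / \<bar>\<gamma>\<bar> * (1 + 1 / \<bar>\<gamma> + 1\<bar>)) * m = \<top>"
      by (simp only: ennreal_mult_eq_top_iff) simp
    then show ?thesis by (simp only: m_def top_greatest)
  next
    case False
    define \<mu> where "\<mu> = density lborel (\<lambda>r. h r * indicator {0..2*T} r)"
    have m: "emeasure \<mu> UNIV = m" by (simp add: \<mu>_def emeasure_density m_def)
    have sp: "space \<mu> = UNIV" "sets \<mu> = sets borel" by (simp_all add: \<mu>_def)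
    interpret finite_borel_measure \<mu>
      using False sp m by (simp add: finite_borel_measure_def finite_borel_measure_axioms_def finite_measureI)
    have null: "emeasure \<mu> {x} = 0" for x
    proof -
      have "{x} \<in> null_sets lborel" by (auto simp: null_sets_def)
      moreover have "absolutely_continuous lborel \<mu>"
        unfolding \<mu>_def by (rule absolutely_continuousI_density) measurable
      ultimately show ?thesis by (meson absolutely_continuous_def null_setsD1 subsetD)
    qed
    have cont: "continuous_on A (cdf \<mu>)" for A
      using null by (intro continuous_at_imp_continuous_on) (auto simp: isCont_cdf measure_def)
    have mono: "mono_on A (cdf \<mu>)" for A
      by (intro mono_onI cdf_nondecreasing)
    \<comment> \<open>Differences of the distribution function measure half-open intervals; the
      missing left end point has mass 0.\<close>
    have Ieq: "(\<integral>\<^sup>+r\<in>{s..s+t}. h r \<partial>lborel) = ennreal (cdf \<mu> (s + t) - cdf \<mu> s)"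
      if "0 \<le> s" "0 < t" "s + t \<le> 2 * T" for s t
    proof -
      have "(\<integral>\<^sup>+r\<in>{s..s+t}. h r \<partial>lborel) = emeasure \<mu> ({s} \<union> {s<..s+t})"
        using that unfolding \<mu>_def
        by (subst emeasure_density) (auto intro!: nn_integral_cong simp: indicator_def)
      also have "\<dots> = emeasure \<mu> {s} + emeasure \<mu> {s<..s+t}"
        by (intro plus_emeasure[symmetric]) (auto simp: \<mu>_def)
      also have "\<dots> = ennreal (cdf \<mu> (s + t) - cdf \<mu> s)"
        using that null by (simp add: cdf_diff_eq emeasure_eq_measure)
      finally show ?thesis .
    qed
    have cdf0: "cdf \<mu> 0 = 0"
    proof -
      have "emeasure \<mu> {..0} = emeasure \<mu> {0}"
        unfolding \<mu>_def using T
        by (subst (1 2) emeasure_density; (intro nn_integral_cong)?) (auto split: split_indicator)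
      then show ?thesis using null by (simp add: cdf_def measure_def)
    qed
    have cdfT: "ennreal (cdf \<mu> (2*T)) = m"
    proof -
      have "emeasure \<mu> {..2*T} = m"
        unfolding m_def \<mu>_def by (auto simp: emeasure_density intro!: nn_integral_cong split: split_indicator)
      then show ?thesis by (simp add: cdf_def emeasure_eq_measure)
    qed
    have "seg_energy \<gamma> T h
      \<le> (\<integral>\<^sup>+s. (\<integral>\<^sup>+t. (if 0 < t \<and> 0 \<le> s \<and> s + t \<le> 2 * T \<and> t powr (\<gamma> + 1) < cdf \<mu> (s + t) - cdf \<mu> s
            then ennreal (t powr (\<gamma> - 1)) else 0) \<partial>lborel) \<partial>lborel)"
    proof (rule nn_integral_mono)
      fix s :: real
      show "indicator {0..T} s * (\<integral>\<^sup>+t. indicator {0<..T} t *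
        seg_weight \<gamma> h s t \<partial>lborel)
        \<le> (\<integral>\<^sup>+t. (if 0 < t \<and> 0 \<le> s \<and> s + t \<le> 2 * T \<and> t powr (\<gamma> + 1) < cdf \<mu> (s + t) - cdf \<mu> s
            then ennreal (t powr (\<gamma> - 1)) else 0) \<partial>lborel)"
      proof (cases "s \<in> {0..T}")
        case True
        have "indicator {0<..T} t *
          seg_weight \<gamma> h s t
          \<le> (if 0 < t \<and> 0 \<le> s \<and> s + t \<le> 2 * T \<and> t powr (\<gamma> + 1) < cdf \<mu> (s + t) - cdf \<mu> s
            then ennreal (t powr (\<gamma> - 1)) else 0)" for t
        proof (cases "t \<in> {0<..T}")
          case t: True
          show ?thesis using True t by (subst Ieq) (auto simp: ennreal_less_iff)
        qed auto
        then show ?thesis using True by (auto intro!: nn_integral_mono)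
      qed auto
    qed
    also have "\<dots> \<le> ennreal (1 / \<bar>\<gamma>\<bar> * (1 + 1 / \<bar>\<gamma> + 1\<bar>) * (2 * (cdf \<mu> (2*T) - cdf \<mu> 0)))"
      using T by (intro one_dim_neg_chain \<gamma> cont mono) auto
    also have "\<dots> = ennreal (2 / \<bar>\<gamma>\<bar> * (1 + 1 / \<bar>\<gamma> + 1\<bar>)) * m"
      using c cdf_nonneg[of "2*T"] by (simp add: cdf0 cdfT[symmetric] ennreal_mult[symmetric])
    finally show ?thesis by (simp add: m_def)
  qed
qed

subsection \<open>Translations, dilations and the radial estimate\<close>

definition shift :: "nat \<Rightarrow> (nat \<Rightarrow> real) \<Rightarrow> real \<Rightarrow> (nat \<Rightarrow> real) \<Rightarrow> nat \<Rightarrow> real" where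
  "shift N z r x = (\<lambda>i\<in>{..<N}. x i + r * z i)"

definition dil :: "nat \<Rightarrow> real \<Rightarrow> (nat \<Rightarrow> real) \<Rightarrow> nat \<Rightarrow> real" where
  "dil N t x = (\<lambda>i\<in>{..<N}. t * x i)"

definition nrm :: "nat \<Rightarrow> (nat \<Rightarrow> real) \<Rightarrow> real" where
  "nrm N z = sqrt (\<Sum>i<N. (z i)\<^sup>2)"

lemma space_BN: "space (BN N) = sp N"
  by (simp add: BN_def sp_def space_PiM)

lemma product_sigma_finite_lborel: "product_sigma_finite (\<lambda>_::nat. lborel :: real measure)"
  by unfold_locales

lemma sigma_finite_BN: "sigma_finite_measure (BN N)"
proof -
  interpret product_sigma_finite "\<lambda>_::nat. lborel :: real measure" by (rule product_sigma_finite_lborel)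
  show ?thesis unfolding BN_def by (rule sigma_finite) simp
qed

interpretation BN: sigma_finite_measure "BN N" for N by (rule sigma_finite_BN)

lemma nn_Fubini:
  assumes "sigma_finite_measure A" "sigma_finite_measure B"
    and "(\<lambda>(x, y). f x y) \<in> borel_measurable (A \<Otimes>\<^sub>M B)"
  shows "(\<integral>\<^sup>+x. (\<integral>\<^sup>+y. f x y \<partial>B) \<partial>A) = (\<integral>\<^sup>+y. (\<integral>\<^sup>+x. f x y \<partial>A) \<partial>B)"
proof -
  interpret pair_sigma_finite A B using assms by (simp add: pair_sigma_finite_def)
  show ?thesis using Fubini'[OF assms(3)] by simp
qed

lemmas Fubini_BN_BN = nn_Fubini[OF sigma_finite_BN sigma_finite_BN]
lemmas Fubini_lborel_BN = nn_Fubini[OF lborel.sigma_finite_measure_axioms sigma_finite_BN]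

lemma component_measurable:
  assumes "f \<in> measurable M (BN N)" "i < N"
  shows "(\<lambda>\<omega>. f \<omega> i) \<in> borel_measurable M"
  using measurable_compose[OF assms(1)[unfolded BN_def] measurable_component_singleton[of i "{..<N}" "\<lambda>_. lborel"]] assms(2)
  by simp

lemma measurable_into_BN:
  assumes "\<And>i. i < N \<Longrightarrow> (\<lambda>\<omega>. f \<omega> i) \<in> borel_measurable M"
  shows "(\<lambda>\<omega>. \<lambda>i\<in>{..<N}. f \<omega> i) \<in> measurable M (BN N)"
  unfolding BN_def by (intro measurable_restrict) (use assms in auto)

lemma shift_measurable [measurable (raw)]:
  assumes [measurable]: "f \<in> measurable M (BN N)" "g \<in> borel_measurable M" "h \<in> measurable M (BN N)"
  shows "(\<lambda>\<omega>. shift N (f \<omega>) (g \<omega>) (h \<omega>)) \<in> measurable M (BN N)"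
  unfolding shift_def
proof (rule measurable_into_BN)
  fix i assume "i < N"
  then have [measurable]: "(\<lambda>\<omega>. f \<omega> i) \<in> borel_measurable M" "(\<lambda>\<omega>. h \<omega> i) \<in> borel_measurable M"
    using component_measurable assms by blast+
  show "(\<lambda>\<omega>. h \<omega> i + g \<omega> * f \<omega> i) \<in> borel_measurable M" by measurable
qed

lemma dil_measurable [measurable (raw)]:
  assumes [measurable]: "g \<in> borel_measurable M" "h \<in> measurable M (BN N)"
  shows "(\<lambda>\<omega>. dil N (g \<omega>) (h \<omega>)) \<in> measurable M (BN N)"
  unfolding dil_def
proof (rule measurable_into_BN)
  fix i assume "i < N"
  then have [measurable]: "(\<lambda>\<omega>. h \<omega> i) \<in> borel_measurable M"
    using component_measurable assms by blast
  show "(\<lambda>\<omega>. g \<omega> * h \<omega> i) \<in> borel_measurable M" by measurable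
qed

lemma coordinate_measurable: "i < N \<Longrightarrow> (\<lambda>x. x i) \<in> borel_measurable (BN N)"
  using component_measurable[of "\<lambda>x. x" "BN N" N i] by simp

lemma shift_measurable' [measurable]: "shift N z r \<in> measurable (BN N) (BN N)"
  unfolding shift_def
  by (intro measurable_into_BN borel_measurable_add coordinate_measurable) auto

lemma dil_measurable' [measurable]: "dil N t \<in> measurable (BN N) (BN N)"
  unfolding dil_def
  by (intro measurable_into_BN borel_measurable_times coordinate_measurable) auto

lemma nrm_measurable [measurable]: "nrm N \<in> borel_measurable (BN N)"
proof -
  have [measurable]: "(\<lambda>z. \<Sum>i<N. (z i)\<^sup>2) \<in> borel_measurable (BN N)"
    by (intro borel_measurable_sum borel_measurable_power coordinate_measurable) auto
  have "(\<lambda>z. nrm N z) \<in> borel_measurable (BN N)" unfolding nrm_def by measurable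
  then show ?thesis by simp
qed

lemma shift_in_sp: "shift N z r x \<in> sp N"
  by (simp add: shift_def sp_def)

lemma shift_shift: "shift N z s (shift N z r x) = shift N z (r + s) x"
  by (auto simp: shift_def fun_eq_iff algebra_simps)

lemma shift_dil: "shift N (dil N t z) r x = shift N z (r * t) x"
  by (auto simp: shift_def dil_def fun_eq_iff algebra_simps)

lemma nrm_nonneg: "nrm N z \<ge> 0"
  by (simp add: nrm_def sum_nonneg)

lemma nrm_dil: "t \<ge> 0 \<Longrightarrow> nrm N (dil N t z) = t * nrm N z"
  by (simp add: nrm_def dil_def power_mult_distrib sum_distrib_left[symmetric] real_sqrt_mult)

lemma emeasure_BN_box:
  assumes "\<And>i. i < N \<Longrightarrow> A i \<in> sets borel"
  shows "emeasure (BN N) (PiE {..<N} A) = (\<Prod>i<N. emeasure lborel (A i))"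
proof -
  interpret product_sigma_finite "\<lambda>_::nat. lborel :: real measure" by (rule product_sigma_finite_lborel)
  show ?thesis unfolding BN_def using assms by (intro emeasure_PiM) auto
qed

lemma BN_eqI:
  assumes "sets P = sets (BN N)"
    and "\<And>A. (\<And>i. i < N \<Longrightarrow> A i \<in> sets borel) \<Longrightarrow> emeasure P (PiE {..<N} A) = (\<Prod>i<N. emeasure lborel (A i))"
  shows "P = BN N"
proof -
  interpret product_sigma_finite "\<lambda>_::nat. lborel :: real measure" by (rule product_sigma_finite_lborel)
  show ?thesis unfolding BN_def using assms by (intro PiM_eqI) (auto simp: BN_def)
qed

lemma box_in_sets_BN [measurable]:
  assumes "\<And>i. i < N \<Longrightarrow> A i \<in> sets borel"
  shows "PiE {..<N} A \<in> sets (BN N)"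
  unfolding BN_def using assms by (intro sets_PiM_I_finite) auto

lemma vimage_box:
  assumes "\<And>x. F x = (\<lambda>i\<in>{..<N}. f i (x i))"
  shows "F -` PiE {..<N} A \<inter> space (BN N) = PiE {..<N} (\<lambda>i. f i -` A i)"
  unfolding space_BN sp_def assms by (auto simp: PiE_iff extensional_def)

lemma distr_shift: "distr (BN N) (BN N) (shift N z r) = BN N"
proof (rule BN_eqI)
  fix A :: "nat \<Rightarrow> real set" assume A: "\<And>i. i < N \<Longrightarrow> A i \<in> sets borel"
  define f where "f = (\<lambda>i x. r * z i + x)"
  have [measurable]: "f i \<in> borel_measurable borel" for i unfolding f_def by measurable
  have "emeasure (distr (BN N) (BN N) (shift N z r)) (PiE {..<N} A)
      = emeasure (BN N) (PiE {..<N} (\<lambda>i. f i -` A i))"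
    using A by (subst emeasure_distr) (auto simp: vimage_box[where F="shift N z r" and f=f] shift_def f_def add.commute)
  also have "\<dots> = (\<Prod>i<N. emeasure lborel (f i -` A i))"
    using measurable_sets[of "f _" borel borel] A by (intro emeasure_BN_box) auto
  also have "\<dots> = (\<Prod>i<N. emeasure lborel (A i))"
  proof (intro prod.cong refl)
    fix i assume i: "i \<in> {..<N}"
    have "emeasure lborel (A i) = emeasure (distr lborel borel ((+) (r * z i))) (A i)"
      by (simp add: lborel_distr_plus)
    also have "\<dots> = emeasure lborel (f i -` A i)"
      using A i by (subst emeasure_distr) (auto simp: f_def)
    finally show "emeasure lborel (f i -` A i) = emeasure lborel (A i)" ..
  qed
  finally show "emeasure (distr (BN N) (BN N) (shift N z r)) (PiE {..<N} A) = (\<Prod>i<N. emeasure lborel (A i))" .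
qed simp

lemma nn_integral_shift:
  assumes [measurable]: "f \<in> borel_measurable (BN N)"
  shows "(\<integral>\<^sup>+x. f (shift N z r x) \<partial>BN N) = (\<integral>\<^sup>+x. f x \<partial>BN N)"
  by (subst (2) distr_shift[of N z r, symmetric]) (simp add: nn_integral_distr)

lemma scale_distr_dil:
  assumes t: "t > 0"
  shows "scale_measure (ennreal (t ^ N)) (distr (BN N) (BN N) (dil N t)) = BN N"
proof (rule BN_eqI)
  fix A :: "nat \<Rightarrow> real set" assume A: "\<And>i. i < N \<Longrightarrow> A i \<in> sets borel"
  define f where "f = (\<lambda>(i::nat) (x::real). t * x)"
  have [measurable]: "f i \<in> borel_measurable borel" for i unfolding f_def by measurable
  have "emeasure (distr (BN N) (BN N) (dil N t)) (PiE {..<N} A)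
      = emeasure (BN N) (PiE {..<N} (\<lambda>i. f i -` A i))"
    using A by (subst emeasure_distr) (auto simp: vimage_box[where F="dil N t" and f=f] dil_def f_def)
  also have "\<dots> = (\<Prod>i<N. emeasure lborel (f i -` A i))"
    using measurable_sets[of "f _" borel borel] A by (intro emeasure_BN_box) auto
  finally have "emeasure (scale_measure (ennreal (t ^ N)) (distr (BN N) (BN N) (dil N t))) (PiE {..<N} A)
     = (\<Prod>i<N. ennreal t * emeasure lborel (f i -` A i))"
    using t by (simp add: prod.distrib ennreal_power)
  also have "\<dots> = (\<Prod>i<N. emeasure lborel (A i))"
  proof (intro prod.cong refl)
    fix i assume i: "i \<in> {..<N}"
    have "emeasure lborel (A i) = emeasure (density (distr lborel borel ((*) t)) (\<lambda>_. ennreal \<bar>t\<bar>)) (A i)"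
      using lborel_distr_mult'[of t] t by simp
    also have "\<dots> = ennreal t * emeasure (distr lborel borel ((*) t)) (A i)"
      using A i t by (subst emeasure_density_const) auto
    also have "emeasure (distr lborel borel ((*) t)) (A i) = emeasure lborel (f i -` A i)"
      using A i by (subst emeasure_distr) (auto simp: f_def)
    finally show "ennreal t * emeasure lborel (f i -` A i) = emeasure lborel (A i)" ..
  qed
  finally show "emeasure (scale_measure (ennreal (t ^ N)) (distr (BN N) (BN N) (dil N t))) (PiE {..<N} A) = (\<Prod>i<N. emeasure lborel (A i))" .
qed simp

lemma nn_integral_dil:
  assumes [measurable]: "f \<in> borel_measurable (BN N)" and t: "t > 0"
  shows "(\<integral>\<^sup>+x. f x \<partial>BN N) = ennreal (t ^ N) * (\<integral>\<^sup>+x. f (dil N t x) \<partial>BN N)"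
  by (subst scale_distr_dil[OF t, symmetric]) (simp add: nn_integral_scale_measure nn_integral_distr)

text \<open>A substitute for polar coordinates. For z \<noteq> 0 the set of t with |z| / q \<le> t
  \<le> |z| has measure at least 1 - 1 / q with respect to dt / t. Hence the integral of f is at
  most 1 / (1 - 1 / q) times the integral over dt / t of f restricted to the shell t \<le> |z| \<le>
  q t. The dilation z = t k turns this into the fixed shell 1 \<le> |k| \<le> q at the price t ^ N,
  and after exchanging the integrals B bounds the contribution of each ray.\<close>

lemma radial_estimate:
  assumes [measurable]: "f \<in> borel_measurable (BN N)" and N: "N \<ge> 1"
    and f0: "\<And>z. nrm N z = 0 \<Longrightarrow> f z = 0"
    and B: "\<And>k. k \<in> sp N \<Longrightarrow> nrm N k \<ge> 1 \<Longrightarrow> (\<integral>\<^sup>+t. indicator {0<..} t * (ennreal (t ^ N / t) * f (dil N t k)) \<partial>lborel) \<le> B"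
  shows "(\<integral>\<^sup>+z. f z \<partial>BN N) \<le> ennreal (2 * exp 1 * sphere_area N) * B"
proof -
  \<comment> \<open>With this q one has 1 - 1 / q = 1 / (N + 1) and q ^ N \<le> e. The loss N + 1
    \<le> 2 N and the volume of the unit ball combine to twice the sphere area, so that the factor 2
    e is absolute.\<close>
  define q where "q = 1 + 1 / real N"
  have q: "q > 1" using N by (simp add: q_def)
  have pt: "f z \<le> ennreal (N + 1) * (\<integral>\<^sup>+t. indicator {0<..} t * ennreal (1 / t) * (if t \<le> nrm N z \<and> nrm N z \<le> q * t then f z else 0) \<partial>lborel)" for z
  proof (cases "nrm N z = 0")
    case False
    define n where "n = nrm N z"
    have n: "n > 0" using False nrm_nonneg[of N z] by (simp add: n_def)
    have nq: "n / q \<le> n" "n / q > 0" using n q by (auto simp: field_simps)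
    have "f z = ennreal (N + 1) * (ennreal ((n - n / q) * (1 / n)) * f z)"
    proof -
      have "real (N + 1) * ((n - n / q) * (1 / n)) = 1"
        using n N by (simp add: q_def field_simps)
      then show ?thesis
        using n nq by (simp add: mult.assoc[symmetric] ennreal_mult[symmetric] del: of_nat_add of_nat_Suc)
    qed
    also have "ennreal ((n - n / q) * (1 / n)) * f z = (\<integral>\<^sup>+t. indicator {n / q..n} t * (ennreal (1 / n) * f z) \<partial>lborel)"
      using n nq by (subst nn_integral_multc) (auto simp: ennreal_mult'[symmetric] mult.assoc[symmetric])
    also have "\<dots> \<le> (\<integral>\<^sup>+t. indicator {0<..} t * ennreal (1 / t) * (if t \<le> n \<and> n \<le> q * t then f z else 0) \<partial>lborel)"
    proof (rule nn_integral_mono)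
      fix t :: real
      have "t > 0 \<and> n \<le> q * t \<and> 1 / n \<le> 1 / t" if "n / q \<le> t" "t \<le> n"
      proof -
        have "t > 0" using that nq by linarith
        moreover have "n \<le> q * t" using that q by (simp add: field_simps)
        ultimately show ?thesis using that n by (simp add: frac_le)
      qed
      then show "indicator {n / q..n} t * (ennreal (1 / n) * f z)
        \<le> indicator {0<..} t * ennreal (1 / t) * (if t \<le> n \<and> n \<le> q * t then f z else 0)"
        by (auto simp: indicator_def intro!: mult_right_mono ennreal_leI)
    qed
    finally show ?thesis by (simp add: n_def mult_left_mono)
  qed (simp add: f0)
  have vol: "ennreal (N + 1) * emeasure (BN N) {x \<in> sp N. nrm N x \<le> q} \<le> ennreal (2 * exp 1 * sphere_area N)"
  proof -
    have "emeasure (BN N) {x \<in> sp N. nrm N x \<le> q} = ennreal (unit_ball_vol (real N) * q ^ N)"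
    proof -
      have "{x \<in> sp N. nrm N x \<le> q} = {f. sqrt (\<Sum>i\<in>{..<N}. (f i)\<^sup>2) \<le> q} \<inter> space (BN N)"
        by (auto simp: space_BN nrm_def)
      then show ?thesis using emeasure_cball_aux[of "{..<N}" q] q by (simp add: BN_def)
    qed
    also have "ennreal (N + 1) * \<dots> \<le> ennreal (2 * exp 1 * sphere_area N)"
    proof -
      have "q ^ N \<le> exp (1 / real N) ^ N"
        using q exp_ge_add_one_self[of "1 / real N"] by (intro power_mono) (auto simp: q_def)
      also have "\<dots> = exp 1" using N by (simp add: exp_of_nat_mult[symmetric])
      finally have "(real N + 1) * (unit_ball_vol N * q ^ N) \<le> (2 * real N) * (unit_ball_vol N * exp 1)"
        using N q by (intro mult_mono mult_left_mono) auto
      also have "real N * unit_ball_vol N = sphere_area N"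
      proof -
        have "real N / 2 \<notin> \<int>\<^sub>\<le>\<^sub>0" using N by (auto dest: nonpos_Ints_nonpos)
        from Gamma_plus1[OF this] have "Gamma (real N / 2 + 1) = real N / 2 * Gamma (real N / 2)"
          by (simp add: add.commute)
        then show ?thesis using N by (simp only: unit_ball_vol_def sphere_area_def) simp
      qed
      hence "(2 * real N) * (unit_ball_vol N * exp 1) = 2 * exp 1 * sphere_area N" by simp
      finally have *: "(real N + 1) * (unit_ball_vol N * q ^ N) \<le> 2 * exp 1 * sphere_area N" .
      have "real (N + 1) = real N + 1" by simp
      then have "ennreal (real (N + 1)) * ennreal (unit_ball_vol N * q ^ N) = ennreal ((real N + 1) * (unit_ball_vol N * q ^ N))"
        using q by (simp only: ennreal_mult[symmetric]) (simp add: ennreal_mult)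
      then show ?thesis using * by (simp only: ennreal_leI)
    qed
    finally show ?thesis .
  qed
  define g where "g = (\<lambda>t z. indicator {0<..} t * ennreal (1 / t) * (if t \<le> nrm N z \<and> nrm N z \<le> q * t then f z else 0))"
  have [measurable]: "(\<lambda>(t, z). g t z) \<in> borel_measurable (lborel \<Otimes>\<^sub>M BN N)"
    "(\<lambda>(z, t). g t z) \<in> borel_measurable (BN N \<Otimes>\<^sub>M lborel)"
    unfolding g_def by measurable
  define g' where "g' = (\<lambda>t k. indicator {0<..} t * (ennreal (t ^ N / t) * (if 1 \<le> nrm N k \<and> nrm N k \<le> q then f (dil N t k) else 0)))"
  have [measurable]: "(\<lambda>(t, z). g' t z) \<in> borel_measurable (lborel \<Otimes>\<^sub>M BN N)"
    unfolding g'_def by measurable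
  have "(\<integral>\<^sup>+z. f z \<partial>BN N) \<le> (\<integral>\<^sup>+z. ennreal (N + 1) * (\<integral>\<^sup>+t. g t z \<partial>lborel) \<partial>BN N)"
    unfolding g_def by (intro nn_integral_mono pt)
  also have "\<dots> = ennreal (N + 1) * (\<integral>\<^sup>+t. (\<integral>\<^sup>+z. g t z \<partial>BN N) \<partial>lborel)"
    by (subst nn_integral_cmult) (auto simp: Fubini_lborel_BN)
  finally have 1: "(\<integral>\<^sup>+z. f z \<partial>BN N) \<le> ennreal (N + 1) * (\<integral>\<^sup>+t. (\<integral>\<^sup>+z. g t z \<partial>BN N) \<partial>lborel)" .
  have "(\<integral>\<^sup>+t. (\<integral>\<^sup>+z. g t z \<partial>BN N) \<partial>lborel) = (\<integral>\<^sup>+t. (\<integral>\<^sup>+k. g' t k \<partial>BN N) \<partial>lborel)"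
  proof (rule nn_integral_cong)
    fix t :: real
    show "(\<integral>\<^sup>+z. g t z \<partial>BN N) = (\<integral>\<^sup>+k. g' t k \<partial>BN N)"
    proof (cases "t > 0")
      case True
      have "(\<integral>\<^sup>+z. g t z \<partial>BN N) = (\<integral>\<^sup>+k. ennreal (t ^ N) * g t (dil N t k) \<partial>BN N)"
        using True by (subst nn_integral_dil[of _ N t]) (auto simp: nn_integral_cmult)
      also have "\<dots> = (\<integral>\<^sup>+k. g' t k \<partial>BN N)"
        using True q by (intro nn_integral_cong)
          (auto simp: g_def g'_def nrm_dil mult.assoc[symmetric] ennreal_mult[symmetric] mult.commute[of q])
      finally show ?thesis .
    qed (simp add: g_def g'_def)
  qed
  also have "\<dots> = (\<integral>\<^sup>+k. (\<integral>\<^sup>+t. g' t k \<partial>lborel) \<partial>BN N)"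
    by (intro Fubini_lborel_BN) measurable
  also have "\<dots> \<le> (\<integral>\<^sup>+k. B * indicator {x \<in> sp N. nrm N x \<le> q} k \<partial>BN N)"
  proof (rule nn_integral_mono)
    fix k assume k: "k \<in> space (BN N)"
    show "(\<integral>\<^sup>+t. g' t k \<partial>lborel) \<le> B * indicator {x \<in> sp N. nrm N x \<le> q} k"
    proof (cases "1 \<le> nrm N k \<and> nrm N k \<le> q")
      case True
      then show ?thesis using B[of k] k by (simp add: g'_def space_BN)
    next
      case False
      then have "g' t k = 0" for t by (auto simp: g'_def)
      then show ?thesis by simp
    qed
  qed
  also have "\<dots> = B * emeasure (BN N) {x \<in> sp N. nrm N x \<le> q}"
    unfolding space_BN[symmetric] by (intro nn_integral_cmult_indicator) measurable
  finally have "ennreal (N + 1) * (\<integral>\<^sup>+t. (\<integral>\<^sup>+z. g t z \<partial>BN N) \<partial>lborel)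
      \<le> ennreal (N + 1) * (B * emeasure (BN N) {x \<in> sp N. nrm N x \<le> q})"
    by (intro mult_left_mono) auto
  with 1 have "(\<integral>\<^sup>+z. f z \<partial>BN N) \<le> (ennreal (N + 1) * emeasure (BN N) {x \<in> sp N. nrm N x \<le> q}) * B"
    by (simp only: mult_ac)
  also have "\<dots> \<le> ennreal (2 * exp 1 * sphere_area N) * B"
    by (intro mult_right_mono vol) simp
  finally show ?thesis .
qed

text \<open>The interface between the line and the space: from here on \<gamma> enters only through
  this inequality. The ranges \<gamma> > 0 and \<gamma> < -1 are treated together and separate again
  only in the constants.\<close>

definition line_bound :: "real \<Rightarrow> ennreal \<Rightarrow> bool" where
  "line_bound \<gamma> c \<longleftrightarrow> (\<forall>(h::real \<Rightarrow> ennreal) T. h \<in> borel_measurable borel \<longrightarrow> T > 0 \<longrightarrow>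
    seg_energy \<gamma> T h
    \<le> c * (\<integral>\<^sup>+r\<in>{0..2*T}. h r \<partial>lborel))"

lemma borel_measurable_interval_nn_integral [measurable (raw)]:
  fixes f :: "'a \<Rightarrow> real \<Rightarrow> ennreal"
  assumes [measurable]: "(\<lambda>(\<omega>, r). f \<omega> r) \<in> borel_measurable (M \<Otimes>\<^sub>M lborel)"
    "a \<in> borel_measurable M" "b \<in> borel_measurable M"
  shows "(\<lambda>\<omega>. \<integral>\<^sup>+r\<in>{a \<omega>..b \<omega>}. f \<omega> r \<partial>lborel) \<in> borel_measurable M"
proof -
  have "(\<lambda>\<omega>. \<integral>\<^sup>+r. (if a \<omega> \<le> r \<and> r \<le> b \<omega> then f \<omega> r else 0) \<partial>lborel) \<in> borel_measurable M"
    by measurable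
  also have "(\<lambda>\<omega>. \<integral>\<^sup>+r. (if a \<omega> \<le> r \<and> r \<le> b \<omega> then f \<omega> r else 0) \<partial>lborel) = (\<lambda>\<omega>. \<integral>\<^sup>+r\<in>{a \<omega>..b \<omega>}. f \<omega> r \<partial>lborel)"
    by (auto intro!: ext nn_integral_cong simp: indicator_def)
  finally show ?thesis .
qed

text \<open>By translation invariance the starting point of the segments may be averaged over
  \<open>[0, T]\<close> along the direction \<open>k\<close>, which replaces slicing by lines.\<close>

lemma direction_estimate:
  assumes [measurable]: "w \<in> borel_measurable (BN N)" and lb: "line_bound \<gamma> c" and k [measurable]: "k \<in> space (BN N)"
  shows "(\<integral>\<^sup>+t. indicator {0<..} t * (\<integral>\<^sup>+x. (if ennreal (t powr (\<gamma> + 1)) < (\<integral>\<^sup>+r\<in>{0..t}. w (shift N k r x) \<partial>lborel)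
      then ennreal (t powr (\<gamma> - 1)) else 0) \<partial>BN N) \<partial>lborel) \<le> 2 * c * (\<integral>\<^sup>+x. w x \<partial>BN N)"
proof -
  define G where "G = (\<lambda>s t x. (if ennreal (t powr (\<gamma> + 1)) < (\<integral>\<^sup>+r\<in>{s..s+t}. w (shift N k r x) \<partial>lborel)
      then ennreal (t powr (\<gamma> - 1)) else 0))"
  have [measurable]: "(\<lambda>(s, t, x). G s t x) \<in> borel_measurable (lborel \<Otimes>\<^sub>M lborel \<Otimes>\<^sub>M BN N)"
    unfolding G_def by measurable
  have [measurable]: "(\<lambda>p. G (fst (fst p)) (snd p) (snd (fst p))) \<in> borel_measurable ((lborel \<Otimes>\<^sub>M BN N) \<Otimes>\<^sub>M lborel)"
    unfolding G_def split_beta by measurable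
  have G_shift: "G 0 t (shift N k s x) = G s t x" for s t x
  proof -
    have "(\<integral>\<^sup>+r\<in>{s..s+t}. w (shift N k r x) \<partial>lborel) = (\<integral>\<^sup>+r\<in>{0..t}. w (shift N k r (shift N k s x)) \<partial>lborel)"
    proof (cases "x \<in> space (BN N)")
      case True
      note [measurable] = True
      have "(\<integral>\<^sup>+r. w (shift N k r x) * indicator {s..s+t} r \<partial>lborel)
        = (\<integral>\<^sup>+r. w (shift N k (s + r) x) * indicator {s..s+t} (s + r) \<partial>lborel)"
        using nn_integral_real_affine[of "\<lambda>r. w (shift N k r x) * indicator {s..s+t} r" 1 s] by simp
      also have "\<dots> = (\<integral>\<^sup>+r\<in>{0..t}. w (shift N k r (shift N k s x)) \<partial>lborel)"
        by (intro nn_integral_cong) (auto simp: shift_shift indicator_def)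
      finally show ?thesis .
    next
      \<comment> \<open>\<open>shift\<close> reads only the coordinates below N, so x may be
        replaced by its extensional restriction.\<close>
      case False
      have *: "shift N k r x = shift N k r (restrict x {..<N})" for r
        by (auto simp: shift_def fun_eq_iff)
      define x' where "x' = restrict x {..<N}"
      have [measurable]: "x' \<in> space (BN N)" by (simp add: x'_def space_BN sp_def)
      have "(\<integral>\<^sup>+r. w (shift N k r x') * indicator {s..s+t} r \<partial>lborel)
        = (\<integral>\<^sup>+r. w (shift N k (s + r) x') * indicator {s..s+t} (s + r) \<partial>lborel)"
        using nn_integral_real_affine[of "\<lambda>r. w (shift N k r x') * indicator {s..s+t} r" 1 s] by simp
      also have "\<dots> = (\<integral>\<^sup>+r\<in>{0..t}. w (shift N k r (shift N k s x')) \<partial>lborel)"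
        by (intro nn_integral_cong) (auto simp: shift_shift indicator_def)
      finally show ?thesis by (simp add: x'_def *[symmetric])
    qed
    then show ?thesis by (simp add: G_def)
  qed
  \<comment> \<open>Averaging over s in [0, T] multiplies the left side by T, while the line
    estimate integrates w over r in [0, 2 * T]. T cancels and the factor 2 remains, uniformly in
    T.\<close>
  have fin: "(\<integral>\<^sup>+t. indicator {0<..T} t * (\<integral>\<^sup>+x. G 0 t x \<partial>BN N) \<partial>lborel) \<le> 2 * c * (\<integral>\<^sup>+x. w x \<partial>BN N)" if T: "T > 0" for T
  proof -
    define L where "L = (\<integral>\<^sup>+t. indicator {0<..T} t * (\<integral>\<^sup>+x. G 0 t x \<partial>BN N) \<partial>lborel)"
    have "ennreal T * L = (\<integral>\<^sup>+s. indicator {0..T} s * L \<partial>lborel)"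
      using T by (simp add: nn_integral_multc)
    also have "\<dots> = (\<integral>\<^sup>+s. indicator {0..T} s * (\<integral>\<^sup>+t. indicator {0<..T} t * (\<integral>\<^sup>+x. G s t x \<partial>BN N) \<partial>lborel) \<partial>lborel)"
    proof (intro nn_integral_cong)
      fix s
      have "(\<integral>\<^sup>+x. G 0 t x \<partial>BN N) = (\<integral>\<^sup>+x. G s t x \<partial>BN N)" for t
        using nn_integral_shift[of "G 0 t" N k s] by (simp add: G_shift)
      then show "indicator {0..T} s * L = indicator {0..T} s * (\<integral>\<^sup>+t. indicator {0<..T} t * (\<integral>\<^sup>+x. G s t x \<partial>BN N) \<partial>lborel)"
        by (simp add: L_def)
    qed
    also have "\<dots> = (\<integral>\<^sup>+s. \<integral>\<^sup>+x. indicator {0..T} s * (\<integral>\<^sup>+t. indicator {0<..T} t * G s t x \<partial>lborel) \<partial>BN N \<partial>lborel)"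
      by (simp add: nn_integral_cmult[symmetric] Fubini_lborel_BN)
    also have "\<dots> = (\<integral>\<^sup>+x. \<integral>\<^sup>+s. indicator {0..T} s * (\<integral>\<^sup>+t. indicator {0<..T} t * G s t x \<partial>lborel) \<partial>lborel \<partial>BN N)"
      by (intro Fubini_lborel_BN) measurable
    also have "\<dots> \<le> (\<integral>\<^sup>+x. c * (\<integral>\<^sup>+r\<in>{0..2*T}. w (shift N k r x) \<partial>lborel) \<partial>BN N)"
    proof (rule nn_integral_mono)
      fix x assume [measurable]: "x \<in> space (BN N)"
      show "(\<integral>\<^sup>+s. indicator {0..T} s * (\<integral>\<^sup>+t. indicator {0<..T} t * G s t x \<partial>lborel) \<partial>lborel)
        \<le> c * (\<integral>\<^sup>+r\<in>{0..2*T}. w (shift N k r x) \<partial>lborel)"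
        unfolding G_def using lb T by (simp add: line_bound_def)
    qed
    also have "\<dots> = c * (\<integral>\<^sup>+r. (\<integral>\<^sup>+x. w (shift N k r x) * indicator {0..2*T} r \<partial>BN N) \<partial>lborel)"
      by (subst nn_integral_cmult) (auto simp: Fubini_lborel_BN)
    also have "\<dots> = c * (\<integral>\<^sup>+r. (\<integral>\<^sup>+x. w x \<partial>BN N) * indicator {0..2*T} r \<partial>lborel)"
      by (simp add: nn_integral_multc nn_integral_shift)
    also have "\<dots> = ennreal T * (2 * c * (\<integral>\<^sup>+x. w x \<partial>BN N))"
      using T by (simp add: nn_integral_cmult ennreal_mult mult_ac)
    finally show ?thesis using T
      by (simp add: L_def[symmetric] ennreal_mult_le_mult_iff)
  qed
  define Q where "Q = (\<lambda>t. (\<integral>\<^sup>+x. G 0 t x \<partial>BN N))"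
  have [measurable]: "Q \<in> borel_measurable borel" unfolding Q_def by measurable
  have "(\<integral>\<^sup>+t. indicator {0<..} t * Q t \<partial>lborel) = (\<integral>\<^sup>+t. (SUP n. indicator {0<..real (Suc n)} t * Q t) \<partial>lborel)"
  proof (intro nn_integral_cong antisym)
    fix t :: real
    obtain n where "t \<le> real (Suc n)" using real_arch_simple[of t] by (metis le_SucI of_nat_le_iff order_trans order_refl)
    then show "indicator {0<..} t * Q t \<le> (SUP n. indicator {0<..real (Suc n)} t * Q t)"
      by (intro SUP_upper2[of n]) (auto simp: indicator_def)
    show "(SUP n. indicator {0<..real (Suc n)} t * Q t) \<le> indicator {0<..} t * Q t"
      by (intro SUP_least) (auto simp: indicator_def)
  qed
  also have "\<dots> = (SUP n. (\<integral>\<^sup>+t. indicator {0<..real (Suc n)} t * Q t \<partial>lborel))"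
    by (intro nn_integral_monotone_convergence_SUP)
      (auto simp: incseq_def le_fun_def indicator_def)
  also have "\<dots> \<le> 2 * c * (\<integral>\<^sup>+x. w x \<partial>BN N)"
    using fin unfolding Q_def by (intro SUP_least) simp
  finally show ?thesis unfolding Q_def G_def by simp
qed

text \<open>On the ray z = t k the norm is homogeneous, and rescaling r by t turns the condition
  into that of a segment of length t for the function w / b, where b = a |k| powr \<gamma>. The
  remaining powers of |k| combine to |k| powr (- N), which is at most 1 on the rays |k| \<ge> 1 that
  \<open>radial_estimate\<close> asks about.\<close>

lemma level_set_estimate:
  assumes [measurable]: "w \<in> borel_measurable (BN N)" and N: "N \<ge> 1" and lb: "line_bound \<gamma> c" and a: "a > 0"
  shows "(\<integral>\<^sup>+z. (\<integral>\<^sup>+x. (if ennreal (a * nrm N z powr \<gamma>) < (\<integral>\<^sup>+r\<in>{0..1}. w (shift N z r x) \<partial>lborel)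
      then ennreal (nrm N z powr (\<gamma> - N)) else 0) \<partial>BN N) \<partial>BN N)
    \<le> ennreal (4 * exp 1 * sphere_area N / a) * c * (\<integral>\<^sup>+x. w x \<partial>BN N)"
proof -
  define f where "f = (\<lambda>z. (\<integral>\<^sup>+x. (if ennreal (a * nrm N z powr \<gamma>) < (\<integral>\<^sup>+r\<in>{0..1}. w (shift N z r x) \<partial>lborel)
      then ennreal (nrm N z powr (\<gamma> - N)) else 0) \<partial>BN N))"
  have [measurable]: "f \<in> borel_measurable (BN N)" unfolding f_def by measurable
  have "(\<integral>\<^sup>+z. f z \<partial>BN N) \<le> ennreal (2 * exp 1 * sphere_area N) * (2 * c * (ennreal (1 / a) * (\<integral>\<^sup>+x. w x \<partial>BN N)))"
  proof (rule radial_estimate[OF _ N])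
    show "f z = 0" if "nrm N z = 0" for z using that by (simp add: f_def cong: if_cong)
  next
    fix k assume k: "k \<in> sp N" and k1: "nrm N k \<ge> 1"
    have [measurable]: "k \<in> space (BN N)" using k by (simp add: space_BN)
    define b where "b = a * nrm N k powr \<gamma>"
    have b: "b > 0" using a k1 by (auto simp: b_def)
    have cond: "ennreal (a * nrm N (dil N t k) powr \<gamma>) < (\<integral>\<^sup>+r\<in>{0..1}. w (shift N (dil N t k) r x) \<partial>lborel)
       \<longleftrightarrow> ennreal (t powr (\<gamma> + 1)) < (\<integral>\<^sup>+r\<in>{0..t}. ennreal (1 / b) * w (shift N k r x) \<partial>lborel)"
      if t: "t > 0" and [measurable]: "x \<in> space (BN N)" for t x
    proof -
      define J where "J = (\<integral>\<^sup>+r\<in>{0..1}. w (shift N (dil N t k) r x) \<partial>lborel)"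
      have "(\<integral>\<^sup>+r\<in>{0..t}. w (shift N k r x) \<partial>lborel)
        = ennreal t * (\<integral>\<^sup>+r. w (shift N k (t * r) x) * indicator {0..t} (t * r) \<partial>lborel)"
        using nn_integral_real_affine[of "\<lambda>r. w (shift N k r x) * indicator {0..t} r" t 0] t by simp
      also have "(\<integral>\<^sup>+r. w (shift N k (t * r) x) * indicator {0..t} (t * r) \<partial>lborel) = J"
        unfolding J_def using t by (intro nn_integral_cong)
          (auto simp: shift_dil indicator_def mult.commute mult_le_cancel_left1 zero_le_mult_iff)
      finally have 1: "(\<integral>\<^sup>+r\<in>{0..t}. ennreal (1 / b) * w (shift N k r x) \<partial>lborel) = ennreal (t / b) * J"
        using t b by (simp add: mult.assoc nn_integral_cmult) (simp add: mult.assoc[symmetric] ennreal_mult[symmetric])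
      have 2: "t powr (\<gamma> + 1) = (t / b) * (a * nrm N (dil N t k) powr \<gamma>)"
        using t k1 a by (simp add: nrm_dil b_def powr_mult powr_add)
      show ?thesis unfolding J_def[symmetric] 1 2
        using t b a ennreal_mult_le_mult_iff[of "ennreal (t / b)" J "ennreal (a * nrm N (dil N t k) powr \<gamma>)"]
        by (subst ennreal_mult) (auto simp: not_le[symmetric])
    qed
    have "(\<integral>\<^sup>+t. indicator {0<..} t * (ennreal (t ^ N / t) * f (dil N t k)) \<partial>lborel)
       = (\<integral>\<^sup>+t. ennreal (nrm N k powr (\<gamma> - N)) * (indicator {0<..} t * (\<integral>\<^sup>+x. (if ennreal (t powr (\<gamma> + 1))
           < (\<integral>\<^sup>+r\<in>{0..t}. ennreal (1 / b) * w (shift N k r x) \<partial>lborel) then ennreal (t powr (\<gamma> - 1)) else 0) \<partial>BN N)) \<partial>lborel)"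
    proof (intro nn_integral_cong)
      fix t :: real
      show "indicator {0<..} t * (ennreal (t ^ N / t) * f (dil N t k))
        = ennreal (nrm N k powr (\<gamma> - N)) * (indicator {0<..} t * (\<integral>\<^sup>+x. (if ennreal (t powr (\<gamma> + 1))
           < (\<integral>\<^sup>+r\<in>{0..t}. ennreal (1 / b) * w (shift N k r x) \<partial>lborel) then ennreal (t powr (\<gamma> - 1)) else 0) \<partial>BN N))"
      proof (cases "t > 0")
        case True
        have eq: "t ^ N / t * nrm N (dil N t k) powr (\<gamma> - N) = nrm N k powr (\<gamma> - N) * t powr (\<gamma> - 1)"
        proof -
          have 1: "t ^ N / t = t powr (real N - 1)" using True by (simp add: powr_diff powr_realpow)
          have 2: "nrm N (dil N t k) powr (\<gamma> - N) = t powr (\<gamma> - N) * nrm N k powr (\<gamma> - N)"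
            using True k1 by (simp add: nrm_dil powr_mult)
          have 3: "t powr (real N - 1) * t powr (\<gamma> - N) = t powr (\<gamma> - 1)"
            by (simp add: powr_add[symmetric])
          show ?thesis unfolding 1 2 mult.assoc[symmetric] 3 by (rule mult.commute)
        qed
        define R where "R = (\<lambda>x. ennreal (t powr (\<gamma> + 1)) < (\<integral>\<^sup>+r\<in>{0..t}. ennreal (1 / b) * w (shift N k r x) \<partial>lborel))"
        have [measurable]: "Measurable.pred (BN N) R" unfolding R_def by measurable
        have "f (dil N t k) = (\<integral>\<^sup>+x. (if R x then ennreal (nrm N (dil N t k) powr (\<gamma> - N)) else 0) \<partial>BN N)"
          unfolding f_def R_def by (rule nn_integral_cong) (simp only: cond[OF True])
        then have "ennreal (t ^ N / t) * f (dil N t k)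
          = (\<integral>\<^sup>+x. ennreal (t ^ N / t) * (if R x then ennreal (nrm N (dil N t k) powr (\<gamma> - N)) else 0) \<partial>BN N)"
          by (subst nn_integral_cmult) simp_all
        also have "\<dots> = (\<integral>\<^sup>+x. ennreal (nrm N k powr (\<gamma> - N)) * (if R x then ennreal (t powr (\<gamma> - 1)) else 0) \<partial>BN N)"
        proof (rule nn_integral_cong)
          fix x
          show "ennreal (t ^ N / t) * (if R x then ennreal (nrm N (dil N t k) powr (\<gamma> - N)) else 0)
            = ennreal (nrm N k powr (\<gamma> - N)) * (if R x then ennreal (t powr (\<gamma> - 1)) else 0)"
            using True by (cases "R x") (simp_all add: ennreal_mult'[symmetric] eq[simplified])
        qed
        also have "\<dots> = ennreal (nrm N k powr (\<gamma> - N)) * (\<integral>\<^sup>+x. (if R x then ennreal (t powr (\<gamma> - 1)) else 0) \<partial>BN N)"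
          by (rule nn_integral_cmult) measurable
        finally show ?thesis using True unfolding R_def by simp
      qed simp
    qed
    also have "\<dots> = ennreal (nrm N k powr (\<gamma> - N)) * (\<integral>\<^sup>+t. indicator {0<..} t * (\<integral>\<^sup>+x. (if ennreal (t powr (\<gamma> + 1))
           < (\<integral>\<^sup>+r\<in>{0..t}. ennreal (1 / b) * w (shift N k r x) \<partial>lborel) then ennreal (t powr (\<gamma> - 1)) else 0) \<partial>BN N) \<partial>lborel)"
      by (intro nn_integral_cmult) measurable
    also have "\<dots> \<le> ennreal (nrm N k powr (\<gamma> - N)) * (2 * c * (\<integral>\<^sup>+x. ennreal (1 / b) * w x \<partial>BN N))"
      by (intro mult_left_mono direction_estimate lb) (auto simp: space_BN k)
    also have "\<dots> = 2 * c * (ennreal (nrm N k powr (\<gamma> - N) / b) * (\<integral>\<^sup>+x. w x \<partial>BN N))"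
    proof -
      have "ennreal (nrm N k powr (\<gamma> - N)) * ennreal (1 / b) = ennreal (nrm N k powr (\<gamma> - N) / b)"
        using b by (simp add: ennreal_mult[symmetric])
      then show ?thesis by (simp add: nn_integral_cmult mult.assoc[symmetric]) (simp add: mult.assoc mult.left_commute)
    qed
    also have "\<dots> \<le> 2 * c * (ennreal (1 / a) * (\<integral>\<^sup>+x. w x \<partial>BN N))"
    proof -
      have "nrm N k powr (\<gamma> - N) / b = nrm N k powr (- real N) / a"
      proof -
        have "nrm N k powr (\<gamma> - N) = nrm N k powr \<gamma> * nrm N k powr (- real N)" by (simp add: powr_add[symmetric])
        then show ?thesis using k1 by (simp add: b_def)
      qed
      also have "\<dots> \<le> 1 / a" using a k1 N powr_mono[of "- real N" 0 "nrm N k"] by (simp add: divide_right_mono)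
      finally show ?thesis by (intro mult_left_mono mult_right_mono ennreal_leI) auto
    qed
    finally show "(\<integral>\<^sup>+t. indicator {0<..} t * (ennreal (t ^ N / t) * f (dil N t k)) \<partial>lborel)
      \<le> 2 * c * (ennreal (1 / a) * (\<integral>\<^sup>+x. w x \<partial>BN N))" .
  qed simp
  also have "\<dots> = (ennreal (2 * exp 1 * sphere_area N) * 2 * ennreal (1 / a)) * c * (\<integral>\<^sup>+x. w x \<partial>BN N)"
    by (simp only: mult_ac)
  also have "ennreal (2 * exp 1 * sphere_area N) * 2 * ennreal (1 / a) = ennreal (4 * exp 1 * sphere_area N / a)"
  proof -
    have "sphere_area N \<ge> 0" using N by (auto simp: sphere_area_def intro!: divide_nonneg_pos Gamma_real_pos)
    then have "ennreal (2 * exp 1 * sphere_area N) * ennreal 2 * ennreal (1 / a) = ennreal (4 * exp 1 * sphere_area N / a)"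
      using a by (subst ennreal_mult[symmetric]; simp add: ennreal_mult[symmetric])
    then show ?thesis by simp
  qed
  finally show ?thesis unfolding f_def .
qed

subsection \<open>Smooth bump functions\<close>

text \<open>With q = (x - a) (b - x), the derivative of p / q ^ n * exp (- c / q) has the same form
  with q ^ (n + 2) in the denominator. The family is therefore closed under differentiation, and all
  orders of derivatives required by \<open>smooth\<close> stay inside it.\<close>

definition bump :: "real \<Rightarrow> real \<Rightarrow> real \<Rightarrow> real poly \<Rightarrow> nat \<Rightarrow> real \<Rightarrow> real" where
  "bump a b c p n x = (if a < x \<and> x < b
     then poly p x / ((x - a) * (b - x)) ^ n * exp (- (c / ((x - a) * (b - x)))) else 0)"

text \<open>The numerator of that derivative; Q is (x - a) (b - x) written as a polynomial.\<close>

definition bump_poly :: "real \<Rightarrow> real \<Rightarrow> real \<Rightarrow> real poly \<Rightarrow> nat \<Rightarrow> real poly" where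
  "bump_poly a b c p n = (let Q = [:- (a * b), a + b, -1:] in
     pderiv p * Q ^ 2 - smult (real n) (p * pderiv Q * Q) + smult c (p * pderiv Q))"

lemma has_derivative_zero_if_quadratic:
  fixes f :: "real \<Rightarrow> real"
  assumes "\<And>x. \<bar>f x\<bar> \<le> K * (x - x0)\<^sup>2"
  shows "(f has_real_derivative 0) (at x0)"
proof -
  have f0: "f x0 = 0" using assms[of x0] by simp
  have "((\<lambda>h. (f (x0 + h) - f x0) / h) \<longlongrightarrow> 0) (at 0)"
  proof (rule Lim_null_comparison)
    show "\<forall>\<^sub>F h in at 0. norm ((f (x0 + h) - f x0) / h) \<le> K * \<bar>h\<bar>"
    proof (rule always_eventually, rule allI)
      fix h :: real
      show "norm ((f (x0 + h) - f x0) / h) \<le> K * \<bar>h\<bar>"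
      proof (cases "h = 0")
        case False
        have "\<bar>f (x0 + h)\<bar> \<le> K * (\<bar>h\<bar> * \<bar>h\<bar>)"
          using assms[of "x0 + h"] by (simp add: power2_eq_square flip: abs_mult)
        then show ?thesis using False f0 by (simp add: abs_divide field_simps)
      qed simp
    qed
    show "((\<lambda>h. K * \<bar>h\<bar>) \<longlongrightarrow> 0) (at (0::real))"
      by (auto intro!: tendsto_eq_intros)
  qed
  then show ?thesis by (simp add: DERIV_def)
qed

lemma power_exp_bound:
  fixes y :: real
  assumes "y \<ge> 0"
  shows "y ^ m * exp (- y) \<le> fact m"
proof -
  have "(\<Sum>k\<in>{m}. y ^ k /\<^sub>R fact k) \<le> (\<Sum>k. y ^ k /\<^sub>R fact k)"
    using assms by (intro sum_le_suminf summable_exp_generic) auto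
  then have "y ^ m / fact m \<le> exp y" by (simp add: exp_def divide_inverse mult.commute)
  then show ?thesis by (simp add: exp_minus field_simps)
qed

text \<open>The exponential absorbs any power of 1 / q. Of the n + 2 powers taken from it, n cancel
  the denominator and q ^ 2 remains, where q is at most b - a times the distance to either end
  point. This yields the derivative 0 at the two end points, where the product rule is not
  applicable.\<close>

lemma bump_quadratic_bound:
  assumes "a < b" "c > 0"
  shows "\<exists>K. \<forall>x. \<bar>bump a b c p n x\<bar> \<le> K * (x - a)\<^sup>2 \<and> \<bar>bump a b c p n x\<bar> \<le> K * (b - x)\<^sup>2"
proof -
  have "compact ((\<lambda>x. poly p x) ` {a..b})"
    by (intro compact_continuous_image continuous_intros) auto
  then obtain B where "\<forall>x\<in>{a..b}. \<bar>poly p x\<bar> \<le> B"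
    by (auto dest!: compact_imp_bounded simp: bounded_iff)
  then have B: "\<bar>poly p x\<bar> \<le> B" if "x \<in> {a..b}" for x using that by blast
  define K where "K = B * (fact (n + 2) / c ^ (n + 2)) * (b - a)\<^sup>2"
  have B0: "B \<ge> 0" using B[of a] assms by auto
  have K0: "K \<ge> 0" using B0 assms by (simp add: K_def)
  have "\<bar>bump a b c p n x\<bar> \<le> K * (x - a)\<^sup>2 \<and> \<bar>bump a b c p n x\<bar> \<le> K * (b - x)\<^sup>2" for x
  proof (cases "a < x \<and> x < b")
    case True
    define q where "q = (x - a) * (b - x)"
    have q: "q > 0" using True by (simp add: q_def)
    have "(c / q) ^ (n + 2) * exp (- (c / q)) \<le> fact (n + 2)"
      using q assms by (intro power_exp_bound) auto
    hence "(q / c) ^ (n + 2) * ((c / q) ^ (n + 2) * exp (- (c / q))) \<le> (q / c) ^ (n + 2) * fact (n + 2)"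
      using q assms by (intro mult_left_mono) auto
    moreover have "(q / c) ^ (n + 2) * ((c / q) ^ (n + 2) * exp (- (c / q))) = exp (- (c / q))"
      using q assms by (simp add: mult.assoc[symmetric] power_mult_distrib[symmetric] del: power_Suc power_add)
    ultimately have "exp (- (c / q)) / q ^ n \<le> (q / c) ^ (n + 2) * fact (n + 2) / q ^ n"
      using q by (intro divide_right_mono) auto
    also have "\<dots> = fact (n + 2) / c ^ (n + 2) * q\<^sup>2"
      using q unfolding power_divide by (simp add: power_add power2_eq_square)
    finally have e: "exp (- (c / q)) / q ^ n \<le> fact (n + 2) / c ^ (n + 2) * q\<^sup>2" .
    have "\<bar>bump a b c p n x\<bar> = \<bar>poly p x\<bar> * (exp (- (c / q)) / q ^ n)"
      using True q by (simp add: bump_def q_def[symmetric] abs_mult abs_divide)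
    also have "\<dots> \<le> B * (fact (n + 2) / c ^ (n + 2) * q\<^sup>2)"
      using B[of x] True e B0 q by (intro mult_mono) auto
    finally have *: "\<bar>bump a b c p n x\<bar> \<le> B * (fact (n + 2) / c ^ (n + 2)) * q\<^sup>2" by (simp add: mult.assoc)
    have q1: "q\<^sup>2 \<le> (b - a)\<^sup>2 * (x - a)\<^sup>2"
      unfolding q_def power_mult_distrib[symmetric] using True by (intro power_mono) (auto simp: mult.commute intro!: mult_right_mono)
    have q2: "q\<^sup>2 \<le> (b - a)\<^sup>2 * (b - x)\<^sup>2"
      unfolding q_def power_mult_distrib[symmetric] using True by (intro power_mono) (auto intro!: mult_right_mono)
    have "B * (fact (n + 2) / c ^ (n + 2)) \<ge> 0" using B0 assms by simp
    from mult_left_mono[OF q1 this] mult_left_mono[OF q2 this] * show ?thesis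
      by (simp add: K_def mult.assoc)
  next
    case False
    then show ?thesis using K0 by (auto simp: bump_def)
  qed
  then show ?thesis by blast
qed

text \<open>The quotient and chain rules with Q for q, X for q ^ (n - 1) when n > 0, k for n, d for
  the derivative of q and E for the exponential.\<close>

lemma bump_deriv_algebra:
  fixes Q X :: real
  assumes "Q > 0" "X > 0"
  shows "((A * (X * Q) - P * (k * X * d)) / ((X * Q) * (X * Q))) * E + P / (X * Q) * (E * (c * d / Q\<^sup>2))
    = (A * Q\<^sup>2 - k * (P * d * Q) + c * (P * d)) / (X * Q * Q\<^sup>2) * E"
proof -
  have "(A * (X * Q) - P * (k * X * d)) / ((X * Q) * (X * Q)) = (A * Q\<^sup>2 - k * (P * d * Q)) / (X * Q * Q\<^sup>2)"
  proof -
    have "(A * (X * Q) - P * (k * X * d)) * (X * Q * Q\<^sup>2) = (A * Q\<^sup>2 - k * (P * d * Q)) * ((X * Q) * (X * Q))"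
      by (simp add: algebra_simps power2_eq_square)
    then show ?thesis using assms by (simp add: frac_eq_eq)
  qed
  then have "((A * (X * Q) - P * (k * X * d)) / ((X * Q) * (X * Q))) * E + P / (X * Q) * (E * (c * d / Q\<^sup>2))
    = (A * Q\<^sup>2 - k * (P * d * Q)) / (X * Q * Q\<^sup>2) * E + c * (P * d) / (X * Q * Q\<^sup>2) * E"
    by (simp only:) (simp add: mult_ac)
  then show ?thesis by (simp only: add_divide_distrib distrib_right)
qed

lemma bump_deriv:
  assumes ab: "a < b" "c > 0"
  shows "(bump a b c p n has_real_derivative bump a b c (bump_poly a b c p n) (n + 2) x) (at x)"
proof -
  consider "a < x \<and> x < b" | "x = a" | "x = b" | "x < a \<or> x > b" by linarith
  then show ?thesis
  proof cases
    case 1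
    define q where "q = (\<lambda>x. (x - a) * (b - x))"
    have q: "q x > 0" using 1 by (simp add: q_def)
    have dq: "(q has_real_derivative (b - x) - (x - a)) (at x)"
      unfolding q_def by (auto intro!: derivative_eq_intros)
    have d1: "((\<lambda>x. poly p x / (q x) ^ n) has_real_derivative
       (poly (pderiv p) x * (q x) ^ n - poly p x * (real n * (q x) ^ (n - 1) * ((b - x) - (x - a)))) / ((q x) ^ n * (q x) ^ n)) (at x)"
      using q by (auto intro!: derivative_eq_intros dq simp: mult_ac)
    have d2: "((\<lambda>x. exp (- (c / q x))) has_real_derivative exp (- (c / q x)) * (c * ((b - x) - (x - a)) / (q x)\<^sup>2)) (at x)"
      using q by (auto intro!: derivative_eq_intros dq simp: power2_eq_square)
    have "((\<lambda>x. poly p x / (q x) ^ n * exp (- (c / q x))) has_real_derivative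
       ((poly (pderiv p) x * (q x) ^ n - poly p x * (real n * (q x) ^ (n - 1) * ((b - x) - (x - a)))) / ((q x) ^ n * (q x) ^ n)) * exp (- (c / q x))
        + poly p x / (q x) ^ n * (exp (- (c / q x)) * (c * ((b - x) - (x - a)) / (q x)\<^sup>2))) (at x)"
      using DERIV_mult[OF d1 d2] by (simp only: mult.commute)
    also have "((poly (pderiv p) x * (q x) ^ n - poly p x * (real n * (q x) ^ (n - 1) * ((b - x) - (x - a)))) / ((q x) ^ n * (q x) ^ n)) * exp (- (c / q x))
        + poly p x / (q x) ^ n * (exp (- (c / q x)) * (c * ((b - x) - (x - a)) / (q x)\<^sup>2))
        = (poly (pderiv p) x * (q x)\<^sup>2 - real n * (poly p x * ((b - x) - (x - a)) * q x) + c * (poly p x * ((b - x) - (x - a)))) / (q x) ^ (n + 2) * exp (- (c / q x))"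
    proof (cases n)
      case 0
      then show ?thesis using q by (simp add: field_simps power2_eq_square)
    next
      case (Suc m)
      have n: "q x ^ n = q x ^ m * q x" "q x ^ (n - 1) = q x ^ m" "q x ^ (n + 2) = q x ^ m * q x * (q x)\<^sup>2"
        using Suc by (simp_all add: power_add power2_eq_square)
      show ?thesis unfolding n using q by (intro bump_deriv_algebra) auto
    qed
    also have "poly (pderiv p) x * (q x)\<^sup>2 - real n * (poly p x * ((b - x) - (x - a)) * q x) + c * (poly p x * ((b - x) - (x - a)))
      = poly (bump_poly a b c p n) x"
      by (simp add: bump_poly_def Let_def q_def pderiv_pCons algebra_simps power2_eq_square)
    finally have "((\<lambda>x. poly p x / (q x) ^ n * exp (- (c / q x))) has_real_derivative
        poly (bump_poly a b c p n) x / (q x) ^ (n + 2) * exp (- (c / q x))) (at x)" .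
    moreover have "\<forall>\<^sub>F y in nhds x. bump a b c p n y = poly p y / (q y) ^ n * exp (- (c / q y))"
      using eventually_nhds_in_open[of "{a<..<b}" x] 1 by (auto elim!: eventually_mono simp: bump_def q_def)
    ultimately show ?thesis
      using 1 by (subst DERIV_cong_ev[OF refl _ refl]) (auto simp: bump_def[of a b c "bump_poly a b c p n"] q_def)
  next
    case 2
    obtain K where "\<And>y. \<bar>bump a b c p n y\<bar> \<le> K * (y - a)\<^sup>2" using bump_quadratic_bound[OF ab] by blast
    from has_derivative_zero_if_quadratic[of "bump a b c p n" K a, OF this] show ?thesis using 2 by (simp add: bump_def[of a b c "bump_poly a b c p n"])
  next
    case 3
    obtain K where "\<And>y. \<bar>bump a b c p n y\<bar> \<le> K * (b - y)\<^sup>2" using bump_quadratic_bound[OF ab] by blast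
    hence "\<And>y. \<bar>bump a b c p n y\<bar> \<le> K * (y - b)\<^sup>2" by (simp add: power2_commute)
    from has_derivative_zero_if_quadratic[of "bump a b c p n" K b, OF this] show ?thesis using 3 by (simp add: bump_def[of a b c "bump_poly a b c p n"])
  next
    case 4
    have "\<forall>\<^sub>F y in nhds x. bump a b c p n y = 0"
    proof -
      have "\<forall>\<^sub>F y in nhds x. y \<in> {..<a} \<union> {b<..}"
        using 4 by (intro eventually_nhds_in_open) auto
      then show ?thesis by eventually_elim (auto simp: bump_def)
    qed
    then show ?thesis using 4 by (subst DERIV_cong_ev[OF refl _ refl]) (auto simp: bump_def[of a b c "bump_poly a b c p n"])
  qed
qed

text \<open>\<open>R i m\<close> is the \<open>m\<close>-th derivative of the \<open>i\<close>-th factor of a product test function.\<close>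

definition bumpseq :: "nat \<Rightarrow> (nat \<Rightarrow> nat \<Rightarrow> real \<Rightarrow> real) \<Rightarrow> bool" where
  "bumpseq N R \<longleftrightarrow> (\<forall>i<N. \<forall>m x. (R i m has_real_derivative R i (Suc m) x) (at x)) \<and>
     (\<exists>K. \<forall>i<N. \<forall>m x. \<bar>x\<bar> > K \<longrightarrow> R i m x = 0)"

text \<open>m is a multi-index: the i-th factor is differentiated m i times, so that
  \<open>e1 i\<close> yields the i-th partial derivative.\<close>

definition bumpfun :: "nat \<Rightarrow> (nat \<Rightarrow> nat \<Rightarrow> real \<Rightarrow> real) \<Rightarrow> (nat \<Rightarrow> nat) \<Rightarrow> (nat \<Rightarrow> real) \<Rightarrow> real" where
  "bumpfun N R m x = (\<Prod>i<N. R i (m i) (x i))"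

lemma bumpseq_support:
  assumes "bumpseq N R"
  obtains K where "\<And>i m x. i < N \<Longrightarrow> \<bar>x\<bar> > K \<Longrightarrow> R i m x = 0"
proof -
  from assms obtain K where "\<forall>i<N. \<forall>m x. \<bar>x\<bar> > K \<longrightarrow> R i m x = 0" unfolding bumpseq_def by blast
  then show ?thesis using that[of K] by blast
qed

abbreviation e1 :: "nat \<Rightarrow> nat \<Rightarrow> nat" where
  "e1 i \<equiv> (\<lambda>_. 0)(i := Suc 0)"

text \<open>The parameter c is sent to 0 in \<open>box_identity\<close>, where the functions of
  order 0 converge to indicators of open intervals.\<close>

lemma ex_bumpseq:
  fixes a b :: "nat \<Rightarrow> real"
  assumes "\<And>i. i < N \<Longrightarrow> a i < b i" "c > 0"
  shows "\<exists>R. bumpseq N R \<and> (\<forall>i<N. R i 0 = (\<lambda>x. if a i < x \<and> x < b i then exp (- (c / ((x - a i) * (b i - x)))) else 0))"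
proof -
  \<comment> \<open>\<open>D i m\<close> carries the numerator and the exponent of the denominator
    of the m-th derivative.\<close>
  define D where "D = (\<lambda>i m. ((\<lambda>(p, n). (bump_poly (a i) (b i) c p n, n + 2)) ^^ m) (1, 0))"
  define R where "R = (\<lambda>i m. bump (a i) (b i) c (fst (D i m)) (snd (D i m)))"
  have D: "D i (Suc m) = (bump_poly (a i) (b i) c (fst (D i m)) (snd (D i m)), snd (D i m) + 2)" for i m
    by (simp add: D_def split_beta)
  have "(R i m has_real_derivative R i (Suc m) x) (at x)" if "i < N" for i m x
    using bump_deriv[OF assms(1)[OF that] assms(2)] by (simp add: R_def D)
  moreover have "\<exists>K. \<forall>i<N. \<forall>m x. \<bar>x\<bar> > K \<longrightarrow> R i m x = 0"
  proof (intro exI allI impI)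
    fix i m x assume i: "i < N" and x: "(\<Sum>i<N. \<bar>a i\<bar> + \<bar>b i\<bar>) < \<bar>x\<bar>"
    have "\<bar>a i\<bar> + \<bar>b i\<bar> \<le> (\<Sum>i<N. \<bar>a i\<bar> + \<bar>b i\<bar>)" using i by (intro member_le_sum) auto
    with x show "R i m x = 0" by (auto simp: R_def bump_def)
  qed
  ultimately have "bumpseq N R" by (simp add: bumpseq_def)
  moreover have "R i 0 = (\<lambda>x. if a i < x \<and> x < b i then exp (- (c / ((x - a i) * (b i - x)))) else 0)" for i
    by (auto simp: R_def D_def bump_def fun_eq_iff)
  ultimately show ?thesis by blast
qed

lemma bumpfun_upd_deriv:
  assumes R: "bumpseq N R" and i: "i < N"
  shows "((\<lambda>t. bumpfun N R m (x(i := t))) has_real_derivative bumpfun N R (m(i := Suc (m i))) (x(i := s))) (at s)"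
proof -
  have "bumpfun N R m (x(i := t)) = R i (m i) t * (\<Prod>j\<in>{..<N} - {i}. R j (m j) (x j))" for t m
    unfolding bumpfun_def using i by (subst prod.remove[of _ i]) (auto intro!: prod.cong)
  moreover have "(\<Prod>j\<in>{..<N} - {i}. R j ((m(i := Suc (m i))) j) (x j)) = (\<Prod>j\<in>{..<N} - {i}. R j (m j) (x j))"
    by (intro prod.cong) auto
  ultimately show ?thesis
    using R i by (auto simp: bumpseq_def intro!: DERIV_cmult_right)
qed

lemma pd_bumpfun:
  assumes "bumpseq N R" "i < N"
  shows "pd i (bumpfun N R m) = bumpfun N R (m(i := Suc (m i)))"
proof
  fix x
  show "pd i (bumpfun N R m) x = bumpfun N R (m(i := Suc (m i))) x"
    using DERIV_imp_deriv[OF bumpfun_upd_deriv[OF assms, of m x "x i"]] by (simp add: pd_def)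
qed

lemma bumpseq_continuous:
  assumes "bumpseq N R" "i < N"
  shows "continuous_on A (R i m)"
proof (intro continuous_at_imp_continuous_on ballI)
  fix x
  have "(R i m has_real_derivative R i (Suc m) x) (at x)" using assms by (simp add: bumpseq_def)
  then show "isCont (R i m) x" by (rule DERIV_isCont)
qed

text \<open>For fixed R the set of all \<open>bumpfun N R m\<close> is closed under every
  \<open>pd i\<close>, so it serves as the coinduction invariant.\<close>

lemma smooth_bumpfun:
  assumes R: "bumpseq N R"
  shows "smooth N (bumpfun N R m)"
proof -
  have "\<exists>m'. bumpfun N R m = bumpfun N R m'" by blast
  then show ?thesis
  proof (coinduction arbitrary: m rule: smooth.coinduct)
    case (smooth m)
    have "continuous_on (sp N) (bumpfun N R m)"
      unfolding bumpfun_def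
      by (intro continuous_on_prod continuous_on_compose2[OF bumpseq_continuous[OF R, of _ UNIV]]
          continuous_on_subset[OF continuous_on_product_coordinates]) auto
    moreover have "\<forall>i<N. \<forall>x\<in>sp N. (\<lambda>t. bumpfun N R m (x(i := t))) differentiable (at (x i))"
      using bumpfun_upd_deriv[OF R] unfolding real_differentiable_def by blast
    ultimately show ?case using pd_bumpfun[OF R] by auto
  qed
qed

lemma test_bumpfun:
  assumes R: "bumpseq N R"
  shows "test N (bumpfun N R m)"
proof -
  obtain K where K: "\<And>i m x. i < N \<Longrightarrow> \<bar>x\<bar> > K \<Longrightarrow> R i m x = 0" using bumpseq_support[OF R] by blast
  have "bumpfun N R m x = 0" if "rdist N x (\<lambda>_. 0) > sqrt (real N) * \<bar>K\<bar>" for x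
  proof (rule ccontr)
    assume nz: "bumpfun N R m x \<noteq> 0"
    have "\<bar>x i\<bar> \<le> \<bar>K\<bar>" if "i < N" for i
      using nz K[OF that, of "x i" "m i"] that by (fastforce simp: bumpfun_def)
    hence "(\<Sum>i<N. (x i)\<^sup>2) \<le> (\<Sum>i<N. \<bar>K\<bar>\<^sup>2)" by (intro sum_mono) (simp add: abs_le_square_iff)
    hence "rdist N x (\<lambda>_. 0) \<le> sqrt (real N * \<bar>K\<bar>\<^sup>2)" unfolding rdist_def by simp
    with that show False by (simp add: real_sqrt_mult)
  qed
  then show ?thesis using smooth_bumpfun[OF R] by (auto simp: test_def)
qed

lemma bumpfun_measurable [measurable (raw)]:
  assumes "bumpseq N R" and [measurable]: "f \<in> measurable M (BN N)"
  shows "(\<lambda>\<omega>. bumpfun N R m (f \<omega>)) \<in> borel_measurable M"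
  unfolding bumpfun_def
proof (intro borel_measurable_prod)
  fix i assume "i \<in> {..<N}"
  then have [measurable]: "R i (m i) \<in> borel_measurable borel" "(\<lambda>\<omega>. f \<omega> i) \<in> borel_measurable M"
    using bumpseq_continuous[OF assms(1), of i UNIV] component_measurable[OF assms(2)]
    by (auto intro: borel_measurable_continuous_onI)
  show "(\<lambda>\<omega>. R i (m i) (f \<omega> i)) \<in> borel_measurable M" by measurable
qed

definition cube :: "nat \<Rightarrow> real \<Rightarrow> (nat \<Rightarrow> real) set" where
  "cube N K = PiE {..<N} (\<lambda>_. {-K..K})"

lemma cube_sets [measurable]: "cube N K \<in> sets (BN N)"
  unfolding cube_def by (intro box_in_sets_BN) auto

lemma bumpfun_bound:
  assumes R: "bumpseq N R"
  shows "\<exists>K C. K \<ge> 0 \<and> C \<ge> 0 \<and> (\<forall>x\<in>sp N. \<bar>bumpfun N R m x\<bar> \<le> C * indicator (cube N K) x)"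
proof -
  obtain K where K: "\<And>i m x. i < N \<Longrightarrow> \<bar>x\<bar> > K \<Longrightarrow> R i m x = 0" using bumpseq_support[OF R] by blast
  have "\<exists>C. \<forall>x. \<bar>R i (m i) x\<bar> \<le> C" if i: "i < N" for i
  proof -
    have "compact (R i (m i) ` {-\<bar>K\<bar>..\<bar>K\<bar>})"
      by (intro compact_continuous_image bumpseq_continuous[OF R i]) auto
    then obtain C where "\<forall>x\<in>{-\<bar>K\<bar>..\<bar>K\<bar>}. \<bar>R i (m i) x\<bar> \<le> C"
      by (auto dest!: compact_imp_bounded simp: bounded_iff)
    then have C: "\<bar>R i (m i) x\<bar> \<le> C" if "x \<in> {-\<bar>K\<bar>..\<bar>K\<bar>}" for x using that by blast
    have "\<bar>R i (m i) x\<bar> \<le> \<bar>C\<bar>" for x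
      using C[of x] K[OF i, of x "m i"] by (cases "x \<in> {-\<bar>K\<bar>..\<bar>K\<bar>}") (auto simp: abs_le_iff)
    then show ?thesis by blast
  qed
  then obtain C where C: "\<And>i x. i < N \<Longrightarrow> \<bar>R i (m i) x\<bar> \<le> C i" by metis
  have "\<bar>bumpfun N R m x\<bar> \<le> (\<Prod>i<N. C i) * indicator (cube N \<bar>K\<bar>) x" if x: "x \<in> sp N" for x
  proof (cases "x \<in> cube N \<bar>K\<bar>")
    case True
    then show ?thesis using C unfolding bumpfun_def abs_prod by (auto intro!: prod_mono)
  next
    case False
    then obtain i where "i < N" "\<bar>x i\<bar> > \<bar>K\<bar>" using x by (auto simp: cube_def sp_def PiE_iff abs_le_iff)
    then have "bumpfun N R m x = 0" using K[of i "x i" "m i"] by (force simp: bumpfun_def)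
    then show ?thesis using False by simp
  qed
  moreover have "(\<Prod>i<N. C i) \<ge> 0" using C by (intro prod_nonneg) (meson abs_ge_zero lessThan_iff order_trans)
  ultimately show ?thesis by (intro exI[of _ "\<bar>K\<bar>"] exI[of _ "\<Prod>i<N. C i"]) auto
qed

text \<open>Translates of test products are again test products, which lets the weak identity be
  applied to \<phi> (x - r z) for every single r.\<close>

lemma bumpseq_shift:
  assumes R: "bumpseq N R"
  shows "bumpseq N (\<lambda>i m x. R i m (x + r * z i))"
proof -
  obtain K where K: "\<And>i m x. i < N \<Longrightarrow> \<bar>x\<bar> > K \<Longrightarrow> R i m x = 0" using bumpseq_support[OF R] by blast
  have "((\<lambda>x. R i m (x + r * z i)) has_real_derivative R i (Suc m) (x + r * z i)) (at x)" if "i < N" for i m x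
    using R that by (auto simp: bumpseq_def DERIV_shift[symmetric])
  moreover have "R i m (x + r * z i) = 0" if "i < N" "\<bar>x\<bar> > \<bar>K\<bar> + (\<Sum>i<N. \<bar>r * z i\<bar>)" for i m x
  proof -
    have "\<bar>r * z i\<bar> \<le> (\<Sum>i<N. \<bar>r * z i\<bar>)" using that(1) by (intro member_le_sum) auto
    then show ?thesis using that by (intro K) auto
  qed
  ultimately show ?thesis unfolding bumpseq_def by blast
qed

lemma bumpfun_shift: "bumpfun N R m (shift N z r x) = bumpfun N (\<lambda>i m x. R i m (x + r * z i)) m x"
  by (simp add: bumpfun_def shift_def)

lemma bumpfun_line_deriv:
  assumes R: "bumpseq N R"
  shows "((\<lambda>r. bumpfun N R (\<lambda>_. 0) (shift N z r x)) has_real_derivative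
     (\<Sum>i<N. z i * bumpfun N R (e1 i) (shift N z r x))) (at r)"
proof -
  have "((\<lambda>r. \<Prod>i<N. R i 0 (x i + r * z i)) has_real_derivative
     (\<Sum>i<N. (R i 1 (x i + r * z i) * z i) * (\<Prod>j\<in>{..<N} - {i}. R j 0 (x j + r * z j)))) (at r)"
  proof (rule has_field_derivative_prod)
    fix i assume "i \<in> {..<N}"
    then have "(R i 0 has_real_derivative R i 1 (x i + r * z i)) (at (x i + r * z i))"
      using R by (auto simp: bumpseq_def)
    then show "((\<lambda>r. R i 0 (x i + r * z i)) has_real_derivative R i 1 (x i + r * z i) * z i) (at r)"
      by (rule DERIV_chain2) (auto intro!: derivative_eq_intros)
  qed
  moreover have "(R i 1 (x i + r * z i) * z i) * (\<Prod>j\<in>{..<N} - {i}. R j 0 (x j + r * z j))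
     = z i * bumpfun N R (e1 i) (shift N z r x)" if "i < N" for i
    unfolding bumpfun_def shift_def using that by (subst prod.remove[of _ i]) (auto intro!: prod.cong)
  then have "(\<Sum>i<N. (R i 1 (x i + r * z i) * z i) * (\<Prod>j\<in>{..<N} - {i}. R j 0 (x j + r * z j)))
      = (\<Sum>i<N. z i * bumpfun N R (e1 i) (shift N z r x))"
    by (intro sum.cong) auto
  ultimately show ?thesis by (simp only: bumpfun_shift) (simp add: bumpfun_def)
qed

lemma bumpfun_line_continuous:
  assumes R: "bumpseq N R"
  shows "continuous_on A (\<lambda>r. bumpfun N R m (shift N z r x))"
  unfolding bumpfun_shift unfolding bumpfun_def
proof (rule continuous_on_prod)
  fix i assume "i \<in> {..<N}"
  then show "continuous_on A (\<lambda>r. R i (m i) (x i + r * z i))"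
    by (intro continuous_on_compose2[OF bumpseq_continuous[OF R, of i UNIV]] continuous_intros) auto
qed

subsection \<open>Open boxes as a generator\<close>

definition obox :: "nat \<Rightarrow> (nat \<Rightarrow> real) \<Rightarrow> (nat \<Rightarrow> real) \<Rightarrow> (nat \<Rightarrow> real) set" where
  "obox N a b = PiE {..<N} (\<lambda>i. {a i<..<b i})"

lemma obox_sets [measurable]: "obox N a b \<in> sets (BN N)"
  unfolding obox_def by (intro box_in_sets_BN) auto

lemma obox_Int: "obox N a b \<inter> obox N a' b' = obox N (\<lambda>i. max (a i) (a' i)) (\<lambda>i. min (b i) (b' i))"
  unfolding obox_def PiE_Int Int_greaterThanLessThan ..

text \<open>A cylinder over an open interval is exhausted by boxes whose other sides are (-n, n);
  cylinders over Borel sets follow by induction.\<close>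

lemma sets_BN_obox: "sets (BN N) = sigma_sets (sp N) (range (\<lambda>(a, b). obox N a b))"
proof
  show "sigma_sets (sp N) (range (\<lambda>(a, b). obox N a b)) \<subseteq> sets (BN N)"
    unfolding space_BN[symmetric] by (intro sets.sigma_sets_subset) auto
  have sub: "range (\<lambda>(a, b). obox N a b) \<subseteq> Pow (sp N)" by (auto simp: obox_def sp_def PiE_iff)
  interpret S: sigma_algebra "sp N" "sigma_sets (sp N) (range (\<lambda>(a, b). obox N a b))"
    by (rule sigma_algebra_sigma_sets[OF sub])
  have "{f \<in> sp N. f i \<in> A} \<in> sigma_sets (sp N) (range (\<lambda>(a, b). obox N a b))"
    if i: "i < N" and A: "A \<in> sets borel" for i A
  proof -
    have "A \<in> sigma_sets UNIV (range (\<lambda>(a, b). box a b :: real set))"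
      using A by (simp add: borel_eq_box)
    then show ?thesis
    proof induction
      case (Basic A)
      then obtain a b where A: "A = {a<..<b::real}" by (auto simp: box_real)
      have "{f \<in> sp N. f i \<in> A} = (\<Union>n::nat. obox N ((\<lambda>_. - real n)(i := a)) ((\<lambda>_. real n)(i := b)))"
      proof (intro equalityI subsetI)
        fix f assume f: "f \<in> {f \<in> sp N. f i \<in> A}"
        obtain n :: nat where n: "(\<Sum>j<N. \<bar>f j\<bar>) < real n" using reals_Archimedean2 by blast
        have "- real n < f j \<and> f j < real n" if "j < N" for j
        proof -
          have "\<bar>f j\<bar> \<le> (\<Sum>j<N. \<bar>f j\<bar>)" using that by (intro member_le_sum) auto
          then show ?thesis using n by linarith
        qed
        then show "f \<in> (\<Union>n::nat. obox N ((\<lambda>_. - real n)(i := a)) ((\<lambda>_. real n)(i := b)))"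
          using f A by (auto simp: obox_def sp_def PiE_iff intro!: exI[of _ n])
      next
        fix f assume "f \<in> (\<Union>n::nat. obox N ((\<lambda>_. - real n)(i := a)) ((\<lambda>_. real n)(i := b)))"
        then show "f \<in> {f \<in> sp N. f i \<in> A}" using i A by (force simp: obox_def sp_def PiE_iff)
      qed
      also have "\<dots> \<in> sigma_sets (sp N) (range (\<lambda>(a, b). obox N a b))"
        by (intro S.countable_UN) auto
      finally show ?case .
    next
      case Empty
      then show ?case by simp
    next
      case (Compl A)
      have "{f \<in> sp N. f i \<in> UNIV - A} = sp N - {f \<in> sp N. f i \<in> A}" by auto
      then show ?case using Compl by (simp add: S.compl_sets)
    next
      case (Union A)
      have "{f \<in> sp N. f i \<in> (\<Union>k. A k)} = (\<Union>k. {f \<in> sp N. f i \<in> A k})" by auto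
      then show ?case using Union by auto
    qed
  qed
  moreover have "sets (BN N) = sigma_sets (sp N) {{f \<in> sp N. f i \<in> A} | i A. i < N \<and> A \<in> sets borel}"
    by (simp add: BN_def sets_PiM_single sp_def)
  ultimately show "sets (BN N) \<subseteq> sigma_sets (sp N) (range (\<lambda>(a, b). obox N a b))"
    by (auto intro!: sigma_sets_mono)
qed

text \<open>Uniqueness on an intersection-stable generator, for real linear combinations: the
  identities to be extended from boxes have signed sides, so they are not equalities of two
  measures. The coefficients do not disturb the Dynkin induction, as each of its steps is
  linear.\<close>

lemma measure_combination_eqI:
  assumes J: "finite J" and M: "\<And>j. j \<in> J \<Longrightarrow> finite_measure (M j)" "\<And>j. j \<in> J \<Longrightarrow> sets (M j) = sets (BN N)"
    and box: "\<And>a b. (\<Sum>j\<in>J. c j * measure (M j) (obox N a b)) = (0::real)"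
    and A: "A \<in> sets (BN N)"
  shows "(\<Sum>j\<in>J. c j * measure (M j) A) = 0"
proof -
  have spM: "space (M j) = sp N" if "j \<in> J" for j using sets_eq_imp_space_eq[OF M(2)[OF that]] by (simp add: space_BN)
  \<comment> \<open>The complement step needs the whole space, which is no box but the increasing
    union of the boxes (-n, n)^N.\<close>
  have top: "(\<Sum>j\<in>J. c j * measure (M j) (sp N)) = 0"
  proof -
    define B where "B = (\<lambda>n::nat. obox N (\<lambda>_. - real n) (\<lambda>_. real n))"
    have Bsp: "(\<Union>n. B n) = sp N"
    proof (intro equalityI subsetI)
      fix f assume f: "f \<in> sp N"
      obtain n :: nat where n: "(\<Sum>j<N. \<bar>f j\<bar>) < real n" using reals_Archimedean2 by blast
      have "- real n < f j \<and> f j < real n" if "j < N" for j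
      proof -
        have "\<bar>f j\<bar> \<le> (\<Sum>j<N. \<bar>f j\<bar>)" using that by (intro member_le_sum) auto
        then show ?thesis using n by linarith
      qed
      then show "f \<in> (\<Union>n. B n)" using f by (auto simp: B_def obox_def sp_def PiE_iff intro!: exI[of _ n])
    qed (auto simp: B_def obox_def sp_def PiE_iff)
    have "(\<lambda>n. measure (M j) (B n)) \<longlonglongrightarrow> measure (M j) (sp N)" if j: "j \<in> J" for j
    proof -
      interpret finite_measure "M j" by (rule M(1)[OF j])
      have "incseq B"
      proof (intro monoI)
        fix m n :: nat assume "m \<le> n"
        then have "real m \<le> real n" by simp
        then show "B m \<subseteq> B n" unfolding B_def obox_def by (intro PiE_mono) auto
      qed
      moreover have "range B \<subseteq> sets (M j)"
        unfolding M(2)[OF j] B_def by (intro image_subsetI obox_sets)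
      ultimately have "(\<lambda>n. measure (M j) (B n)) \<longlonglongrightarrow> measure (M j) (\<Union>n. B n)"
        by (intro finite_Lim_measure_incseq)
      then show ?thesis unfolding Bsp .
    qed
    then have "(\<lambda>n. \<Sum>j\<in>J. c j * measure (M j) (B n)) \<longlonglongrightarrow> (\<Sum>j\<in>J. c j * measure (M j) (sp N))"
      by (intro tendsto_sum tendsto_mult_left) auto
    then show ?thesis using box by (simp add: B_def LIMSEQ_const_iff)
  qed
  have "Int_stable (range (\<lambda>(a, b). obox N a b))"
    by (auto simp: Int_stable_def obox_Int)
  moreover have "range (\<lambda>(a, b). obox N a b) \<subseteq> Pow (sp N)" by (auto simp: obox_def sp_def PiE_iff)
  moreover have "A \<in> sigma_sets (sp N) (range (\<lambda>(a, b). obox N a b))" using A unfolding sets_BN_obox .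
  ultimately show ?thesis
  proof (induction rule: sigma_sets_induct_disjoint)
    case (basic A)
    then show ?case using box by auto
  next
    case empty
    then show ?case by simp
  next
    case (compl A)
    have "measure (M j) (sp N - A) = measure (M j) (sp N) - measure (M j) A" if j: "j \<in> J" for j
    proof -
      interpret finite_measure "M j" by (rule M(1)[OF j])
      have "A \<in> sets (M j)" using compl(1) unfolding M(2)[OF j] sets_BN_obox .
      from finite_measure_compl[OF this] show ?thesis unfolding spM[OF j] .
    qed
    then have "(\<Sum>j\<in>J. c j * measure (M j) (sp N - A)) = (\<Sum>j\<in>J. c j * measure (M j) (sp N)) - (\<Sum>j\<in>J. c j * measure (M j) A)"
      by (simp add: sum_subtractf[symmetric] right_diff_distrib)
    then show ?case using top compl by simp
  next
    case (union A)
    have "(\<lambda>n. measure (M j) (A n)) sums measure (M j) (\<Union>n. A n)" if j: "j \<in> J" for j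
    proof -
      interpret finite_measure "M j" by (rule M(1)[OF j])
      have "range A \<subseteq> sets (M j)" using union(2) unfolding M(2)[OF j] sets_BN_obox .
      then show ?thesis using union(1) by (intro finite_measure_UNION)
    qed
    then have "(\<lambda>n. \<Sum>j\<in>J. c j * measure (M j) (A n)) sums (\<Sum>j\<in>J. c j * measure (M j) (\<Union>n. A n))"
      by (intro sums_sum sums_mult) auto
    then show ?case using union by (simp add: sums_iff)
  qed
qed

subsection \<open>Increments of a function with a measure gradient\<close>

definition unit01 :: "real measure" where
  "unit01 = density lborel (indicator {0..1})"

lemma sets_unit01 [measurable_cong, simp]: "sets unit01 = sets borel"
  by (simp add: unit01_def)

lemma space_unit01 [simp]: "space unit01 = UNIV"
  by (simp add: unit01_def)

lemma finite_unit01: "finite_measure unit01"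
  by (intro finite_measureI) (simp add: unit01_def emeasure_density)

interpretation U: finite_measure unit01 by (rule finite_unit01)

lemma nn_integral_unit01:
  "f \<in> borel_measurable borel \<Longrightarrow> (\<integral>\<^sup>+r. f r \<partial>unit01) = (\<integral>\<^sup>+r\<in>{0..1}. f r \<partial>lborel)"
  unfolding unit01_def by (subst nn_integral_density) (auto simp: mult.commute)

lemma nn_integral_unit01_const: "(\<integral>\<^sup>+r. c \<partial>unit01) = c"
  by (subst nn_integral_unit01) (auto simp: nn_integral_cmult_indicator)

lemma emeasure_unit01 [simp]: "emeasure unit01 UNIV = 1"
  using nn_integral_unit01_const[of 1] by (simp add: unit01_def emeasure_density)

lemma AE_unit01: "AE r in unit01. 0 \<le> r \<and> r \<le> 1"
  unfolding unit01_def by (subst AE_density) (auto simp: indicator_def)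

lemma integral_unit01:
  fixes f :: "real \<Rightarrow> real"
  assumes "f \<in> borel_measurable borel"
  shows "(\<integral>r. f r \<partial>unit01) = (\<integral>r. indicator {0..1} r *\<^sub>R f r \<partial>lborel)"
  using integral_density[of f lborel "indicator {0..1}"] assms
  by (simp add: unit01_def ennreal_indicator)

lemma integrable_pair_unit01:
  fixes f :: "real \<times> 'a \<Rightarrow> real"
  assumes M: "sigma_finite_measure M" and [measurable]: "f \<in> borel_measurable (unit01 \<Otimes>\<^sub>M M)"
    and g: "integrable M g"
    and le: "\<And>r y. 0 \<le> r \<Longrightarrow> r \<le> 1 \<Longrightarrow> y \<in> space M \<Longrightarrow> \<bar>f (r, y)\<bar> \<le> g y"
  shows "integrable (unit01 \<Otimes>\<^sub>M M) f"
proof (rule integrableI_bounded)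
  interpret sigma_finite_measure M by (rule M)
  have "(\<integral>\<^sup>+p. ennreal (norm (f p)) \<partial>(unit01 \<Otimes>\<^sub>M M)) = (\<integral>\<^sup>+r. \<integral>\<^sup>+y. ennreal (norm (f (r, y))) \<partial>M \<partial>unit01)"
    by (intro nn_integral_fst[symmetric]) measurable
  also have "\<dots> \<le> (\<integral>\<^sup>+r. \<integral>\<^sup>+y. ennreal (norm (g y)) \<partial>M \<partial>unit01)"
  proof (rule nn_integral_mono_AE, use AE_unit01 in eventually_elim)
    fix r :: real assume r: "0 \<le> r \<and> r \<le> 1"
    show "(\<integral>\<^sup>+y. ennreal (norm (f (r, y))) \<partial>M) \<le> (\<integral>\<^sup>+y. ennreal (norm (g y)) \<partial>M)"
    proof (rule nn_integral_mono)
      fix y assume "y \<in> space M"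
      with le[of r y] r have "norm (f (r, y)) \<le> norm (g y)" by auto
      then show "ennreal (norm (f (r, y))) \<le> ennreal (norm (g y))" by (rule ennreal_leI)
    qed
  qed
  also have "\<dots> = (\<integral>\<^sup>+y. ennreal (norm (g y)) \<partial>M)" by (rule nn_integral_unit01_const)
  also have "\<dots> < \<infinity>" using g by (simp add: integrable_iff_bounded)
  finally show "(\<integral>\<^sup>+p. ennreal (norm (f p)) \<partial>(unit01 \<Otimes>\<^sub>M M)) < \<infinity>" .
qed measurable

lemma shift_0: "x \<in> sp N \<Longrightarrow> shift N z 0 x = x"
  by (auto simp: shift_def sp_def PiE_iff extensional_def fun_eq_iff)

lemma integral_shift:
  fixes f :: "_ \<Rightarrow> real"
  assumes [measurable]: "f \<in> borel_measurable (BN N)"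
  shows "(\<integral>x. f (shift N z r x) \<partial>BN N) = (\<integral>x. f x \<partial>BN N)"
  by (subst (2) distr_shift[of N z r, symmetric]) (simp add: integral_distr)

lemma integrable_shift:
  fixes f :: "_ \<Rightarrow> real"
  assumes "integrable (BN N) f"
  shows "integrable (BN N) (\<lambda>x. f (shift N z r x))"
proof -
  have "integrable (distr (BN N) (BN N) (shift N z r)) f" using assms by (simp add: distr_shift)
  then show ?thesis by (rule integrable_distr[rotated]) measurable
qed

text \<open>Finiteness is local because a gradient in L^p need not be integrable over the whole
  space.\<close>

definition locfin :: "nat \<Rightarrow> (nat \<Rightarrow> real) measure \<Rightarrow> bool" where
  "locfin N M \<longleftrightarrow> sets M = sets (BN N) \<and> (\<forall>K. emeasure M (cube N K) < \<infinity>)"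

lemma cube_mono: "K \<le> K' \<Longrightarrow> cube N K \<subseteq> cube N K'"
  unfolding cube_def by (intro PiE_mono) auto

lemma mem_cube: "x \<in> cube N K \<longleftrightarrow> x \<in> sp N \<and> (\<forall>i<N. \<bar>x i\<bar> \<le> K)"
  by (auto simp: cube_def sp_def PiE_iff abs_le_iff minus_le_iff)

lemma ex_cube:
  assumes "x \<in> sp N"
  shows "\<exists>n::nat. x \<in> cube N (real n)"
proof -
  obtain n :: nat where n: "(\<Sum>j<N. \<bar>x j\<bar>) < real n" using reals_Archimedean2 by blast
  have "\<bar>x j\<bar> \<le> real n" if "j < N" for j
  proof -
    have "\<bar>x j\<bar> \<le> (\<Sum>j<N. \<bar>x j\<bar>)" using that by (intro member_le_sum) auto
    then show ?thesis using n by linarith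
  qed
  then show ?thesis using assms by (auto simp: mem_cube)
qed

lemma shift_cube:
  assumes "shift N z r y \<in> cube N K" "\<bar>r\<bar> \<le> 1" "y \<in> sp N"
  shows "y \<in> cube N (K + (\<Sum>i<N. \<bar>z i\<bar>))"
  unfolding mem_cube
proof (intro conjI allI impI)
  fix i assume i: "i < N"
  have "\<bar>z i\<bar> \<le> (\<Sum>i<N. \<bar>z i\<bar>)" using i by (intro member_le_sum) auto
  moreover have "\<bar>r * z i\<bar> \<le> \<bar>z i\<bar>" using assms(2) by (simp add: abs_mult mult_left_le_one_le)
  moreover have "\<bar>y i + r * z i\<bar> \<le> K" using assms(1) i by (auto simp: mem_cube shift_def)
  ultimately show "\<bar>y i\<bar> \<le> K + (\<Sum>i<N. \<bar>z i\<bar>)" by linarith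
qed fact

lemma locfin_sigma_finite:
  assumes "locfin N M"
  shows "sigma_finite_measure M"
proof
  have sp: "space M = sp N" using assms sets_eq_imp_space_eq[of M "BN N"] by (simp add: locfin_def space_BN)
  show "\<exists>A. countable A \<and> A \<subseteq> sets M \<and> \<Union> A = space M \<and> (\<forall>a\<in>A. emeasure M a \<noteq> \<infinity>)"
  proof (intro exI[of _ "range (\<lambda>n::nat. cube N (real n))"] conjI)
    show "\<Union> (range (\<lambda>n::nat. cube N (real n))) = space M"
      using ex_cube unfolding sp by (auto simp: mem_cube)
  qed (use assms in \<open>auto simp: locfin_def less_top\<close>)
qed

text \<open>M averaged over the translations by - r z with 0 \<le> r \<le> 1: a set A receives the
  mean of the masses of A + r z. If M has the density h, the result has the density \<integral> h (x
  + r z) dr, so this measure takes the place of a line integral when M has no density.\<close>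

definition smear :: "nat \<Rightarrow> (nat \<Rightarrow> real) \<Rightarrow> (nat \<Rightarrow> real) measure \<Rightarrow> (nat \<Rightarrow> real) measure" where
  "smear N z M = distr (unit01 \<Otimes>\<^sub>M M) (BN N) (\<lambda>p. shift N z (- fst p) (snd p))"

lemma sets_smear [simp, measurable_cong]: "sets (smear N z M) = sets (BN N)"
  by (simp add: smear_def)

context
  fixes N :: nat and M :: "(nat \<Rightarrow> real) measure" and z :: "nat \<Rightarrow> real"
  assumes M: "locfin N M" and z [measurable]: "z \<in> space (BN N)"
begin

lemma locfin_sets: "sets M = sets (BN N)"
  using M by (simp add: locfin_def)

lemma locfin_space: "space M = sp N"
  using sets_eq_imp_space_eq[OF locfin_sets] by (simp add: space_BN)

lemma smear_map [measurable]: "(\<lambda>p. shift N z (- fst p) (snd p)) \<in> measurable (unit01 \<Otimes>\<^sub>M M) (BN N)"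
proof -
  note [measurable_cong] = locfin_sets
  show ?thesis by measurable
qed

lemma nn_integral_smear:
  assumes [measurable]: "f \<in> borel_measurable (BN N)"
  shows "(\<integral>\<^sup>+x. f x \<partial>smear N z M) = (\<integral>\<^sup>+r\<in>{0..1}. (\<integral>\<^sup>+y. f (shift N z (- r) y) \<partial>M) \<partial>lborel)"
proof -
  note [measurable_cong] = locfin_sets
  interpret M: sigma_finite_measure M by (rule locfin_sigma_finite[OF M])
  have "(\<integral>\<^sup>+x. f x \<partial>smear N z M) = (\<integral>\<^sup>+p. f (shift N z (- fst p) (snd p)) \<partial>(unit01 \<Otimes>\<^sub>M M))"
    unfolding smear_def by (subst nn_integral_distr) auto
  also have "\<dots> = (\<integral>\<^sup>+r. (\<integral>\<^sup>+y. f (shift N z (- r) y) \<partial>M) \<partial>unit01)"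
    by (subst M.nn_integral_fst[symmetric]) auto
  also have "\<dots> = (\<integral>\<^sup>+r\<in>{0..1}. (\<integral>\<^sup>+y. f (shift N z (- r) y) \<partial>M) \<partial>lborel)"
    by (intro nn_integral_unit01) measurable
  finally show ?thesis .
qed

lemma emeasure_smear_cube: "emeasure (smear N z M) (cube N K) < \<infinity>"
proof -
  note [measurable_cong] = locfin_sets
  let ?K = "K + (\<Sum>i<N. \<bar>z i\<bar>)"
  have "emeasure (smear N z M) (cube N K) = (\<integral>\<^sup>+x. indicator (cube N K) x \<partial>smear N z M)"
    by (simp add: cube_sets)
  also have "\<dots> = (\<integral>\<^sup>+r\<in>{0..1}. (\<integral>\<^sup>+y. indicator (cube N K) (shift N z (- r) y) \<partial>M) \<partial>lborel)"
    by (intro nn_integral_smear) measurable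
  also have "\<dots> \<le> (\<integral>\<^sup>+r\<in>{0..1::real}. emeasure M (cube N ?K) \<partial>lborel)"
  proof (rule nn_integral_mono)
    fix r :: real
    show "(\<integral>\<^sup>+y. indicator (cube N K) (shift N z (- r) y) \<partial>M) * indicator {0..1} r \<le> emeasure M (cube N ?K) * indicator {0..1} r"
    proof (cases "r \<in> {0..1}")
      case True
      have "(\<integral>\<^sup>+y. indicator (cube N K) (shift N z (- r) y) \<partial>M) \<le> (\<integral>\<^sup>+y. indicator (cube N ?K) y \<partial>M)"
        using shift_cube[of N z "- r" _ K] True by (intro nn_integral_mono) (auto simp: locfin_space indicator_def)
      also have "\<dots> = emeasure M (cube N ?K)" by (intro nn_integral_indicator) measurable
      finally show ?thesis using True by simp
    qed simp
  qed
  also have "\<dots> = emeasure M (cube N ?K)" by (simp add: nn_integral_cmult_indicator)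
  also have "\<dots> < \<infinity>" using M by (simp add: locfin_def)
  finally show ?thesis .
qed

lemma integral_smear:
  fixes f :: "(nat \<Rightarrow> real) \<Rightarrow> real"
  assumes [measurable]: "f \<in> borel_measurable (BN N)" and f: "\<And>x. x \<in> sp N \<Longrightarrow> \<bar>f x\<bar> \<le> C * indicator (cube N K) x"
    and C: "C \<ge> 0"
  shows "(\<integral>x. f x \<partial>smear N z M) = (\<integral>r. (\<integral>y. f (shift N z (- r) y) \<partial>M) \<partial>unit01)"
    and "integrable unit01 (\<lambda>r. \<integral>y. f (shift N z (- r) y) \<partial>M)"
proof -
  note [measurable_cong] = locfin_sets
  let ?K = "K + (\<Sum>i<N. \<bar>z i\<bar>)"
  interpret M: sigma_finite_measure M by (rule locfin_sigma_finite[OF M])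
  interpret pair_sigma_finite unit01 M by unfold_locales
  have int: "integrable (unit01 \<Otimes>\<^sub>M M) (\<lambda>p. f (shift N z (- fst p) (snd p)))"
  proof (rule integrable_pair_unit01[where g = "\<lambda>y. C * indicator (cube N ?K) y"])
    show "integrable M (\<lambda>y. C * indicator (cube N ?K) y)"
      using M by (intro integrable_mult_right integrable_real_indicator) (auto simp: locfin_def)
    fix r y assume r: "0 \<le> r" "r \<le> (1::real)" and y: "y \<in> space M"
    have "\<bar>f (shift N z (- r) y)\<bar> \<le> C * indicator (cube N K) (shift N z (- r) y)"
      by (intro f shift_in_sp)
    also have "\<dots> \<le> C * indicator (cube N ?K) y"
      using shift_cube[of N z "- r" y K] r y C by (intro mult_left_mono) (auto simp: locfin_space indicator_def)
    finally show "\<bar>f (shift N z (- fst (r, y)) (snd (r, y)))\<bar> \<le> C * indicator (cube N ?K) y" by simp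
  qed (use M.sigma_finite_measure_axioms in auto)
  have "(\<integral>x. f x \<partial>smear N z M) = (\<integral>p. f (shift N z (- fst p) (snd p)) \<partial>(unit01 \<Otimes>\<^sub>M M))"
    unfolding smear_def by (subst integral_distr) auto
  also have "\<dots> = (\<integral>r. (\<integral>y. f (shift N z (- r) y) \<partial>M) \<partial>unit01)"
    using integral_fst'[OF int] by simp
  finally show "(\<integral>x. f x \<partial>smear N z M) = (\<integral>r. (\<integral>y. f (shift N z (- r) y) \<partial>M) \<partial>unit01)" .
  show "integrable unit01 (\<lambda>r. \<integral>y. f (shift N z (- r) y) \<partial>M)"
    using integrable_fst'[OF int] by simp
qed

end

text \<open>P i - Q i is the i-th partial derivative of u, tested against products of bump
  functions. Sobolev functions enter with the positive and negative parts of g i as densities,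
  functions of bounded variation with their given pairs of finite measures.\<close>

locale measure_gradient =
  fixes N :: nat and u :: "(nat \<Rightarrow> real) \<Rightarrow> real" and P Q :: "nat \<Rightarrow> (nat \<Rightarrow> real) measure"
  assumes u [measurable]: "u \<in> borel_measurable (BN N)"
    and u_int: "set_integrable (BN N) (cube N K) u"
    and P: "i < N \<Longrightarrow> locfin N (P i)" and Q: "i < N \<Longrightarrow> locfin N (Q i)"
    and weak: "bumpseq N R \<Longrightarrow> i < N \<Longrightarrow> (\<integral>x. u x * bumpfun N R (e1 i) x \<partial>BN N)
      = - ((\<integral>x. bumpfun N R (\<lambda>_. 0) x \<partial>P i) - (\<integral>x. bumpfun N R (\<lambda>_. 0) x \<partial>Q i))"
begin

lemma integrable_mult_bounded:
  assumes [measurable]: "f \<in> borel_measurable (BN N)" and f: "\<And>x. x \<in> sp N \<Longrightarrow> \<bar>f x\<bar> \<le> C * indicator (cube N K) x"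
  shows "integrable (BN N) (\<lambda>x. u x * f x)"
proof (rule Bochner_Integration.integrable_bound)
  show "integrable (BN N) (\<lambda>x. C * (indicator (cube N K) x *\<^sub>R u x))"
    using u_int[of K] by (intro integrable_mult_right) (simp add: set_integrable_def)
  show "AE x in BN N. norm (u x * f x) \<le> norm (C * (indicator (cube N K) x *\<^sub>R u x))"
  proof (rule AE_I2)
    fix x assume "x \<in> space (BN N)"
    then have "\<bar>f x\<bar> \<le> C * indicator (cube N K) x" using f by (simp add: space_BN)
    also have "\<dots> \<le> \<bar>C * indicator (cube N K) x\<bar>" by simp
    finally have "\<bar>u x\<bar> * \<bar>f x\<bar> \<le> \<bar>u x\<bar> * \<bar>C * indicator (cube N K) x\<bar>" by (rule mult_left_mono) simp
    then show "norm (u x * f x) \<le> norm (C * (indicator (cube N K) x *\<^sub>R u x))" by (simp add: abs_mult mult_ac)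
  qed
qed measurable

text \<open>The translation is moved to the test function, and \<phi> (x - z) - \<phi> x is minus
  the integral of z \<bullet> \<nabla>\<phi> (x - r z) over r in [0, 1]. After Fubini the weak
  identity is applied for each r, and the remaining average over r is what \<open>smear\<close>
  records. The sign from the chain rule cancels the one from integration by parts.\<close>

lemma bump_identity:
  assumes R: "bumpseq N R" and z [measurable]: "z \<in> space (BN N)"
  shows "(\<integral>x. (u (shift N z 1 x) - u x) * bumpfun N R (\<lambda>_. 0) x \<partial>BN N)
    = (\<Sum>i<N. z i * ((\<integral>x. bumpfun N R (\<lambda>_. 0) x \<partial>smear N z (P i)) - (\<integral>x. bumpfun N R (\<lambda>_. 0) x \<partial>smear N z (Q i))))"
proof -
  define \<phi> where "\<phi> = bumpfun N R (\<lambda>_. 0)"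
  define \<psi> where "\<psi> = (\<lambda>i. bumpfun N R (e1 i))"
  have m: "bumpfun N R m \<in> borel_measurable (BN N)" for m
    using bumpfun_measurable[OF R measurable_ident, of m] by simp
  have [measurable]: "\<phi> \<in> borel_measurable (BN N)" "\<psi> i \<in> borel_measurable (BN N)" for i
    using m by (auto simp: \<phi>_def \<psi>_def)
  interpret UB: pair_sigma_finite unit01 "BN N" by unfold_locales
  let ?s = "\<Sum>i<N. \<bar>z i\<bar>"
  obtain K C where KC: "K \<ge> 0" "C \<ge> 0" "\<And>x. x \<in> sp N \<Longrightarrow> \<bar>\<phi> x\<bar> \<le> C * indicator (cube N K) x"
    using bumpfun_bound[OF R, of "\<lambda>_. 0"] unfolding \<phi>_def by blast
  \<comment> \<open>For all r in [0, 1] the translated functions live in one enlarged cube; this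
    gives domination uniformly in r, as Fubini requires.\<close>
  have shifted: "\<bar>f (shift N z (- r) x)\<bar> \<le> C * indicator (cube N (K + ?s)) x"
    if "\<And>x. x \<in> sp N \<Longrightarrow> \<bar>f x\<bar> \<le> C * indicator (cube N K) x" "C \<ge> 0" "0 \<le> r" "r \<le> 1" "x \<in> sp N"
    for f :: "_ \<Rightarrow> real" and C K r x
  proof -
    have "\<bar>f (shift N z (- r) x)\<bar> \<le> C * indicator (cube N K) (shift N z (- r) x)"
      by (intro that shift_in_sp)
    also have "\<dots> \<le> C * indicator (cube N (K + ?s)) x"
      using shift_cube[of N z "- r" x K] that by (intro mult_left_mono) (auto simp: indicator_def)
    finally show ?thesis .
  qed
  have i1: "integrable (BN N) (\<lambda>x. u x * \<phi> x)"
    by (intro integrable_mult_bounded[OF _ KC(3)]) measurable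
  have i2: "integrable (BN N) (\<lambda>x. u x * \<phi> (shift N z (- 1) x))"
    by (intro integrable_mult_bounded[OF _ shifted[OF KC(3,2)]]) auto
  have sh_inv: "shift N z (- 1) (shift N z 1 x) = x" if "x \<in> space (BN N)" for x
    using that by (simp add: shift_shift shift_0 space_BN)
  have i3: "integrable (BN N) (\<lambda>x. u (shift N z 1 x) * \<phi> x)"
    using integrable_shift[OF i2, of z 1] by (simp add: sh_inv cong: Bochner_Integration.integrable_cong)
  have "(\<integral>x. u (shift N z 1 x) * \<phi> x \<partial>BN N) = (\<integral>x. u (shift N z 1 x) * \<phi> (shift N z (- 1) (shift N z 1 x)) \<partial>BN N)"
    by (intro Bochner_Integration.integral_cong) (auto simp: sh_inv)
  also have "\<dots> = (\<integral>x. u x * \<phi> (shift N z (- 1) x) \<partial>BN N)"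
    using integral_shift[of "\<lambda>x. u x * \<phi> (shift N z (- 1) x)" N z 1] by simp
  finally have "(\<integral>x. (u (shift N z 1 x) - u x) * \<phi> x \<partial>BN N) = (\<integral>x. u x * (\<phi> (shift N z (- 1) x) - \<phi> x) \<partial>BN N)"
    using i1 i2 i3 by (simp add: left_diff_distrib right_diff_distrib)
  also have "\<dots> = (\<integral>x. (\<Sum>i<N. - z i * (\<integral>r. u x * \<psi> i (shift N z (- r) x) \<partial>unit01)) \<partial>BN N)"
  proof (rule Bochner_Integration.integral_cong[OF refl])
    fix x assume x [measurable]: "x \<in> space (BN N)"
    define F where "F = (\<lambda>r. \<phi> (shift N z (- r) x))"
    define F' where "F' = (\<lambda>r. - (\<Sum>i<N. z i * \<psi> i (shift N z (- r) x)))"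
    have cont: "continuous_on A (\<lambda>r. \<psi> i (shift N z (- r) x))" for A i
      unfolding \<psi>_def by (intro continuous_on_compose2[OF bumpfun_line_continuous[OF R, of UNIV]] continuous_intros) auto
    have dF: "(F has_real_derivative F' r) (at r)" for r
    proof -
      have "((\<lambda>r. (\<lambda>r. bumpfun N R (\<lambda>_. 0) (shift N z r x)) (- r)) has_real_derivative
          (\<Sum>i<N. z i * bumpfun N R (e1 i) (shift N z (- r) x)) * (- 1)) (at r)"
        by (rule DERIV_chain2[where g=uminus], rule bumpfun_line_deriv[OF R]) (auto intro!: derivative_eq_intros)
      then show ?thesis by (simp add: F_def F'_def \<phi>_def \<psi>_def)
    qed
    have "(\<integral>r. indicator {0..1} r *\<^sub>R F' r \<partial>lborel) = F 1 - F 0"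
    proof (rule integral_FTC_atLeastAtMost)
      show "(F has_vector_derivative F' r) (at r within {0..1})" for r
        unfolding has_real_derivative_iff_has_vector_derivative[symmetric] by (rule has_field_derivative_at_within[OF dF])
      show "continuous_on {0..1} F'" unfolding F'_def by (intro continuous_intros cont)
    qed simp
    moreover have [measurable]: "F' \<in> borel_measurable borel" unfolding F'_def by measurable
    ultimately have "F 1 - F 0 = (\<integral>r. F' r \<partial>unit01)" by (simp add: integral_unit01)
    also have "\<dots> = (\<Sum>i<N. - z i * (\<integral>r. \<psi> i (shift N z (- r) x) \<partial>unit01))"
    proof -
      have "integrable unit01 (\<lambda>r. \<psi> i (shift N z (- r) x))" if i: "i < N" for i
      proof -
        obtain K C where KC: "\<forall>x\<in>sp N. \<bar>\<psi> i x\<bar> \<le> C * indicator (cube N K) x" "C \<ge> 0"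
          using bumpfun_bound[OF R, of "e1 i"] unfolding \<psi>_def by blast
        have "\<bar>\<psi> i (shift N z (- r) x)\<bar> \<le> C" for r
        proof -
          have "\<bar>\<psi> i (shift N z (- r) x)\<bar> \<le> C * indicator (cube N K) (shift N z (- r) x)"
            using bspec[OF KC(1) shift_in_sp[of N z "- r" x]] .
          also have "\<dots> \<le> C * 1" using KC(2) by (intro mult_left_mono) (auto simp: indicator_def)
          finally show ?thesis by simp
        qed
        moreover have "(\<lambda>r. \<psi> i (shift N z (- r) x)) \<in> borel_measurable unit01"
          using borel_measurable_continuous_onI[OF cont, of i] by (simp add: measurable_cong_sets[OF sets_unit01 refl])
        ultimately show ?thesis by (intro U.integrable_const_bound[of _ C] AE_I2) auto
      qed
      moreover have "F' = (\<lambda>r. \<Sum>i<N. - z i * \<psi> i (shift N z (- r) x))"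
        by (simp add: F'_def sum_negf)
      ultimately show ?thesis by (simp add: Bochner_Integration.integral_sum)
    qed
    finally have "\<phi> (shift N z (- 1) x) - \<phi> x = (\<Sum>i<N. - z i * (\<integral>r. \<psi> i (shift N z (- r) x) \<partial>unit01))"
      using x by (simp add: F_def shift_0 space_BN)
    then show "u x * (\<phi> (shift N z (- 1) x) - \<phi> x) = (\<Sum>i<N. - z i * (\<integral>r. u x * \<psi> i (shift N z (- r) x) \<partial>unit01))"
      by (simp add: sum_distrib_left mult_ac)
  qed
  also have "\<dots> = (\<Sum>i<N. z i * ((\<integral>x. \<phi> x \<partial>smear N z (P i)) - (\<integral>x. \<phi> x \<partial>smear N z (Q i))))"
  proof -
    have *: "integrable (BN N) (\<lambda>x. \<integral>r. u x * \<psi> i (shift N z (- r) x) \<partial>unit01) \<and>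
      (\<integral>x. \<integral>r. u x * \<psi> i (shift N z (- r) x) \<partial>unit01 \<partial>BN N) = - ((\<integral>x. \<phi> x \<partial>smear N z (P i)) - (\<integral>x. \<phi> x \<partial>smear N z (Q i)))"
      if i: "i < N" for i
    proof -
      obtain K C where KC': "\<forall>x\<in>sp N. \<bar>\<psi> i x\<bar> \<le> C * indicator (cube N K) x" "C \<ge> 0"
        using bumpfun_bound[OF R, of "e1 i"] unfolding \<psi>_def by blast
      then have KC': "\<And>x. x \<in> sp N \<Longrightarrow> \<bar>\<psi> i x\<bar> \<le> C * indicator (cube N K) x" "C \<ge> 0" by auto
      have int: "integrable (unit01 \<Otimes>\<^sub>M BN N) (\<lambda>(r, x). u x * \<psi> i (shift N z (- r) x))"
      proof (rule integrable_pair_unit01[where g = "\<lambda>x. \<bar>u x * (C * indicator (cube N (K + ?s)) x)\<bar>"])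
        show "integrable (BN N) (\<lambda>x. \<bar>u x * (C * indicator (cube N (K + ?s)) x)\<bar>)"
          using KC'(2) by (intro integrable_abs integrable_mult_bounded[where C=C and K="K + ?s"]) auto
        fix r x assume r: "0 \<le> r" "r \<le> (1::real)" and x: "x \<in> space (BN N)"
        have "\<bar>u x\<bar> * \<bar>\<psi> i (shift N z (- r) x)\<bar> \<le> \<bar>u x\<bar> * (C * indicator (cube N (K + ?s)) x)"
          using shifted[OF KC' r] x by (intro mult_left_mono) (auto simp: space_BN)
        then show "\<bar>case (r, x) of (r, x) \<Rightarrow> u x * \<psi> i (shift N z (- r) x)\<bar> \<le> \<bar>u x * (C * indicator (cube N (K + ?s)) x)\<bar>"
          using KC'(2) by (simp add: abs_mult)
      next
        show "(\<lambda>(r, x). u x * \<psi> i (shift N z (- r) x)) \<in> borel_measurable (unit01 \<Otimes>\<^sub>M BN N)"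
          by measurable
      qed (rule sigma_finite_BN)
      have "(\<integral>x. \<integral>r. u x * \<psi> i (shift N z (- r) x) \<partial>unit01 \<partial>BN N) = (\<integral>r. \<integral>x. u x * \<psi> i (shift N z (- r) x) \<partial>BN N \<partial>unit01)"
        using UB.Fubini_integral[OF int] .
      also have "\<dots> = (\<integral>r. - ((\<integral>y. \<phi> (shift N z (- r) y) \<partial>P i) - (\<integral>y. \<phi> (shift N z (- r) y) \<partial>Q i)) \<partial>unit01)"
        unfolding \<phi>_def \<psi>_def bumpfun_shift
        by (intro Bochner_Integration.integral_cong refl weak[OF _ i] bumpseq_shift R)
      also have "\<dots> = - ((\<integral>x. \<phi> x \<partial>smear N z (P i)) - (\<integral>x. \<phi> x \<partial>smear N z (Q i)))"
        using integral_smear[OF P[OF i] z _ KC(3,2)] integral_smear[OF Q[OF i] z _ KC(3,2)] by simp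
      finally show ?thesis using UB.integrable_snd[OF int] by simp
    qed
    have "(\<integral>x. (\<Sum>i<N. - z i * (\<integral>r. u x * \<psi> i (shift N z (- r) x) \<partial>unit01)) \<partial>BN N)
       = (\<Sum>i<N. - z i * (\<integral>x. \<integral>r. u x * \<psi> i (shift N z (- r) x) \<partial>unit01 \<partial>BN N))"
      using * by (subst Bochner_Integration.integral_sum) auto
    also have "\<dots> = (\<Sum>i<N. z i * ((\<integral>x. \<phi> x \<partial>smear N z (P i)) - (\<integral>x. \<phi> x \<partial>smear N z (Q i))))"
    proof (rule sum.cong[OF refl])
      fix i assume "i \<in> {..<N}"
      with *[of i] show "- z i * (\<integral>x. \<integral>r. u x * \<psi> i (shift N z (- r) x) \<partial>unit01 \<partial>BN N)
        = z i * ((\<integral>x. \<phi> x \<partial>smear N z (P i)) - (\<integral>x. \<phi> x \<partial>smear N z (Q i)))"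
        by (simp only: lessThan_iff minus_mult_minus)
    qed
    finally show ?thesis .
  qed
  finally show ?thesis unfolding \<phi>_def .
qed

lemma integrable_increment:
  assumes z [measurable]: "z \<in> space (BN N)"
  shows "integrable (BN N) (\<lambda>x. (u (shift N z 1 x) - u x) * indicator (cube N K) x)"
proof -
  have i1: "integrable (BN N) (\<lambda>x. u x * indicator (cube N K) x)"
    by (rule integrable_mult_bounded[where C=1 and K=K]) auto
  have "integrable (BN N) (\<lambda>x. u x * indicator (cube N K) (shift N z (- 1) x))"
    by (rule integrable_mult_bounded[where C=1 and K="K + (\<Sum>i<N. \<bar>z i\<bar>)"])
      (use shift_cube[of N z "- 1" _ K] in \<open>auto simp: indicator_def\<close>)
  from integrable_shift[OF this, of z 1]
  have "integrable (BN N) (\<lambda>x. u (shift N z 1 x) * indicator (cube N K) x)"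
    by (rule Bochner_Integration.integrable_cong[OF refl, THEN iffD1, rotated]) (auto simp: shift_shift shift_0 space_BN)
  with i1 show ?thesis by (simp add: left_diff_distrib)
qed

text \<open>Products of bumps are bounded by the indicator of the box and converge to it pointwise
  as c tends to 0, so both sides of \<open>bump_identity\<close> pass to the limit by dominated
  convergence. The boxes are open because bumps vanish at the end points.\<close>

lemma box_identity:
  assumes z [measurable]: "z \<in> space (BN N)"
  shows "(\<integral>x. (u (shift N z 1 x) - u x) * indicator (obox N a b) x \<partial>BN N)
    = (\<Sum>i<N. z i * (measure (smear N z (P i)) (obox N a b) - measure (smear N z (Q i)) (obox N a b)))"
proof (cases "\<forall>i<N. a i < b i")
  case False
  then obtain i where "i < N" "\<not> a i < b i" by auto
  then have "obox N a b = {}" by (force simp: obox_def PiE_iff)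
  then show ?thesis by simp
next
  case True
  define c where "c = (\<lambda>n::nat. 1 / real (Suc n))"
  have "\<exists>R. bumpseq N R \<and> (\<forall>i<N. R i 0 = (\<lambda>x. if a i < x \<and> x < b i then exp (- (c n / ((x - a i) * (b i - x)))) else 0))" for n
    using True by (intro ex_bumpseq) (auto simp: c_def)
  then obtain R where R: "\<And>n. bumpseq N (R n)"
    and R0: "\<And>n i. i < N \<Longrightarrow> R n i 0 = (\<lambda>x. if a i < x \<and> x < b i then exp (- (c n / ((x - a i) * (b i - x)))) else 0)"
    by metis
  define \<phi> where "\<phi> = (\<lambda>n. bumpfun N (R n) (\<lambda>_. 0))"
  have [measurable]: "\<phi> n \<in> borel_measurable (BN N)" for n
    using bumpfun_measurable[OF R measurable_ident, of n "\<lambda>_. 0"] by (simp add: \<phi>_def)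
  have bnd: "\<bar>\<phi> n x\<bar> \<le> indicator (obox N a b) x" if xsp: "x \<in> sp N" for n x
  proof (cases "x \<in> obox N a b")
    case x: True
    have "(\<Prod>i<N. \<bar>R n i 0 (x i)\<bar>) \<le> (\<Prod>i<N. 1)"
      by (intro prod_mono) (auto simp: R0 c_def intro!: divide_nonneg_nonneg mult_nonneg_nonneg)
    then show ?thesis using x by (simp add: \<phi>_def bumpfun_def abs_prod)
  next
    case False
    then obtain i where "i < N" "\<not> (a i < x i \<and> x i < b i)" using xsp by (auto simp: obox_def sp_def PiE_iff)
    then have "\<phi> n x = 0" by (force simp: \<phi>_def bumpfun_def R0)
    then show ?thesis by simp
  qed
  have lim: "(\<lambda>n. \<phi> n x) \<longlonglongrightarrow> indicator (obox N a b) x" if "x \<in> sp N" for x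
  proof (cases "x \<in> obox N a b")
    case x: True
    have c0: "c \<longlonglongrightarrow> 0" unfolding c_def by (rule lim_1_over_n[THEN LIMSEQ_Suc])
    have "(\<lambda>n. \<Prod>i<N. exp (- (c n / ((x i - a i) * (b i - x i))))) \<longlonglongrightarrow> (\<Prod>i<N. exp (- (0 / ((x i - a i) * (b i - x i)))))"
      using x by (intro tendsto_prod tendsto_exp tendsto_minus tendsto_divide c0 tendsto_const) (force simp: obox_def PiE_iff)
    moreover have "\<phi> n x = (\<Prod>i<N. exp (- (c n / ((x i - a i) * (b i - x i)))))" for n
      using x by (auto simp: \<phi>_def bumpfun_def R0 obox_def PiE_iff intro!: prod.cong)
    ultimately show ?thesis using x by simp
  next
    case False
    have "\<phi> n x = 0" for n using bnd[OF that, of n] False by simp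
    then show ?thesis using False by simp
  qed
  define K where "K = (\<Sum>i<N. \<bar>a i\<bar> + \<bar>b i\<bar>)"
  have sub: "obox N a b \<subseteq> cube N K"
  proof
    fix x assume x: "x \<in> obox N a b"
    have "\<bar>x i\<bar> \<le> K" if i: "i < N" for i
    proof -
      have "\<bar>a i\<bar> + \<bar>b i\<bar> \<le> K" unfolding K_def using i by (intro member_le_sum) auto
      moreover have "x i \<in> {a i<..<b i}" using PiE_mem[of x "{..<N}" "\<lambda>i. {a i<..<b i}" i] x i by (simp add: obox_def)
      ultimately show ?thesis by auto
    qed
    then show "x \<in> cube N K" using x by (auto simp: mem_cube obox_def sp_def PiE_iff)
  qed
  define D where "D = (\<lambda>x. u (shift N z 1 x) - u x)"
  have [measurable]: "D \<in> borel_measurable (BN N)" unfolding D_def by measurable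
  have "(\<lambda>n. \<integral>x. D x * \<phi> n x \<partial>BN N) \<longlonglongrightarrow> (\<integral>x. D x * indicator (obox N a b) x \<partial>BN N)"
  proof (rule integral_dominated_convergence[where w = "\<lambda>x. \<bar>D x * indicator (cube N K) x\<bar>"])
    show "integrable (BN N) (\<lambda>x. \<bar>D x * indicator (cube N K) x\<bar>)"
      unfolding D_def by (intro integrable_abs integrable_increment z)
    show "AE x in BN N. (\<lambda>n. D x * \<phi> n x) \<longlonglongrightarrow> D x * indicator (obox N a b) x"
      using lim by (intro AE_I2 tendsto_mult tendsto_const) (auto simp: space_BN)
    show "AE x in BN N. norm (D x * \<phi> n x) \<le> \<bar>D x * indicator (cube N K) x\<bar>" for n
    proof (rule AE_I2)
      fix x assume "x \<in> space (BN N)"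
      then have "\<bar>\<phi> n x\<bar> \<le> indicator (obox N a b) x" using bnd by (simp add: space_BN)
      also have "\<dots> \<le> indicator (cube N K) x" using sub by (auto simp: indicator_def)
      finally show "norm (D x * \<phi> n x) \<le> \<bar>D x * indicator (cube N K) x\<bar>"
        by (simp add: abs_mult mult_left_mono)
    qed
  qed measurable
  moreover have "(\<lambda>n. \<Sum>i<N. z i * ((\<integral>x. \<phi> n x \<partial>smear N z (P i)) - (\<integral>x. \<phi> n x \<partial>smear N z (Q i))))
    \<longlonglongrightarrow> (\<Sum>i<N. z i * (measure (smear N z (P i)) (obox N a b) - measure (smear N z (Q i)) (obox N a b)))"
  proof -
    have "(\<lambda>n. \<integral>x. \<phi> n x \<partial>smear N z M) \<longlonglongrightarrow> measure (smear N z M) (obox N a b)" if M: "locfin N M" for M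
    proof -
      have sp: "space (smear N z M) = sp N" using sets_eq_imp_space_eq[OF sets_smear] by (simp add: space_BN)
      have "emeasure (smear N z M) (obox N a b) \<le> emeasure (smear N z M) (cube N K)"
        by (intro emeasure_mono sub) simp_all
      also have "\<dots> < \<infinity>" by (rule emeasure_smear_cube[OF M z])
      finally have fin: "emeasure (smear N z M) (obox N a b) < \<infinity>" .
      have "(\<lambda>n. \<integral>x. \<phi> n x \<partial>smear N z M) \<longlonglongrightarrow> (\<integral>x. indicator (obox N a b) x \<partial>smear N z M)"
      proof (rule integral_dominated_convergence[where w = "indicator (obox N a b)"])
        show "integrable (smear N z M) (indicator (obox N a b) :: _ \<Rightarrow> real)"
          using fin by (intro integrable_real_indicator) auto
      next
        show "AE x in smear N z M. (\<lambda>n. \<phi> n x) \<longlonglongrightarrow> indicator (obox N a b) x"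
          using lim by (intro AE_I2) (auto simp: sp)
        show "AE x in smear N z M. norm (\<phi> n x) \<le> indicator (obox N a b) x" for n
          using bnd by (intro AE_I2) (auto simp: sp)
      qed (simp_all add: measurable_cong_sets[OF sets_smear refl])
      moreover have "obox N a b \<inter> sp N = obox N a b" by (auto simp: obox_def sp_def PiE_iff)
      ultimately show ?thesis by (simp add: sp)
    qed
    then show ?thesis using P Q by (intro tendsto_sum tendsto_mult tendsto_diff tendsto_const) auto
  qed
  moreover have "(\<integral>x. D x * \<phi> n x \<partial>BN N) = (\<Sum>i<N. z i * ((\<integral>x. \<phi> n x \<partial>smear N z (P i)) - (\<integral>x. \<phi> n x \<partial>smear N z (Q i))))" for n
    unfolding D_def \<phi>_def by (rule bump_identity[OF R z])
  ultimately show ?thesis unfolding D_def by (simp add: LIMSEQ_unique)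
qed

text \<open>The extension from boxes by \<open>measure_combination_eqI\<close> needs finite
  measures. The increment D is split into its positive and negative part, each used as a density,
  and everything is restricted to a bounded set C that contains A.\<close>

lemma set_identity:
  assumes z [measurable]: "z \<in> space (BN N)" and A [measurable]: "A \<in> sets (BN N)" and AK: "A \<subseteq> cube N K"
  shows "(\<integral>x. (u (shift N z 1 x) - u x) * indicator A x \<partial>BN N)
    = (\<Sum>i<N. z i * (measure (smear N z (P i)) A - measure (smear N z (Q i)) A))"
proof -
  \<comment> \<open>L exceeds K, so the open box C still contains the closed cube. C is a box itself
    in order that its intersection with any box is one to which \<open>box_identity\<close>
    applies.\<close>
  define L where "L = \<bar>K\<bar> + 1"
  define C where "C = obox N (\<lambda>_. - L) (\<lambda>_. L)"
  have AC: "A \<subseteq> C" using AK by (force simp: C_def obox_def cube_def L_def PiE_iff)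
  have CL: "C \<subseteq> cube N L" unfolding C_def obox_def cube_def by (intro PiE_mono) auto
  have [measurable]: "C \<in> sets (BN N)" by (simp add: C_def)
  define D where "D = (\<lambda>x. u (shift N z 1 x) - u x)"
  have [measurable]: "D \<in> borel_measurable (BN N)" unfolding D_def by measurable
  have intD: "integrable (BN N) (\<lambda>x. D x * indicator B x)" if B [measurable]: "B \<in> sets (BN N)" and "B \<subseteq> C" for B
  proof (rule Bochner_Integration.integrable_bound)
    show "integrable (BN N) (\<lambda>x. D x * indicator (cube N L) x)"
      unfolding D_def by (rule integrable_increment[OF z])
    show "AE x in BN N. norm (D x * indicator B x) \<le> norm (D x * indicator (cube N L) x)"
      using that CL by (intro AE_I2) (auto simp: indicator_def)
  qed measurable
  \<comment> \<open>An index i < N stands for a component of the gradient and the index N for the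
    increment; s selects P or Q, respectively the positive or negative part, since
    \<open>ennreal\<close> sends negative reals to 0.\<close>
  define M where "M = (\<lambda>(s::bool, i). if i < N then density (smear N z (if s then P i else Q i)) (indicator C)
     else density (BN N) (\<lambda>x. ennreal ((if s then D x else - D x) * indicator C x)))"
  define cf where "cf = (\<lambda>(s::bool, i). (if i < N then - z i else 1) * (if s then 1 else - 1 :: real))"
  have m_smear: "measure (M (s, i)) B = measure (smear N z (if s then P i else Q i)) (B \<inter> C)"
    if "i < N" "B \<in> sets (BN N)" for s i B
  proof -
    have "emeasure (M (s, i)) B = emeasure (smear N z (if s then P i else Q i)) (C \<inter> B)"
      using that unfolding M_def by (auto simp: emeasure_restricted simp del: sets.Int)
    then show ?thesis by (simp add: measure_def Int_commute)
  qed
  have m_D: "measure (M (True, N)) B - measure (M (False, N)) B = (\<integral>x. D x * indicator (B \<inter> C) x \<partial>BN N)"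
    if [measurable]: "B \<in> sets (BN N)" for B
  proof -
    have "emeasure (M (s, N)) B = (\<integral>\<^sup>+x. ennreal (if s then D x * indicator (B \<inter> C) x else - (D x * indicator (B \<inter> C) x)) \<partial>BN N)" for s
      unfolding M_def by (auto simp: emeasure_density indicator_def intro!: nn_integral_cong)
    then show ?thesis
      using real_lebesgue_integral_def[OF intD[of "B \<inter> C"]] by (simp add: measure_def)
  qed
  have comb: "(\<Sum>j\<in>UNIV \<times> {..N}. cf j * measure (M j) B) = (\<integral>x. D x * indicator (B \<inter> C) x \<partial>BN N)
      - (\<Sum>i<N. z i * (measure (smear N z (P i)) (B \<inter> C) - measure (smear N z (Q i)) (B \<inter> C)))"
    if B: "B \<in> sets (BN N)" for B
  proof -
    have "(\<Sum>j\<in>UNIV \<times> {..N}. cf j * measure (M j) B)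
      = (cf (True, N) * measure (M (True, N)) B + cf (False, N) * measure (M (False, N)) B)
        + (\<Sum>i<N. cf (True, i) * measure (M (True, i)) B + cf (False, i) * measure (M (False, i)) B)"
      by (simp add: sum.cartesian_product' UNIV_bool lessThan_Suc_atMost[symmetric] sum.distrib)
    also have "(\<Sum>i<N. cf (True, i) * measure (M (True, i)) B + cf (False, i) * measure (M (False, i)) B)
      = (\<Sum>i<N. - (z i * (measure (smear N z (P i)) (B \<inter> C) - measure (smear N z (Q i)) (B \<inter> C))))"
      using B by (intro sum.cong) (auto simp: cf_def m_smear algebra_simps)
    also have "cf (True, N) * measure (M (True, N)) B + cf (False, N) * measure (M (False, N)) B = (\<integral>x. D x * indicator (B \<inter> C) x \<partial>BN N)"
      using m_D[OF B] by (simp add: cf_def)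
    finally show ?thesis by (simp add: sum_negf)
  qed
  have "(\<Sum>j\<in>UNIV \<times> {..N}. cf j * measure (M j) A) = 0"
  proof (rule measure_combination_eqI)
    fix j :: "bool \<times> nat" assume j: "j \<in> UNIV \<times> {..N}"
    obtain s i where si: "j = (s, i)" by force
    show sets: "sets (M j) = sets (BN N)" by (simp add: M_def si)
    show "finite_measure (M j)"
    proof (rule finite_measureI)
      have sp: "space (M j) = sp N" using sets_eq_imp_space_eq[OF sets] by (simp add: space_BN)
      have spB: "sp N \<in> sets (BN N)" using sets.top[of "BN N"] by (simp add: space_BN)
      show "emeasure (M j) (space (M j)) \<noteq> \<infinity>"
      proof (cases "i < N")
        case True
        have lf: "locfin N (if s then P i else Q i)" using P Q True by simp
        have "emeasure (M j) (space (M j)) = emeasure (smear N z (if s then P i else Q i)) (C \<inter> sp N)"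
          unfolding sp using True spB unfolding M_def si by (simp add: emeasure_restricted)
        also have "\<dots> \<le> emeasure (smear N z (if s then P i else Q i)) (cube N L)"
          using CL by (intro emeasure_mono) auto
        also have "\<dots> < \<infinity>" by (rule emeasure_smear_cube[OF lf z])
        finally show ?thesis by simp
      next
        case False
        have "emeasure (M j) (space (M j)) \<le> (\<integral>\<^sup>+x. ennreal (norm (D x * indicator C x)) \<partial>BN N)"
          unfolding sp using False spB unfolding M_def si
          by (auto simp: emeasure_density indicator_def intro!: nn_integral_mono ennreal_leI)
        also have "\<dots> < \<infinity>" using intD[of C] by (simp add: integrable_iff_bounded)
        finally show ?thesis by simp
      qed
    qed
  next
    fix a b
    have "obox N a b \<inter> C = obox N (\<lambda>i. max (a i) (- L)) (\<lambda>i. min (b i) L)" by (simp add: C_def obox_Int)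
    then show "(\<Sum>j\<in>UNIV \<times> {..N}. cf j * measure (M j) (obox N a b)) = 0"
      unfolding comb[OF obox_sets] D_def by (simp only: box_identity[OF z])
  qed (use A in auto)
  moreover have "A \<inter> C = A" using AC by auto
  ultimately show ?thesis
    unfolding comb[OF A] D_def by simp
qed

end

subsection \<open>From pointwise increment bounds to level sets\<close>

text \<open>The counterpart of \<open>nu\<close> over the Borel product measure, for a Borel
  representative v. The diagonal contributes nothing, as 0 powr (\<gamma> - N) = 0.\<close>

definition level_energy :: "nat \<Rightarrow> real \<Rightarrow> real \<Rightarrow> real \<Rightarrow> ((nat \<Rightarrow> real) \<Rightarrow> real) \<Rightarrow> ennreal" where
  "level_energy N \<gamma> b lam v = (\<integral>\<^sup>+x. (\<integral>\<^sup>+y. (if lam < \<bar>v x - v y\<bar> / rdist N x y powr (1 + b)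
     then ennreal (rdist N x y powr (\<gamma> - N)) else 0) \<partial>BN N) \<partial>BN N)"

lemma rdist_measurable [measurable (raw)]:
  assumes "f \<in> measurable M (BN N)" "g \<in> measurable M (BN N)"
  shows "(\<lambda>\<omega>. rdist N (f \<omega>) (g \<omega>)) \<in> borel_measurable M"
proof -
  have [measurable]: "(\<lambda>\<omega>. \<Sum>i<N. (f \<omega> i - g \<omega> i)\<^sup>2) \<in> borel_measurable M"
    by (intro borel_measurable_sum borel_measurable_power borel_measurable_diff) (auto intro: component_measurable assms)
  show ?thesis unfolding rdist_def by measurable
qed

lemma nu_le_level_energy:
  assumes ae: "AE x in BN N. u x = v x"
  shows "nu N \<gamma> (Elev N u lam b) \<le> level_energy N \<gamma> b lam v"
  unfolding nu_def level_energy_def LN_def nn_integral_completion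
proof (rule nn_integral_mono_AE, use ae in eventually_elim)
  fix x assume x: "u x = v x"
  show "(\<integral>\<^sup>+y. indicator (Elev N u lam b) (x, y) * indicator {q. fst q \<noteq> snd q} (x, y) * ennreal (rdist N x y powr (\<gamma> - real N)) \<partial>BN N)
    \<le> (\<integral>\<^sup>+y. (if lam < \<bar>v x - v y\<bar> / rdist N x y powr (1 + b) then ennreal (rdist N x y powr (\<gamma> - real N)) else 0) \<partial>BN N)"
    by (rule nn_integral_mono_AE, use ae in eventually_elim) (auto simp: Elev_def x indicator_def)
qed

lemma rdist_shift: "rdist N x (shift N z 1 x) = nrm N z"
  by (simp add: rdist_def nrm_def shift_def)

lemma shift_commute: "shift N x 1 z = shift N z 1 x"
  by (auto simp: shift_def fun_eq_iff)

text \<open>After the substitution y = x + z and Fubini the displacement z is the outer variable.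
  Statements for almost every x, with a null set depending on z, can then be used inside.\<close>

lemma level_energy_shift:
  assumes [measurable]: "v \<in> borel_measurable (BN N)"
  shows "level_energy N \<gamma> b lam v = (\<integral>\<^sup>+z. (\<integral>\<^sup>+x. (if lam < \<bar>v (shift N z 1 x) - v x\<bar> / nrm N z powr (1 + b)
     then ennreal (nrm N z powr (\<gamma> - N)) else 0) \<partial>BN N) \<partial>BN N)"
proof -
  have "level_energy N \<gamma> b lam v = (\<integral>\<^sup>+x. (\<integral>\<^sup>+z. (if lam < \<bar>v (shift N z 1 x) - v x\<bar> / nrm N z powr (1 + b)
     then ennreal (nrm N z powr (\<gamma> - N)) else 0) \<partial>BN N) \<partial>BN N)"
    unfolding level_energy_def
  proof (rule nn_integral_cong)
    fix x assume [measurable]: "x \<in> space (BN N)"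
    have "(\<integral>\<^sup>+y. (if lam < \<bar>v x - v y\<bar> / rdist N x y powr (1 + b) then ennreal (rdist N x y powr (\<gamma> - N)) else 0) \<partial>BN N)
      = (\<integral>\<^sup>+z. (if lam < \<bar>v x - v (shift N x 1 z)\<bar> / rdist N x (shift N x 1 z) powr (1 + b)
          then ennreal (rdist N x (shift N x 1 z) powr (\<gamma> - N)) else 0) \<partial>BN N)"
      by (rule nn_integral_shift[symmetric]) measurable
    then show "(\<integral>\<^sup>+y. (if lam < \<bar>v x - v y\<bar> / rdist N x y powr (1 + b) then ennreal (rdist N x y powr (\<gamma> - N)) else 0) \<partial>BN N)
      = (\<integral>\<^sup>+z. (if lam < \<bar>v (shift N z 1 x) - v x\<bar> / nrm N z powr (1 + b) then ennreal (nrm N z powr (\<gamma> - N)) else 0) \<partial>BN N)"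
      by (simp add: shift_commute[of N x] rdist_shift abs_minus_commute cong: if_cong)
  qed
  also have "\<dots> = (\<integral>\<^sup>+z. (\<integral>\<^sup>+x. (if lam < \<bar>v (shift N z 1 x) - v x\<bar> / nrm N z powr (1 + b)
     then ennreal (nrm N z powr (\<gamma> - N)) else 0) \<partial>BN N) \<partial>BN N)"
    by (rule Fubini_BN_BN) measurable
  finally show ?thesis .
qed

text \<open>Put \<delta> = |v (x + z) - v x|. The p-th power of lam * |z| powr (1 + \<gamma> / p) <
  \<delta> reads |z|^p * lam^p * |z|^\<gamma> < \<delta>^p, and |z|^p cancels against the assumed
  bound for \<delta>^p. What remains is the condition of \<open>level_set_estimate\<close> with a =
  lam^p.\<close>

lemma level_energy_bound:
  assumes [measurable]: "v \<in> borel_measurable (BN N)" "w \<in> borel_measurable (BN N)"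
    and N: "N \<ge> 1" and lb: "line_bound \<gamma> c" and p: "p \<ge> 1" and lam: "lam > 0"
    and incr: "\<And>z. z \<in> space (BN N) \<Longrightarrow> AE x in BN N. ennreal (\<bar>v (shift N z 1 x) - v x\<bar> powr p)
      \<le> ennreal (nrm N z powr p) * (\<integral>\<^sup>+r\<in>{0..1}. w (shift N z r x) \<partial>lborel)"
  shows "ennreal (lam powr p) * level_energy N \<gamma> (\<gamma> / p) lam v
    \<le> ennreal (4 * exp 1 * sphere_area N) * c * (\<integral>\<^sup>+x. w x \<partial>BN N)"
proof -
  have "level_energy N \<gamma> (\<gamma> / p) lam v
    \<le> (\<integral>\<^sup>+z. (\<integral>\<^sup>+x. (if ennreal (lam powr p * nrm N z powr \<gamma>) < (\<integral>\<^sup>+r\<in>{0..1}. w (shift N z r x) \<partial>lborel)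
      then ennreal (nrm N z powr (\<gamma> - N)) else 0) \<partial>BN N) \<partial>BN N)"
    unfolding level_energy_shift[OF assms(1)]
  proof (rule nn_integral_mono)
    fix z assume z: "z \<in> space (BN N)"
    show "(\<integral>\<^sup>+x. (if lam < \<bar>v (shift N z 1 x) - v x\<bar> / nrm N z powr (1 + \<gamma> / p) then ennreal (nrm N z powr (\<gamma> - N)) else 0) \<partial>BN N)
      \<le> (\<integral>\<^sup>+x. (if ennreal (lam powr p * nrm N z powr \<gamma>) < (\<integral>\<^sup>+r\<in>{0..1}. w (shift N z r x) \<partial>lborel)
          then ennreal (nrm N z powr (\<gamma> - N)) else 0) \<partial>BN N)"
    proof (rule nn_integral_mono_AE, use incr[OF z] in eventually_elim)
      fix x
      assume le: "ennreal (\<bar>v (shift N z 1 x) - v x\<bar> powr p) \<le> ennreal (nrm N z powr p) * (\<integral>\<^sup>+r\<in>{0..1}. w (shift N z r x) \<partial>lborel)"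
      define J where "J = (\<integral>\<^sup>+r\<in>{0..1}. w (shift N z r x) \<partial>lborel)"
      define n where "n = nrm N z"
      define \<delta> where "\<delta> = \<bar>v (shift N z 1 x) - v x\<bar>"
      have "ennreal (lam powr p * n powr \<gamma>) < J" if less: "lam < \<delta> / n powr (1 + \<gamma> / p)"
      proof -
        \<comment> \<open>For |z| = 0 the quotient is 0 by the convention for division, which is not
          above lam.\<close>
        have n: "n > 0" using less lam nrm_nonneg[of N z] by (cases "n = 0") (auto simp: n_def)
        have "lam * n powr (1 + \<gamma> / p) < \<delta>" using less n by (simp add: field_simps)
        then have "(lam * n powr (1 + \<gamma> / p)) powr p < \<delta> powr p"
          using lam p n by (intro powr_less_mono2) auto
        moreover have "(lam * n powr (1 + \<gamma> / p)) powr p = n powr p * (lam powr p * n powr \<gamma>)"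
          using lam n p by (simp add: powr_mult powr_powr distrib_right powr_add)
        moreover have "0 \<le> n powr p * (lam powr p * n powr \<gamma>)" by simp
        ultimately have "ennreal (n powr p * (lam powr p * n powr \<gamma>)) < ennreal (\<delta> powr p)"
          by (intro ennreal_lessI) linarith+
        also have "\<dots> \<le> ennreal (n powr p) * J" using le by (simp add: \<delta>_def n_def J_def)
        finally have "ennreal (n powr p) * ennreal (lam powr p * n powr \<gamma>) < ennreal (n powr p) * J"
          by (simp add: ennreal_mult)
        then show ?thesis
          using n ennreal_mult_le_mult_iff[of "ennreal (n powr p)" J "ennreal (lam powr p * n powr \<gamma>)"] by (auto simp: not_le[symmetric])
      qed
      then show "(if lam < \<bar>v (shift N z 1 x) - v x\<bar> / nrm N z powr (1 + \<gamma> / p) then ennreal (nrm N z powr (\<gamma> - N)) else 0)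
        \<le> (if ennreal (lam powr p * nrm N z powr \<gamma>) < (\<integral>\<^sup>+r\<in>{0..1}. w (shift N z r x) \<partial>lborel)
          then ennreal (nrm N z powr (\<gamma> - N)) else 0)"
        by (auto simp: \<delta>_def n_def J_def)
    qed
  qed
  also have "\<dots> \<le> ennreal (4 * exp 1 * sphere_area N / lam powr p) * c * (\<integral>\<^sup>+x. w x \<partial>BN N)"
    using lam by (intro level_set_estimate N lb) auto
  finally have "ennreal (lam powr p) * level_energy N \<gamma> (\<gamma> / p) lam v
    \<le> ennreal (lam powr p) * (ennreal (4 * exp 1 * sphere_area N / lam powr p) * c * (\<integral>\<^sup>+x. w x \<partial>BN N))"
    by (rule mult_left_mono) simp
  also have "\<dots> = (ennreal (lam powr p) * ennreal (4 * exp 1 * sphere_area N / lam powr p)) * c * (\<integral>\<^sup>+x. w x \<partial>BN N)"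
    by (simp only: mult.assoc)
  also have "ennreal (lam powr p) * ennreal (4 * exp 1 * sphere_area N / lam powr p) = ennreal (4 * exp 1 * sphere_area N)"
    using lam by (subst ennreal_mult'[symmetric]) auto
  finally show ?thesis .
qed

text \<open>Cauchy-Schwarz under the integral sign. The number a i r is later the i-th component of
  the gradient, or of its average over a box, at the point x + r z.\<close>

lemma line_average_bound:
  assumes a: "\<And>i. i < N \<Longrightarrow> integrable unit01 (a i)"
  shows "ennreal \<bar>\<Sum>i<N. z i * (\<integral>r. a i r \<partial>unit01)\<bar> \<le> ennreal (nrm N z) * (\<integral>\<^sup>+r. ennreal (sqrt (\<Sum>i<N. (a i r)\<^sup>2)) \<partial>unit01)"
proof -
  have [measurable]: "i < N \<Longrightarrow> a i \<in> borel_measurable unit01" for i using a by auto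
  have m: "(\<lambda>r. \<Sum>i<N. (a i r)\<^sup>2) \<in> borel_measurable unit01"
    by (intro borel_measurable_sum borel_measurable_power) auto
  have "(\<Sum>i<N. z i * (\<integral>r. a i r \<partial>unit01)) = (\<integral>r. (\<Sum>i<N. z i * a i r) \<partial>unit01)"
    using a by (subst Bochner_Integration.integral_sum) auto
  then have "ennreal \<bar>\<Sum>i<N. z i * (\<integral>r. a i r \<partial>unit01)\<bar> \<le> (\<integral>\<^sup>+r. ennreal (norm (\<Sum>i<N. z i * a i r)) \<partial>unit01)"
  proof -
    have "integrable unit01 (\<lambda>r. \<Sum>i<N. z i * a i r)"
      using a by (intro Bochner_Integration.integrable_sum integrable_mult_right) auto
    from integral_norm_bound_ennreal[OF this] show ?thesis
      by (simp only: \<open>(\<Sum>i<N. z i * (\<integral>r. a i r \<partial>unit01)) = (\<integral>r. (\<Sum>i<N. z i * a i r) \<partial>unit01)\<close> real_norm_def)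
  qed
  also have "\<dots> \<le> (\<integral>\<^sup>+r. ennreal (nrm N z) * ennreal (sqrt (\<Sum>i<N. (a i r)\<^sup>2)) \<partial>unit01)"
  proof (rule nn_integral_mono)
    fix r
    have "\<bar>\<Sum>i<N. z i * a i r\<bar> \<le> (\<Sum>i<N. \<bar>z i\<bar> * \<bar>a i r\<bar>)"
      by (rule order_trans[OF sum_abs]) (simp add: abs_mult)
    also have "\<dots> \<le> nrm N z * sqrt (\<Sum>i<N. (a i r)\<^sup>2)"
      using L2_set_mult_ineq[of z "\<lambda>i. a i r" "{..<N}"] by (simp add: L2_set_def nrm_def)
    finally show "ennreal (norm (\<Sum>i<N. z i * a i r)) \<le> ennreal (nrm N z) * ennreal (sqrt (\<Sum>i<N. (a i r)\<^sup>2))"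
      using nrm_nonneg by (simp add: ennreal_mult[symmetric] sum_nonneg ennreal_leI)
  qed
  also have "\<dots> = ennreal (nrm N z) * (\<integral>\<^sup>+r. ennreal (sqrt (\<Sum>i<N. (a i r)\<^sup>2)) \<partial>unit01)"
    using m by (intro nn_integral_cmult) measurable
  finally show ?thesis .
qed

text \<open>The tangent of t powr p at d, from Young's inequality with the conjugate exponents p and
  p / (p - 1). Both sides are sums of nonnegative terms, so that the inequality can be integrated in
  \<open>ennreal\<close>.\<close>

lemma powr_tangent:
  fixes t d p :: real
  assumes "t \<ge> 0" "d > 0" "p \<ge> 1"
  shows "p * d powr (p - 1) * t \<le> t powr p + (p - 1) * d powr p"
proof (cases "p = 1")
  case False
  define q where "q = p / (p - 1)"
  have p: "p > 1" using False assms by simp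
  have "t * d powr (p - 1) \<le> t powr p / p + (d powr (p - 1)) powr q / q"
    using assms p by (intro Youngs_inequality) (auto simp: q_def field_simps)
  also have "(d powr (p - 1)) powr q = d powr p" using p by (simp add: powr_powr q_def)
  finally have "p * (t * d powr (p - 1)) \<le> p * (t powr p / p + d powr p / q)"
    using p by (intro mult_left_mono) auto
  also have "\<dots> = t powr p + (p - 1) * d powr p" using p by (simp add: q_def field_simps)
  finally show ?thesis by (simp add: mult_ac)
qed (use assms in auto)

text \<open>The tangent inequality at d is integrated, and the finite term (p - 1) * d powr p is
  cancelled. The mean of h may be infinite, and d is merely below it, as
  \<open>line_average_bound\<close> gives only an upper bound for the increment.\<close>

lemma Jensen_powr_unit01:
  assumes h: "h \<in> borel_measurable borel" "\<And>r. h r \<ge> 0" and p: "p \<ge> (1::real)" and d: "d \<ge> 0"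
    and le: "ennreal d \<le> (\<integral>\<^sup>+r. ennreal (h r) \<partial>unit01)"
  shows "ennreal (d powr p) \<le> (\<integral>\<^sup>+r. ennreal (h r powr p) \<partial>unit01)"
proof (cases "d = 0")
  case False
  with d have d: "d > 0" by simp
  have [measurable]: "h \<in> borel_measurable unit01" using h by (simp add: measurable_cong_sets[OF sets_unit01 refl])
  have "ennreal ((p - 1) * d powr p) + ennreal (d powr p) = ennreal (p * d powr (p - 1)) * ennreal d"
  proof -
    have "(p - 1) * d powr p + d powr p = p * d powr (p - 1) * d" using d by (simp add: powr_diff algebra_simps)
    then show ?thesis using p d by (simp add: ennreal_plus[symmetric] ennreal_mult[symmetric] del: ennreal_plus)
  qed
  also have "\<dots> \<le> ennreal (p * d powr (p - 1)) * (\<integral>\<^sup>+r. ennreal (h r) \<partial>unit01)"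
    by (intro mult_left_mono le) simp
  also have "\<dots> = (\<integral>\<^sup>+r. ennreal (p * d powr (p - 1) * h r) \<partial>unit01)"
    using p h(2) by (simp add: nn_integral_cmult[symmetric] ennreal_mult)
  also have "\<dots> \<le> (\<integral>\<^sup>+r. ennreal ((p - 1) * d powr p) + ennreal (h r powr p) \<partial>unit01)"
    using powr_tangent[OF h(2) d p] p
    by (intro nn_integral_mono) (simp add: ennreal_plus[symmetric] add.commute ennreal_leI del: ennreal_plus)
  also have "\<dots> = ennreal ((p - 1) * d powr p) + (\<integral>\<^sup>+r. ennreal (h r powr p) \<partial>unit01)"
    by (subst nn_integral_add) (auto simp: nn_integral_unit01_const)
  finally show ?thesis by (simp add: ennreal_add_left_cancel_le)
qed simp

subsection \<open>Sobolev functions\<close>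

text \<open>By Tonelli and translation invariance the averaged measure has the line integral of h as
  its density; this is how line integrals come back for Sobolev functions.\<close>

lemma smear_density_measure:
  assumes [measurable]: "h \<in> borel_measurable (BN N)" "A \<in> sets (BN N)" and z [measurable]: "z \<in> space (BN N)"
    and lf: "locfin N (density (BN N) h)"
  shows "emeasure (smear N z (density (BN N) h)) A = (\<integral>\<^sup>+x. (\<integral>\<^sup>+r\<in>{0..1}. h (shift N z r x) \<partial>lborel) * indicator A x \<partial>BN N)"
proof -
  have "emeasure (smear N z (density (BN N) h)) A = (\<integral>\<^sup>+x. indicator A x \<partial>smear N z (density (BN N) h))"
    by simp
  also have "\<dots> = (\<integral>\<^sup>+r\<in>{0..1}. (\<integral>\<^sup>+y. indicator A (shift N z (- r) y) \<partial>density (BN N) h) \<partial>lborel)"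
    by (rule nn_integral_smear[OF lf z]) measurable
  also have "\<dots> = (\<integral>\<^sup>+r. (\<integral>\<^sup>+x. h (shift N z r x) * indicator A x * indicator {0..1} r \<partial>BN N) \<partial>lborel)"
  proof (rule nn_integral_cong)
    fix r :: real
    have "(\<integral>\<^sup>+y. indicator A (shift N z (- r) y) \<partial>density (BN N) h) = (\<integral>\<^sup>+y. h y * indicator A (shift N z (- r) y) \<partial>BN N)"
      by (intro nn_integral_density) measurable
    also have "\<dots> = (\<integral>\<^sup>+x. h (shift N z r x) * indicator A (shift N z (- r) (shift N z r x)) \<partial>BN N)"
      by (rule nn_integral_shift[symmetric]) measurable
    also have "\<dots> = (\<integral>\<^sup>+x. h (shift N z r x) * indicator A x \<partial>BN N)"
      by (rule nn_integral_cong) (simp add: shift_shift shift_0 space_BN)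
    finally show "(\<integral>\<^sup>+y. indicator A (shift N z (- r) y) \<partial>density (BN N) h) * indicator {0..1} r
      = (\<integral>\<^sup>+x. h (shift N z r x) * indicator A x * indicator {0..1} r \<partial>BN N)"
      by (simp add: nn_integral_multc)
  qed
  also have "\<dots> = (\<integral>\<^sup>+x. (\<integral>\<^sup>+r. h (shift N z r x) * indicator A x * indicator {0..1} r \<partial>lborel) \<partial>BN N)"
    by (rule Fubini_lborel_BN) measurable
  also have "\<dots> = (\<integral>\<^sup>+x. (\<integral>\<^sup>+r\<in>{0..1}. h (shift N z r x) \<partial>lborel) * indicator A x \<partial>BN N)"
    by (rule nn_integral_cong) (subst nn_integral_multc[symmetric], measurable, simp add: mult_ac)
  finally show ?thesis .
qed

lemma emeasure_cube_finite: "emeasure (BN N) (cube N K) < \<infinity>"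
proof -
  have "emeasure (BN N) (cube N K) = (\<Prod>i<N. emeasure lborel {-K..K})"
    unfolding cube_def by (rule emeasure_BN_box) simp
  also have "\<dots> < \<infinity>" by (simp add: less_top[symmetric] emeasure_lborel_Icc_eq power_eq_top_ennreal)
  finally show ?thesis .
qed

text \<open>Since \<open>ennreal\<close> maps negative reals to 0, the two densities are the
  positive and the negative part of g i.\<close>

locale density_gradient =
  fixes N :: nat and u :: "(nat \<Rightarrow> real) \<Rightarrow> real" and g :: "nat \<Rightarrow> (nat \<Rightarrow> real) \<Rightarrow> real"
  assumes g_meas: "i < N \<Longrightarrow> g i \<in> borel_measurable (BN N)"
    and grad: "measure_gradient N u (\<lambda>i. density (BN N) (\<lambda>x. ennreal (g i x))) (\<lambda>i. density (BN N) (\<lambda>x. ennreal (- g i x)))"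
begin

sublocale measure_gradient N u "\<lambda>i. density (BN N) (\<lambda>x. ennreal (g i x))" "\<lambda>i. density (BN N) (\<lambda>x. ennreal (- g i x))"
  by (rule grad)

text \<open>By \<open>set_identity\<close> and \<open>smear_density_measure\<close> both sides have
  the same integral over each measurable subset of a cube. So they agree almost everywhere on the
  cube, and countably many cubes exhaust the space. \<open>G 1 i\<close> and
  \<open>G (- 1) i\<close> are the line integrals of the two parts of g i.\<close>

lemma increment_eq_line_integral:
  assumes z [measurable]: "z \<in> space (BN N)"
  defines "G \<equiv> \<lambda>s i x. \<integral>\<^sup>+r\<in>{0..1}. ennreal (s * g i (shift N z r x)) \<partial>lborel"
  shows "AE x in BN N. u (shift N z 1 x) - u x = (\<Sum>i<N. z i * (enn2real (G 1 i x) - enn2real (G (- 1) i x)))"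
proof -
  have [measurable]: "i < N \<Longrightarrow> G s i \<in> borel_measurable (BN N)" for s i
    using g_meas[of i] unfolding G_def by measurable
  define D where "D = (\<lambda>x. u (shift N z 1 x) - u x)"
  define H where "H = (\<lambda>x. \<Sum>i<N. z i * (enn2real (G 1 i x) - enn2real (G (- 1) i x)))"
  have [measurable]: "D \<in> borel_measurable (BN N)" unfolding D_def by measurable
  have smG: "emeasure (smear N z (density (BN N) (\<lambda>x. ennreal (s * g i x)))) A = (\<integral>\<^sup>+x. G s i x * indicator A x \<partial>BN N)"
    if "A \<in> sets (BN N)" "i < N" "s = 1 \<or> s = - 1" for A i s
    using that P[of i] Q[of i] g_meas[of i] z unfolding G_def
    by (intro smear_density_measure[of "\<lambda>x. ennreal (s * g i x)"]) auto
  have on_cube: "AE x in BN N. x \<in> cube N K \<longrightarrow> D x = H x" for K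
  proof -
    \<comment> \<open>Local finiteness makes \<open>G s i\<close> finite almost everywhere on the
      cube, so that the default value of \<open>enn2real\<close> at infinity does not affect the
      integrals.\<close>
    have Gint: "integrable (BN N) (\<lambda>x. enn2real (G s i x) * indicator A x) \<and>
        (\<integral>x. enn2real (G s i x) * indicator A x \<partial>BN N) = measure (smear N z (density (BN N) (\<lambda>x. ennreal (s * g i x)))) A \<and>
        (\<integral>\<^sup>+x. G s i x * indicator A x \<partial>BN N) < \<infinity>"
      if A [measurable]: "A \<in> sets (BN N)" "A \<subseteq> cube N K" and i: "i < N" and s: "s = 1 \<or> s = - 1" for A i s
    proof -
      note [measurable] = i
      have lf: "locfin N (density (BN N) (\<lambda>x. ennreal (s * g i x)))" using P[OF i] Q[OF i] s by auto
      have "emeasure (smear N z (density (BN N) (\<lambda>x. ennreal (s * g i x)))) A \<le> emeasure (smear N z (density (BN N) (\<lambda>x. ennreal (s * g i x)))) (cube N K)"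
        using A by (intro emeasure_mono) (auto simp: cube_sets)
      also have "\<dots> < \<infinity>" by (rule emeasure_smear_cube[OF lf z])
      finally have fin: "(\<integral>\<^sup>+x. G s i x * indicator A x \<partial>BN N) < \<infinity>" using smG[OF A(1) i s] by simp
      have mG: "(\<lambda>x. G s i x * indicator A x) \<in> borel_measurable (BN N)" by measurable
      have "AE x in BN N. G s i x * indicator A x \<noteq> \<infinity>"
        using nn_integral_PInf_AE[OF mG] fin by auto
      then have ae: "AE x in BN N. ennreal (enn2real (G s i x) * indicator A x) = G s i x * indicator A x"
        by eventually_elim (auto simp: indicator_def less_top)
      then have eq: "(\<integral>\<^sup>+x. ennreal (enn2real (G s i x) * indicator A x) \<partial>BN N) = (\<integral>\<^sup>+x. G s i x * indicator A x \<partial>BN N)"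
        by (rule nn_integral_cong_AE)
      have "integrable (BN N) (\<lambda>x. enn2real (G s i x) * indicator A x)"
        using eq fin by (intro integrableI_nonneg) auto
      moreover have "(\<integral>x. enn2real (G s i x) * indicator A x \<partial>BN N) = measure (smear N z (density (BN N) (\<lambda>x. ennreal (s * g i x)))) A"
        using eq smG[OF A(1) i s] by (subst integral_eq_nn_integral) (auto simp: measure_def)
      ultimately show ?thesis using fin by blast
    qed
    have Hint: "integrable (BN N) (\<lambda>x. H x * indicator A x) \<and> (\<integral>x. H x * indicator A x \<partial>BN N) = (\<integral>x. D x * indicator A x \<partial>BN N)"
      if A [measurable]: "A \<in> sets (BN N)" and AK: "A \<subseteq> cube N K" for A
    proof -
      have Heq: "(\<lambda>x. H x * indicator A x) = (\<lambda>x. \<Sum>i<N. z i * (enn2real (G 1 i x) * indicator A x - enn2real (G (- 1) i x) * indicator A x))"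
        by (auto simp: H_def sum_distrib_right left_diff_distrib mult.assoc)
      have "integrable (BN N) (\<lambda>x. H x * indicator A x)"
        unfolding Heq using Gint[OF A AK] by (intro Bochner_Integration.integrable_sum integrable_mult_right Bochner_Integration.integrable_diff) auto
      moreover have "(\<integral>x. H x * indicator A x \<partial>BN N)
        = (\<Sum>i<N. z i * (measure (smear N z (density (BN N) (\<lambda>x. ennreal (g i x)))) A - measure (smear N z (density (BN N) (\<lambda>x. ennreal (- g i x)))) A))"
      proof -
        have "(\<integral>x. H x * indicator A x \<partial>BN N)
          = (\<Sum>i<N. (\<integral>x. z i * (enn2real (G 1 i x) * indicator A x - enn2real (G (- 1) i x) * indicator A x) \<partial>BN N))"
          unfolding Heq using Gint[OF A AK]
          by (intro Bochner_Integration.integral_sum integrable_mult_right Bochner_Integration.integrable_diff) auto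
        also have "\<dots> = (\<Sum>i<N. z i * (measure (smear N z (density (BN N) (\<lambda>x. ennreal (g i x)))) A - measure (smear N z (density (BN N) (\<lambda>x. ennreal (- g i x)))) A))"
        proof (rule sum.cong[OF refl])
          fix i assume "i \<in> {..<N}"
          then show "(\<integral>x. z i * (enn2real (G 1 i x) * indicator A x - enn2real (G (- 1) i x) * indicator A x) \<partial>BN N)
            = z i * (measure (smear N z (density (BN N) (\<lambda>x. ennreal (g i x)))) A - measure (smear N z (density (BN N) (\<lambda>x. ennreal (- g i x)))) A)"
            using Gint[OF A AK, of i 1] Gint[OF A AK, of i "- 1"] by simp
        qed
        finally show ?thesis .
      qed
      ultimately show ?thesis using set_identity[OF z A AK] by (simp add: D_def)
    qed
    have "AE x in BN N. D x * indicator (cube N K) x - H x * indicator (cube N K) x = 0"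
    proof (rule BN.density_zero)
      show "integrable (BN N) (\<lambda>x. D x * indicator (cube N K) x - H x * indicator (cube N K) x)"
        using Hint[of "cube N K"] integrable_increment[OF z, of K] by (intro Bochner_Integration.integrable_diff) (auto simp: D_def cube_sets)
      fix A assume A [measurable]: "A \<in> sets (BN N)"
      have AK: "A \<inter> cube N K \<in> sets (BN N)" "A \<inter> cube N K \<subseteq> cube N K" by auto
      have iD: "integrable (BN N) (\<lambda>x. D x * indicator (A \<inter> cube N K) x)"
      proof (rule Bochner_Integration.integrable_bound)
        show "integrable (BN N) (\<lambda>x. D x * indicator (cube N K) x)" unfolding D_def by (rule integrable_increment[OF z])
      qed (auto simp: indicator_def)
      have "set_lebesgue_integral (BN N) A (\<lambda>x. D x * indicator (cube N K) x - H x * indicator (cube N K) x)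
        = (\<integral>x. D x * indicator (A \<inter> cube N K) x - H x * indicator (A \<inter> cube N K) x \<partial>BN N)"
        unfolding set_lebesgue_integral_def by (intro Bochner_Integration.integral_cong) (auto simp: indicator_def)
      also have "\<dots> = 0" using Hint[OF AK] iD by simp
      finally show "set_lebesgue_integral (BN N) A (\<lambda>x. D x * indicator (cube N K) x - H x * indicator (cube N K) x) = 0" .
    qed
    then show ?thesis by eventually_elim auto
  qed
  have "AE x in BN N. \<forall>n::nat. x \<in> cube N (real n) \<longrightarrow> D x = H x"
    unfolding AE_all_countable using on_cube by blast
  then have "AE x in BN N. D x = H x"
    using AE_space by eventually_elim (use ex_cube in \<open>auto simp: space_BN\<close>)
  then show ?thesis by (simp add: D_def H_def)
qed

lemma increment_powr_bound:
  assumes z [measurable]: "z \<in> space (BN N)" and p: "p \<ge> 1"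
  shows "AE x in BN N. ennreal (\<bar>u (shift N z 1 x) - u x\<bar> powr p)
    \<le> ennreal (nrm N z powr p) * (\<integral>\<^sup>+r\<in>{0..1}. ennreal (sqrt (\<Sum>i<N. (g i (shift N z r x))\<^sup>2) powr p) \<partial>lborel)"
  using increment_eq_line_integral[OF z] AE_space
proof eventually_elim
  fix x
  assume eq: "u (shift N z 1 x) - u x = (\<Sum>i<N. z i * (enn2real (\<integral>\<^sup>+r\<in>{0..1}. ennreal (1 * g i (shift N z r x)) \<partial>lborel)
      - enn2real (\<integral>\<^sup>+r\<in>{0..1}. ennreal (- 1 * g i (shift N z r x)) \<partial>lborel)))"
    and x [measurable]: "x \<in> space (BN N)"
  define a where "a = (\<lambda>i r. g i (shift N z r x))"
  define h where "h = (\<lambda>r. sqrt (\<Sum>i<N. (a i r)\<^sup>2))"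
  have am: "a i \<in> borel_measurable borel" if "i < N" for i
    using g_meas[OF that] unfolding a_def by measurable
  have am': "a i \<in> borel_measurable unit01" if "i < N" for i
    using am[OF that] by (simp add: measurable_cong_sets[OF sets_unit01 refl])
  have "(\<lambda>r. \<Sum>i<N. (a i r)\<^sup>2) \<in> borel_measurable borel"
    by (intro borel_measurable_sum borel_measurable_power) (auto intro: am)
  then have hm: "h \<in> borel_measurable borel" unfolding h_def by measurable
  have h0: "h r \<ge> 0" for r by (simp add: h_def sum_nonneg)
  show "ennreal (\<bar>u (shift N z 1 x) - u x\<bar> powr p)
    \<le> ennreal (nrm N z powr p) * (\<integral>\<^sup>+r\<in>{0..1}. ennreal (sqrt (\<Sum>i<N. (g i (shift N z r x))\<^sup>2) powr p) \<partial>lborel)"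
  proof (cases "nrm N z = 0")
    case True
    have "z i = 0" if "i < N" for i
      using True that by (simp add: nrm_def sum_nonneg_eq_0_iff)
    then show ?thesis using eq by simp
  next
    case nz: False
    then have nz: "nrm N z > 0" using nrm_nonneg[of N z] by simp
    define \<delta> where "\<delta> = \<bar>u (shift N z 1 x) - u x\<bar>"
    \<comment> \<open>If h has infinite integral over the segment, the formula for the increment may
      contain default values of \<open>enn2real\<close>, but the right side is infinite. Otherwise
      each a i is integrable and the formula is a true line integral.\<close>
    have le: "ennreal \<delta> \<le> ennreal (nrm N z) * (\<integral>\<^sup>+r. ennreal (h r) \<partial>unit01)"
    proof (cases "(\<integral>\<^sup>+r. ennreal (h r) \<partial>unit01) = \<infinity>")
      case True
      then show ?thesis using nz by (simp add: ennreal_mult_top)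
    next
      case False
      have int: "integrable unit01 (a i)" if i: "i < N" for i
      proof (rule integrableI_bounded)
        have "(\<integral>\<^sup>+r. ennreal (norm (a i r)) \<partial>unit01) \<le> (\<integral>\<^sup>+r. ennreal (h r) \<partial>unit01)"
        proof (intro nn_integral_mono ennreal_leI)
          fix r
          have "(a i r)\<^sup>2 \<le> (\<Sum>i<N. (a i r)\<^sup>2)" using i by (intro member_le_sum) auto
          then show "norm (a i r) \<le> h r" unfolding h_def by (simp add: real_le_rsqrt)
        qed
        then show "(\<integral>\<^sup>+r. ennreal (norm (a i r)) \<partial>unit01) < \<infinity>" using False by (simp add: less_top[symmetric] top_unique) (metis neq_top_trans)
      qed (rule am'[OF i])
      have "(\<integral>r. a i r \<partial>unit01) = enn2real (\<integral>\<^sup>+r\<in>{0..1}. ennreal (1 * g i (shift N z r x)) \<partial>lborel)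
        - enn2real (\<integral>\<^sup>+r\<in>{0..1}. ennreal (- 1 * g i (shift N z r x)) \<partial>lborel)" if i: "i < N" for i
        using real_lebesgue_integral_def[OF int[OF i]] am[OF i]
        by (simp add: nn_integral_unit01) (simp add: a_def)
      then have "\<delta> = \<bar>\<Sum>i<N. z i * (\<integral>r. a i r \<partial>unit01)\<bar>" unfolding \<delta>_def eq by simp
      then show ?thesis using line_average_bound[of N a z] int by (simp add: h_def)
    qed
    have "ennreal (\<delta> / nrm N z) \<le> (\<integral>\<^sup>+r. ennreal (h r) \<partial>unit01)"
    proof -
      have "ennreal (nrm N z) * ennreal (\<delta> / nrm N z) = ennreal \<delta>"
        using nz by (simp add: ennreal_mult'[symmetric])
      then have "ennreal (nrm N z) * ennreal (\<delta> / nrm N z) \<le> ennreal (nrm N z) * (\<integral>\<^sup>+r. ennreal (h r) \<partial>unit01)"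
        using le by simp
      then show ?thesis using nz by (subst (asm) ennreal_mult_le_mult_iff) auto
    qed
    then have J: "ennreal ((\<delta> / nrm N z) powr p) \<le> (\<integral>\<^sup>+r. ennreal (h r powr p) \<partial>unit01)"
      using nz by (intro Jensen_powr_unit01[OF hm h0 p]) (auto simp: \<delta>_def)
    have "ennreal (\<delta> powr p) = ennreal (nrm N z powr p) * ennreal ((\<delta> / nrm N z) powr p)"
      using nz by (simp add: ennreal_mult'[symmetric] powr_divide \<delta>_def)
    also have "\<dots> \<le> ennreal (nrm N z powr p) * (\<integral>\<^sup>+r. ennreal (h r powr p) \<partial>unit01)"
      by (intro mult_left_mono J) simp
    also have "(\<integral>\<^sup>+r. ennreal (h r powr p) \<partial>unit01) = (\<integral>\<^sup>+r\<in>{0..1}. ennreal (sqrt (\<Sum>i<N. (g i (shift N z r x))\<^sup>2) powr p) \<partial>lborel)"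
      using hm by (subst nn_integral_unit01) (auto simp: h_def a_def)
    finally show ?thesis by (simp add: \<delta>_def)
  qed
qed

end

lemma cube_subset_ball: "cube N K \<subseteq> {x \<in> sp N. rdist N x (\<lambda>_. 0) \<le> sqrt (real N * \<bar>K\<bar>\<^sup>2)}"
proof
  fix x assume x: "x \<in> cube N K"
  have "(x i)\<^sup>2 \<le> \<bar>K\<bar>\<^sup>2" if "i < N" for i
  proof -
    have "\<bar>x i\<bar> \<le> \<bar>K\<bar>" using x that by (auto simp: mem_cube)
    then show ?thesis by (simp add: abs_le_square_iff)
  qed
  then have "(\<Sum>i<N. (x i)\<^sup>2) \<le> real N * \<bar>K\<bar>\<^sup>2"
    using sum_bounded_above[of "{..<N}" "\<lambda>i. (x i)\<^sup>2" "\<bar>K\<bar>\<^sup>2"] by simp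
  then show "x \<in> {x \<in> sp N. rdist N x (\<lambda>_. 0) \<le> sqrt (real N * \<bar>K\<bar>\<^sup>2)}"
    using x by (simp add: mem_cube rdist_def)
qed

text \<open>The statement is about the completed measure, whereas Fubini and translations are used
  for the Borel product measure. Passing to a Borel representative changes u on a null set only and
  keeps all test integrals.\<close>

lemma locint_representative:
  assumes u: "locint N u"
  obtains u' where "u' \<in> borel_measurable (BN N)" "AE x in BN N. u x = u' x" "\<And>K. set_integrable (BN N) (cube N K) u'"
    "\<And>f. f \<in> borel_measurable (BN N) \<Longrightarrow> (\<integral>x. u x * f x \<partial>LN N) = (\<integral>x. u' x * f x \<partial>BN N)"
proof -
  have um: "u \<in> borel_measurable (completion (BN N))" using u by (simp add: locint_def LN_def)
  then obtain u' where u' [measurable]: "u' \<in> borel_measurable (BN N)" and ae: "AE x in BN N. u x = u' x"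
    using completion_ex_borel_measurable_real by blast
  have "set_integrable (BN N) (cube N K) u'" for K
  proof -
    have "set_integrable (completion (BN N)) {x \<in> sp N. rdist N x (\<lambda>_. 0) \<le> sqrt (real N * \<bar>K\<bar>\<^sup>2)} u"
      using u unfolding locint_def LN_def by blast
    then have "set_integrable (completion (BN N)) (cube N K) u"
      by (rule set_integrable_subset) (use cube_subset_ball in \<open>auto intro: cube_sets\<close>)
    then have "integrable (completion (BN N)) (\<lambda>x. indicator (cube N K) x *\<^sub>R u' x)"
      unfolding set_integrable_def
    proof (subst (asm) integrable_cong_AE)
      show "AE x in completion (BN N). indicator (cube N K) x *\<^sub>R u x = indicator (cube N K) x *\<^sub>R u' x"
        using AE_completion[OF ae] by eventually_elim simp
      show "(\<lambda>x. indicator (cube N K) x *\<^sub>R u' x) \<in> borel_measurable (completion (BN N))"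
        by (rule measurable_completion) measurable
      have [measurable]: "cube N K \<in> sets (completion (BN N))" using cube_sets[of N K] by auto
      show "(\<lambda>x. indicator (cube N K) x *\<^sub>R u x) \<in> borel_measurable (completion (BN N))"
        using um by measurable
    qed
    then show ?thesis unfolding set_integrable_def by (subst (asm) integrable_completion) measurable
  qed
  moreover have "(\<integral>x. u x * f x \<partial>LN N) = (\<integral>x. u' x * f x \<partial>BN N)" if [measurable]: "f \<in> borel_measurable (BN N)" for f
  proof -
    have "(\<integral>x. u x * f x \<partial>LN N) = (\<integral>x. u' x * f x \<partial>completion (BN N))"
      unfolding LN_def
    proof (rule integral_cong_AE)
      show "AE x in completion (BN N). u x * f x = u' x * f x" using AE_completion[OF ae] by eventually_elim simp
      show "(\<lambda>x. u x * f x) \<in> borel_measurable (completion (BN N))"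
        by (rule borel_measurable_times[OF um measurable_completion[OF that]])
      show "(\<lambda>x. u' x * f x) \<in> borel_measurable (completion (BN N))"
        by (rule measurable_completion) measurable
    qed
    also have "\<dots> = (\<integral>x. u' x * f x \<partial>BN N)" by (rule integral_completion) measurable
    finally show ?thesis .
  qed
  ultimately show ?thesis using that[OF u' ae] by blast
qed

lemma density_pos_part:
  fixes h :: "'a \<Rightarrow> real"
  assumes [measurable]: "h \<in> borel_measurable M" "f \<in> borel_measurable M"
  shows "(\<integral>x. f x \<partial>density M (\<lambda>x. ennreal (h x))) = (\<integral>x. max 0 (h x) * f x \<partial>M)"
proof -
  have "density M (\<lambda>x. ennreal (h x)) = density M (\<lambda>x. ennreal (max 0 (h x)))"
    by (rule arg_cong[where f="density M"]) (auto simp: max_def ennreal_neg)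
  then show ?thesis using integral_density[of f M "\<lambda>x. max 0 (h x)"] by simp
qed

lemma W1p_representative:
  assumes W: "W1p N p u g" and p: "p \<ge> 1"
  obtains u' g' where "AE x in BN N. u x = u' x" "u' \<in> borel_measurable (BN N)" "density_gradient N u' g'"
    "gradnorm N p g = (\<integral>\<^sup>+x. ennreal (sqrt (\<Sum>i<N. (g' i x)\<^sup>2) powr p) \<partial>BN N)"
proof -
  have loc: "locint N u" using W by (simp add: W1p_def)
  obtain u' where u': "u' \<in> borel_measurable (BN N)" "AE x in BN N. u x = u' x" "\<And>K. set_integrable (BN N) (cube N K) u'"
    and uint: "\<And>f. f \<in> borel_measurable (BN N) \<Longrightarrow> (\<integral>x. u x * f x \<partial>LN N) = (\<integral>x. u' x * f x \<partial>BN N)"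
    by (rule locint_representative[OF loc], rule that)
  have gm: "g i \<in> borel_measurable (completion (BN N))" if "i < N" for i
    using W that by (simp add: W1p_def LN_def)
  have "\<forall>i. \<exists>g'. i < N \<longrightarrow> g' \<in> borel_measurable (BN N) \<and> (AE x in BN N. g i x = g' x)"
    using completion_ex_borel_measurable_real[OF gm] by blast
  then obtain g' where g': "\<And>i. i < N \<Longrightarrow> g' i \<in> borel_measurable (BN N)" "\<And>i. i < N \<Longrightarrow> AE x in BN N. g i x = g' i x"
    by metis
  have gp: "(\<integral>\<^sup>+x. ennreal (\<bar>g' i x\<bar> powr p) \<partial>BN N) < \<infinity>" if i: "i < N" for i
  proof -
    have "(\<integral>\<^sup>+x. ennreal (\<bar>g' i x\<bar> powr p) \<partial>BN N) = (\<integral>\<^sup>+x. ennreal (\<bar>g i x\<bar> powr p) \<partial>BN N)"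
      by (rule nn_integral_cong_AE, use g'(2)[OF i] in eventually_elim) simp
    then show ?thesis using W i by (simp add: W1p_def LN_def nn_integral_completion)
  qed
  have lf: "(\<integral>\<^sup>+x. ennreal \<bar>g' i x\<bar> * indicator (cube N K) x \<partial>BN N) < \<infinity>" if i: "i < N" for i K
  proof -
    note [measurable] = g'(1)[OF i]
    have "(\<integral>\<^sup>+x. ennreal \<bar>g' i x\<bar> * indicator (cube N K) x \<partial>BN N) \<le> (\<integral>\<^sup>+x. indicator (cube N K) x + ennreal (\<bar>g' i x\<bar> powr p) \<partial>BN N)"
    proof (rule nn_integral_mono)
      fix x
      \<comment> \<open>This makes a gradient in L^p locally integrable, because cubes have finite
        measure and p \<ge> 1.\<close>
      have "\<bar>g' i x\<bar> \<le> 1 + \<bar>g' i x\<bar> powr p"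
      proof (cases "\<bar>g' i x\<bar> \<le> 1")
        case True
        then show ?thesis by (simp add: add_increasing2)
      next
        case False
        then have "\<bar>g' i x\<bar> powr 1 \<le> \<bar>g' i x\<bar> powr p" using p by (intro powr_mono) auto
        then show ?thesis by simp
      qed
      then have "ennreal \<bar>g' i x\<bar> \<le> 1 + ennreal (\<bar>g' i x\<bar> powr p)"
        by (metis ennreal_1 ennreal_leI ennreal_plus powr_ge_zero zero_le_one)
      then show "ennreal \<bar>g' i x\<bar> * indicator (cube N K) x \<le> indicator (cube N K) x + ennreal (\<bar>g' i x\<bar> powr p)"
        by (auto simp: indicator_def)
    qed
    also have "\<dots> = emeasure (BN N) (cube N K) + (\<integral>\<^sup>+x. ennreal (\<bar>g' i x\<bar> powr p) \<partial>BN N)"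
      by (subst nn_integral_add) (auto simp: cube_sets)
    also have "\<dots> < \<infinity>" using gp[OF i] emeasure_cube_finite[of N K] by simp
    finally show ?thesis .
  qed
  have "density_gradient N u' g'"
  proof
    show "g' i \<in> borel_measurable (BN N)" if "i < N" for i using g' that by simp
    show "u' \<in> borel_measurable (BN N)" by fact
    show "set_integrable (BN N) (cube N K) u'" for K by fact
    have locfin: "locfin N (density (BN N) (\<lambda>x. ennreal (s * g' i x)))" if i: "i < N" and s: "\<bar>s\<bar> = 1" for i s
      unfolding locfin_def
    proof (intro conjI allI)
      note [measurable] = g'(1)[OF i]
      fix K
      have "emeasure (density (BN N) (\<lambda>x. ennreal (s * g' i x))) (cube N K) = (\<integral>\<^sup>+x. ennreal (s * g' i x) * indicator (cube N K) x \<partial>BN N)"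
        by (rule emeasure_density) measurable
      also have "\<dots> \<le> (\<integral>\<^sup>+x. ennreal \<bar>g' i x\<bar> * indicator (cube N K) x \<partial>BN N)"
      proof (intro nn_integral_mono mult_right_mono ennreal_leI)
        fix x
        have "s * g' i x \<le> \<bar>s * g' i x\<bar>" by simp
        also have "\<dots> = \<bar>g' i x\<bar>" using s by (simp add: abs_mult)
        finally show "s * g' i x \<le> \<bar>g' i x\<bar>" .
      qed simp
      also have "\<dots> < \<infinity>" by (rule lf[OF i])
      finally show "emeasure (density (BN N) (\<lambda>x. ennreal (s * g' i x))) (cube N K) < \<infinity>" .
    qed simp
    show "locfin N (density (BN N) (\<lambda>x. ennreal (g' i x)))" if "i < N" for i using locfin[OF that, of 1] by simp
    show "locfin N (density (BN N) (\<lambda>x. ennreal (- g' i x)))" if "i < N" for i using locfin[OF that, of "- 1"] by simp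
    fix R i assume R: "bumpseq N R" and i: "i < N"
    note [measurable] = g'(1)[OF i]
    define \<phi> where "\<phi> = bumpfun N R (\<lambda>_. 0)"
    have bm: "bumpfun N R m \<in> borel_measurable (BN N)" for m
      using bumpfun_measurable[OF R measurable_ident, of m] by simp
    have [measurable]: "\<phi> \<in> borel_measurable (BN N)" using bm by (simp add: \<phi>_def)
    obtain K C where KC: "C \<ge> 0" "\<And>x. x \<in> sp N \<Longrightarrow> \<bar>\<phi> x\<bar> \<le> C * indicator (cube N K) x"
      using bumpfun_bound[OF R, of "\<lambda>_. 0"] unfolding \<phi>_def by blast
    have int_abs: "integrable (BN N) (\<lambda>x. C * (\<bar>g' i x\<bar> * indicator (cube N K) x))"
    proof (intro integrable_mult_right integrableI_bounded)
      have "(\<integral>\<^sup>+x. ennreal (norm (\<bar>g' i x\<bar> * indicator (cube N K) x)) \<partial>BN N) = (\<integral>\<^sup>+x. ennreal \<bar>g' i x\<bar> * indicator (cube N K) x \<partial>BN N)"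
        by (rule nn_integral_cong) (simp add: indicator_def)
      then show "(\<integral>\<^sup>+x. ennreal (norm (\<bar>g' i x\<bar> * indicator (cube N K) x)) \<partial>BN N) < \<infinity>" using lf[OF i] by simp
    qed measurable
    have int: "integrable (BN N) (\<lambda>x. max 0 (s * g' i x) * \<phi> x)" if s: "\<bar>s\<bar> = 1" for s
    proof (rule Bochner_Integration.integrable_bound[OF int_abs])
      show "AE x in BN N. norm (max 0 (s * g' i x) * \<phi> x) \<le> norm (C * (\<bar>g' i x\<bar> * indicator (cube N K) x))"
      proof (rule AE_I2)
        fix x assume "x \<in> space (BN N)"
        then have "\<bar>\<phi> x\<bar> \<le> C * indicator (cube N K) x" using KC by (simp add: space_BN)
        moreover have "\<bar>max 0 (s * g' i x)\<bar> \<le> \<bar>g' i x\<bar>"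
        proof -
          have "\<bar>s * g' i x\<bar> = \<bar>g' i x\<bar>" using s by (simp add: abs_mult)
          then show ?thesis by linarith
        qed
        ultimately have "\<bar>max 0 (s * g' i x)\<bar> * \<bar>\<phi> x\<bar> \<le> \<bar>g' i x\<bar> * (C * indicator (cube N K) x)"
          by (intro mult_mono) auto
        then show "norm (max 0 (s * g' i x) * \<phi> x) \<le> norm (C * (\<bar>g' i x\<bar> * indicator (cube N K) x))"
          using KC(1) by (simp add: abs_mult mult_ac)
      qed
    qed measurable
    have "(\<integral>x. u' x * bumpfun N R (e1 i) x \<partial>BN N) = (\<integral>x. u x * pd i \<phi> x \<partial>LN N)"
      unfolding \<phi>_def pd_bumpfun[OF R i] by (rule uint[symmetric, OF bm])
    also have "\<dots> = - (\<integral>x. g i x * \<phi> x \<partial>LN N)"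
      using W test_bumpfun[OF R, of "\<lambda>_. 0"] i by (simp add: W1p_def \<phi>_def)
    also have "(\<integral>x. g i x * \<phi> x \<partial>LN N) = (\<integral>x. g' i x * \<phi> x \<partial>completion (BN N))"
      unfolding LN_def
    proof (rule integral_cong_AE)
      show "AE x in completion (BN N). g i x * \<phi> x = g' i x * \<phi> x"
        using AE_completion[OF g'(2)[OF i]] by eventually_elim simp
      show "(\<lambda>x. g i x * \<phi> x) \<in> borel_measurable (completion (BN N))"
        by (rule borel_measurable_times[OF gm[OF i] measurable_completion]) measurable
      show "(\<lambda>x. g' i x * \<phi> x) \<in> borel_measurable (completion (BN N))"
        by (rule measurable_completion) measurable
    qed
    also have "\<dots> = (\<integral>x. g' i x * \<phi> x \<partial>BN N)" by (rule integral_completion) measurable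
    also have "\<dots> = (\<integral>x. max 0 (1 * g' i x) * \<phi> x - max 0 (- 1 * g' i x) * \<phi> x \<partial>BN N)"
      by (rule Bochner_Integration.integral_cong) (auto simp: max_def)
    also have "\<dots> = (\<integral>x. max 0 (1 * g' i x) * \<phi> x \<partial>BN N) - (\<integral>x. max 0 (- 1 * g' i x) * \<phi> x \<partial>BN N)"
      by (intro Bochner_Integration.integral_diff int) auto
    also have "\<dots> = (\<integral>x. \<phi> x \<partial>density (BN N) (\<lambda>x. ennreal (g' i x))) - (\<integral>x. \<phi> x \<partial>density (BN N) (\<lambda>x. ennreal (- g' i x)))"
      by (simp add: density_pos_part)
    finally show "(\<integral>x. u' x * bumpfun N R (e1 i) x \<partial>BN N)
      = - ((\<integral>x. bumpfun N R (\<lambda>_. 0) x \<partial>density (BN N) (\<lambda>x. ennreal (g' i x))) - (\<integral>x. bumpfun N R (\<lambda>_. 0) x \<partial>density (BN N) (\<lambda>x. ennreal (- g' i x))))"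
      unfolding \<phi>_def .
  qed
  moreover have "gradnorm N p g = (\<integral>\<^sup>+x. ennreal (sqrt (\<Sum>i<N. (g' i x)\<^sup>2) powr p) \<partial>BN N)"
  proof -
    have "AE x in BN N. \<forall>i\<in>{..<N}. g i x = g' i x" using g'(2) by (intro AE_finite_allI) auto
    then show ?thesis unfolding gradnorm_def LN_def nn_integral_completion
      by (intro nn_integral_cong_AE) (auto elim!: eventually_mono)
  qed
  ultimately show ?thesis using that u' by blast
qed

lemma W1p_level_bound:
  assumes W: "W1p N p u g" and p: "p \<ge> 1" and N: "N \<ge> 1" and lb: "line_bound \<gamma> c" and lam: "lam > 0"
  shows "ennreal (lam powr p) * nu N \<gamma> (Elev N u lam (\<gamma> / p)) \<le> ennreal (4 * exp 1 * sphere_area N) * c * gradnorm N p g"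
proof -
  obtain u' g' where ae: "AE x in BN N. u x = u' x" and [measurable]: "u' \<in> borel_measurable (BN N)" and dg: "density_gradient N u' g'"
    and gn: "gradnorm N p g = (\<integral>\<^sup>+x. ennreal (sqrt (\<Sum>i<N. (g' i x)\<^sup>2) powr p) \<partial>BN N)"
    by (rule W1p_representative[OF W p], rule that)
  have "ennreal (lam powr p) * nu N \<gamma> (Elev N u lam (\<gamma> / p)) \<le> ennreal (lam powr p) * level_energy N \<gamma> (\<gamma> / p) lam u'"
    by (intro mult_left_mono nu_le_level_energy ae) simp
  also have "\<dots> \<le> ennreal (4 * exp 1 * sphere_area N) * c * (\<integral>\<^sup>+x. ennreal (sqrt (\<Sum>i<N. (g' i x)\<^sup>2) powr p) \<partial>BN N)"
  proof (rule level_energy_bound[OF _ _ N lb p lam])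
    have [measurable]: "(\<lambda>x. \<Sum>i<N. (g' i x)\<^sup>2) \<in> borel_measurable (BN N)"
      using density_gradient.g_meas[OF dg] by (intro borel_measurable_sum borel_measurable_power) auto
    show "(\<lambda>x. ennreal (sqrt (\<Sum>i<N. (g' i x)\<^sup>2) powr p)) \<in> borel_measurable (BN N)" by measurable
    show "AE x in BN N. ennreal (\<bar>u' (shift N z 1 x) - u' x\<bar> powr p)
      \<le> ennreal (nrm N z powr p) * (\<integral>\<^sup>+r\<in>{0..1}. ennreal (sqrt (\<Sum>i<N. (g' i (shift N z r x))\<^sup>2) powr p) \<partial>lborel)"
      if "z \<in> space (BN N)" for z
      by (rule density_gradient.increment_powr_bound[OF dg that p])
  qed fact
  finally show ?thesis by (simp add: gn)
qed

subsection \<open>Functions of bounded variation\<close>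

text \<open>Half-open, so that the translates by \<epsilon> times integer vectors partition the
  space; x is the lower corner.\<close>

definition hbox :: "nat \<Rightarrow> real \<Rightarrow> (nat \<Rightarrow> real) \<Rightarrow> (nat \<Rightarrow> real) set" where
  "hbox N \<epsilon> x = PiE {..<N} (\<lambda>i. {x i..<x i + \<epsilon>})"

lemma hbox_sets [measurable]: "hbox N \<epsilon> x \<in> sets (BN N)"
  unfolding hbox_def by (intro box_in_sets_BN) auto

lemma mem_hbox: "y \<in> hbox N \<epsilon> x \<longleftrightarrow> y \<in> sp N \<and> (\<forall>i\<in>{..<N}. x i \<le> y i \<and> y i < x i + \<epsilon>)"
  by (auto simp: hbox_def sp_def PiE_iff)

lemma hbox_pred_measurable:
  assumes "f \<in> measurable M (BN N)" "g \<in> measurable M (BN N)"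
  shows "Measurable.pred M (\<lambda>\<omega>. g \<omega> \<in> hbox N \<epsilon> (f \<omega>))"
proof -
  have "Measurable.pred M (\<lambda>\<omega>. \<forall>i\<in>{..<N}. f \<omega> i \<le> g \<omega> i \<and> g \<omega> i < f \<omega> i + \<epsilon>)"
  proof (intro pred_intros_finite finite_lessThan)
    fix i assume "i \<in> {..<N}"
    then have [measurable]: "(\<lambda>\<omega>. f \<omega> i) \<in> borel_measurable M" "(\<lambda>\<omega>. g \<omega> i) \<in> borel_measurable M"
      using component_measurable[OF assms(1)] component_measurable[OF assms(2)] by auto
    show "Measurable.pred M (\<lambda>\<omega>. f \<omega> i \<le> g \<omega> i \<and> g \<omega> i < f \<omega> i + \<epsilon>)" by measurable
  qed
  then show ?thesis
    by (rule measurable_cong[THEN iffD1, rotated])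
      (use measurable_space[OF assms(2)] in \<open>auto simp: mem_hbox space_BN\<close>)
qed

lemma hbox_indicator_measurable:
  assumes "f \<in> measurable M (BN N)" "g \<in> measurable M (BN N)"
  shows "(\<lambda>\<omega>. indicator (hbox N \<epsilon> (f \<omega>)) (g \<omega>) :: 'b::{zero_neq_one, topological_space}) \<in> borel_measurable M"
proof -
  note [measurable] = hbox_pred_measurable[OF assms]
  have "(\<lambda>\<omega>. if g \<omega> \<in> hbox N \<epsilon> (f \<omega>) then 1 else 0 :: 'b) \<in> borel_measurable M" by measurable
  then show ?thesis by (simp add: indicator_def of_bool_def)
qed

lemma measure_hbox_measurable:
  assumes "finite_measure M" and M: "sets M = sets (BN N)"
  shows "(\<lambda>x. measure M (hbox N \<epsilon> x)) \<in> borel_measurable (BN N)"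
proof -
  interpret finite_measure M by fact
  note [measurable_cong] = M
  have "(\<lambda>p. indicator (hbox N \<epsilon> (fst p)) (snd p) :: ennreal) \<in> borel_measurable (BN N \<Otimes>\<^sub>M M)"
    by (rule hbox_indicator_measurable) measurable
  then have "(\<lambda>x. \<integral>\<^sup>+y. indicator (hbox N \<epsilon> x) y \<partial>M) \<in> borel_measurable (BN N)"
    by (intro borel_measurable_nn_integral) (simp add: split_beta)
  then have "(\<lambda>x. emeasure M (hbox N \<epsilon> x)) \<in> borel_measurable (BN N)"
    using hbox_sets M by simp
  then show ?thesis unfolding measure_def by measurable
qed

lemma emeasure_hbox: "\<epsilon> > 0 \<Longrightarrow> emeasure (BN N) (hbox N \<epsilon> x) = ennreal (\<epsilon> ^ N)"
  unfolding hbox_def by (subst emeasure_BN_box) (auto simp: ennreal_power)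

lemma hbox_subset_cube: "hbox N \<epsilon> x \<subseteq> cube N ((\<Sum>i<N. \<bar>x i\<bar>) + \<bar>\<epsilon>\<bar>)"
proof
  fix y assume y: "y \<in> hbox N \<epsilon> x"
  have "\<bar>y i\<bar> \<le> (\<Sum>i<N. \<bar>x i\<bar>) + \<bar>\<epsilon>\<bar>" if i: "i < N" for i
  proof -
    have "\<bar>x i\<bar> \<le> (\<Sum>i<N. \<bar>x i\<bar>)" using i by (intro member_le_sum) auto
    moreover have "x i \<le> y i" "y i < x i + \<epsilon>" using y i by (auto simp: mem_hbox)
    ultimately show ?thesis by linarith
  qed
  then show "y \<in> cube N ((\<Sum>i<N. \<bar>x i\<bar>) + \<bar>\<epsilon>\<bar>)" using y by (simp add: mem_cube mem_hbox)
qed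

lemma shift_mem_hbox: "y \<in> sp N \<Longrightarrow> shift N z (- r) y \<in> hbox N \<epsilon> x \<longleftrightarrow> y \<in> hbox N \<epsilon> (shift N z r x)"
  by (simp add: mem_hbox shift_in_sp) (simp add: shift_def le_diff_eq diff_less_eq add_ac)

lemma nn_integral_le_if_cubes_le:
  assumes [measurable]: "f \<in> borel_measurable (BN N)"
    and le: "\<And>n::nat. (\<integral>\<^sup>+x. f x * indicator (cube N (real n)) x \<partial>BN N) \<le> B"
  shows "(\<integral>\<^sup>+x. f x \<partial>BN N) \<le> B"
proof -
  have "(\<integral>\<^sup>+x. f x \<partial>BN N) = (\<integral>\<^sup>+x. (SUP n::nat. f x * indicator (cube N (real n)) x) \<partial>BN N)"
  proof (rule nn_integral_cong, rule antisym)
    fix x assume "x \<in> space (BN N)"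
    then obtain n :: nat where "x \<in> cube N (real n)" using ex_cube by (auto simp: space_BN)
    then show "f x \<le> (SUP n::nat. f x * indicator (cube N (real n)) x)"
      by (intro SUP_upper2[of n]) auto
    show "(SUP n::nat. f x * indicator (cube N (real n)) x) \<le> f x"
      by (intro SUP_least) (auto simp: indicator_def)
  qed
  also have "\<dots> = (SUP n::nat. \<integral>\<^sup>+x. f x * indicator (cube N (real n)) x \<partial>BN N)"
  proof (rule nn_integral_monotone_convergence_SUP)
    show "incseq (\<lambda>n x. f x * indicator (cube N (real n)) x)"
    proof (intro monoI le_funI mult_left_mono)
      fix m n :: nat and x assume "m \<le> n"
      then have "cube N (real m) \<subseteq> cube N (real n)" by (intro cube_mono) simp
      then show "(indicator (cube N (real m)) x :: ennreal) \<le> indicator (cube N (real n)) x" by (auto simp: indicator_def)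
    qed simp
  qed measurable
  also have "\<dots> \<le> B" by (intro SUP_least le)
  finally show ?thesis .
qed

text \<open>Moving the measure by - r z has the same effect on a box as moving the box by r z. The
  averaged measure of a box is thus a line integral of box measures.\<close>

lemma smear_hbox:
  assumes "finite_measure M" and lf: "locfin N M" and z: "z \<in> space (BN N)"
  shows "measure (smear N z M) (hbox N \<epsilon> x) = (\<integral>r. measure M (hbox N \<epsilon> (shift N z r x)) \<partial>unit01)"
    and "integrable unit01 (\<lambda>r. measure M (hbox N \<epsilon> (shift N z r x)))"
proof -
  interpret finite_measure M by fact
  have M: "sets M = sets (BN N)" and spM: "space M = sp N"
    using lf sets_eq_imp_space_eq[of M "BN N"] by (auto simp: locfin_def space_BN)
  have eq: "(\<integral>y. (indicator (hbox N \<epsilon> x) (shift N z (- r) y) :: real) \<partial>M) = measure M (hbox N \<epsilon> (shift N z r x))" for r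
  proof -
    have "(\<integral>y. indicator (hbox N \<epsilon> x) (shift N z (- r) y) \<partial>M) = (\<integral>y. indicator (hbox N \<epsilon> (shift N z r x)) y \<partial>M)"
      by (rule Bochner_Integration.integral_cong) (auto simp: indicator_def shift_mem_hbox spM)
    also have "\<dots> = measure M (hbox N \<epsilon> (shift N z r x))"
      using hbox_sets[of N \<epsilon> "shift N z r x"] M sets.sets_into_space[of "hbox N \<epsilon> (shift N z r x)" M] by (simp add: Int_absorb2)
    finally show ?thesis .
  qed
  have bd: "\<bar>indicator (hbox N \<epsilon> x) y :: real\<bar> \<le> 1 * indicator (cube N ((\<Sum>i<N. \<bar>x i\<bar>) + \<bar>\<epsilon>\<bar>)) y" for y
    using hbox_subset_cube[of N \<epsilon> x] by (auto simp: indicator_def)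
  have "(\<integral>y. (indicator (hbox N \<epsilon> x) y :: real) \<partial>smear N z M) = (\<integral>r. (\<integral>y. indicator (hbox N \<epsilon> x) (shift N z (- r) y) \<partial>M) \<partial>unit01)"
    by (rule integral_smear(1)[OF lf z, where f="indicator (hbox N \<epsilon> x)", OF _ bd]) auto
  moreover have "(\<integral>y. indicator (hbox N \<epsilon> x) y \<partial>smear N z M) = measure (smear N z M) (hbox N \<epsilon> x)"
    using hbox_sets[of N \<epsilon> x] sets.sets_into_space[of "hbox N \<epsilon> x" "smear N z M"] by (simp add: Int_absorb2)
  ultimately show "measure (smear N z M) (hbox N \<epsilon> x) = (\<integral>r. measure M (hbox N \<epsilon> (shift N z r x)) \<partial>unit01)"
    by (simp add: eq)
  have "integrable unit01 (\<lambda>r. \<integral>y. (indicator (hbox N \<epsilon> x) (shift N z (- r) y) :: real) \<partial>M)"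
    by (rule integral_smear(2)[OF lf z, where f="indicator (hbox N \<epsilon> x)", OF _ bd]) auto
  then show "integrable unit01 (\<lambda>r. measure M (hbox N \<epsilon> (shift N z r x)))" by (simp add: eq)
qed

lemma measure_smear_le:
  assumes "finite_measure M" and lf: "locfin N M" and z: "z \<in> space (BN N)"
  shows "measure (smear N z M) A \<le> measure M (space M)"
proof -
  interpret finite_measure M by fact
  have "emeasure (smear N z M) (space (smear N z M)) = (\<integral>\<^sup>+x. 1 \<partial>smear N z M)" by simp
  also have "\<dots> = (\<integral>\<^sup>+r\<in>{0..1::real}. (\<integral>\<^sup>+y. 1 \<partial>M) \<partial>lborel)"
    by (rule nn_integral_smear[OF lf z]) simp
  also have "\<dots> = emeasure M (space M)" by (simp add: nn_integral_cmult_indicator)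
  finally have *: "emeasure (smear N z M) (space (smear N z M)) = emeasure M (space M)" .
  then interpret S: finite_measure "smear N z M" by (intro finite_measureI) simp
  have "measure (smear N z M) A \<le> measure (smear N z M) (space (smear N z M))" by (rule S.bounded_measure)
  then show ?thesis using * by (simp add: measure_def)
qed

text \<open>\<open>TV\<close> ranges over families indexed by initial segments of the natural
  numbers; the families used below are indexed by lattice vectors.\<close>

lemma TV_upper:
  assumes T: "finite T" and A: "\<And>t. t \<in> T \<Longrightarrow> A t \<in> sets (BN N)" and dis: "disjoint_family_on A T"
  shows "ennreal (\<Sum>t\<in>T. sqrt (\<Sum>i<N. (measure (P i) (A t) - measure (Q i) (A t))\<^sup>2)) \<le> TV N P Q"
proof -
  obtain h where h: "bij_betw h {0..<card T} T" using ex_bij_betw_nat_finite[OF T] by blast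
  then have h: "bij_betw h {..<card T} T" by (simp add: atLeast0LessThan)
  have hT: "h k \<in> T" if "k < card T" for k using h that by (auto simp: bij_betw_def)
  have "disjoint_family_on (\<lambda>k. A (h k)) {..<card T}"
    unfolding disjoint_family_on_def
  proof (intro ballI impI)
    fix k l assume kl: "k \<in> {..<card T}" "l \<in> {..<card T}" "k \<noteq> l"
    then have "h k \<noteq> h l" using h by (auto simp: bij_betw_def inj_on_def)
    then show "A (h k) \<inter> A (h l) = {}" using dis hT kl by (simp add: disjoint_family_on_def)
  qed
  then have "(card T, \<lambda>k. A (h k)) \<in> {(m::nat, A::nat \<Rightarrow> (nat \<Rightarrow> real) set). (\<forall>k<m. A k \<in> sets (BN N)) \<and> disjoint_family_on A {..<m}}"
    using A hT by simp
  then have "ennreal (\<Sum>k<card T. sqrt (\<Sum>i<N. (measure (P i) (A (h k)) - measure (Q i) (A (h k)))\<^sup>2)) \<le> TV N P Q"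
    unfolding TV_def by (rule SUP_upper2) simp
  also have "(\<Sum>k<card T. sqrt (\<Sum>i<N. (measure (P i) (A (h k)) - measure (Q i) (A (h k)))\<^sup>2))
    = (\<Sum>t\<in>T. sqrt (\<Sum>i<N. (measure (P i) (A t) - measure (Q i) (A t))\<^sup>2))"
    by (rule sum.reindex_bij_betw[OF h])
  finally show ?thesis .
qed

text \<open>The strict inequality is an open condition: almost every pair in the level set of u
  belongs to that of v n for all large n. Fatou's lemma is then applied in y and in x.\<close>

lemma level_energy_Fatou:
  assumes v [measurable]: "\<And>n. v n \<in> borel_measurable (BN N)" and u: "u \<in> borel_measurable (BN N)"
    and lim: "AE x in BN N. (\<lambda>n. v n x) \<longlonglongrightarrow> u x"
  shows "level_energy N \<gamma> b lam u \<le> liminf (\<lambda>n. level_energy N \<gamma> b lam (v n))"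
proof -
  define h where "h = (\<lambda>(v :: (nat \<Rightarrow> real) \<Rightarrow> real) x y. if lam < \<bar>v x - v y\<bar> / rdist N x y powr (1 + b)
     then ennreal (rdist N x y powr (\<gamma> - N)) else 0)"
  have hm [measurable]: "(\<lambda>(x, y). h (v n) x y) \<in> borel_measurable (BN N \<Otimes>\<^sub>M BN N)" for n
    unfolding h_def by measurable
  have "level_energy N \<gamma> b lam u \<le> (\<integral>\<^sup>+x. liminf (\<lambda>n. \<integral>\<^sup>+y. h (v n) x y \<partial>BN N) \<partial>BN N)"
    unfolding level_energy_def
  proof (rule nn_integral_mono_AE, use lim AE_space in eventually_elim)
    fix x assume x: "(\<lambda>n. v n x) \<longlonglongrightarrow> u x" and [measurable]: "x \<in> space (BN N)"
    have "(\<integral>\<^sup>+y. (if lam < \<bar>u x - u y\<bar> / rdist N x y powr (1 + b) then ennreal (rdist N x y powr (\<gamma> - N)) else 0) \<partial>BN N)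
      \<le> (\<integral>\<^sup>+y. liminf (\<lambda>n. h (v n) x y) \<partial>BN N)"
    proof (rule nn_integral_mono_AE, use lim in eventually_elim)
      fix y assume y: "(\<lambda>n. v n y) \<longlonglongrightarrow> u y"
      show "(if lam < \<bar>u x - u y\<bar> / rdist N x y powr (1 + b) then ennreal (rdist N x y powr (\<gamma> - N)) else 0) \<le> liminf (\<lambda>n. h (v n) x y)"
      proof (cases "lam < \<bar>u x - u y\<bar> / rdist N x y powr (1 + b)")
        case True
        have "(\<lambda>n. \<bar>v n x - v n y\<bar> * inverse (rdist N x y powr (1 + b))) \<longlonglongrightarrow> \<bar>u x - u y\<bar> * inverse (rdist N x y powr (1 + b))"
          by (intro tendsto_mult tendsto_rabs tendsto_diff x y tendsto_const)
        then have "\<forall>\<^sub>F n in sequentially. lam < \<bar>v n x - v n y\<bar> * inverse (rdist N x y powr (1 + b))"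
          using True by (intro order_tendstoD(1)) (auto simp: divide_inverse)
        then have "\<forall>\<^sub>F n in sequentially. ennreal (rdist N x y powr (\<gamma> - N)) \<le> h (v n) x y"
          by eventually_elim (simp add: h_def divide_inverse)
        then show ?thesis using True by (simp add: Liminf_bounded)
      qed simp
    qed
    also have "\<dots> \<le> liminf (\<lambda>n. \<integral>\<^sup>+y. h (v n) x y \<partial>BN N)"
      by (rule nn_integral_liminf) measurable
    finally show "(\<integral>\<^sup>+y. (if lam < \<bar>u x - u y\<bar> / rdist N x y powr (1 + b) then ennreal (rdist N x y powr (\<gamma> - N)) else 0) \<partial>BN N)
      \<le> liminf (\<lambda>n. \<integral>\<^sup>+y. h (v n) x y \<partial>BN N)" .
  qed
  also have "\<dots> \<le> liminf (\<lambda>n. \<integral>\<^sup>+x. \<integral>\<^sup>+y. h (v n) x y \<partial>BN N \<partial>BN N)"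
    by (rule nn_integral_liminf) measurable
  finally show ?thesis by (simp add: level_energy_def h_def)
qed

section \<open>Averages of a function of bounded variation over small boxes\<close>

locale finite_measure_gradient = measure_gradient +
  assumes finP: "i < N \<Longrightarrow> finite_measure (P i)" and finQ: "i < N \<Longrightarrow> finite_measure (Q i)"
begin

definition avg :: "real \<Rightarrow> (nat \<Rightarrow> real) \<Rightarrow> real" where
  "avg \<epsilon> x = (\<integral>y. u y * indicator (hbox N \<epsilon> x) y \<partial>BN N) / \<epsilon> ^ N"

text \<open>The length of the gradient measure of the box divided by the volume of the box. It plays
  the part of the gradient norm of \<open>avg\<close>, although \<open>avg\<close> is never
  differentiated.\<close>

definition avg_grad :: "real \<Rightarrow> (nat \<Rightarrow> real) \<Rightarrow> real" where
  "avg_grad \<epsilon> x = sqrt (\<Sum>i<N. (measure (P i) (hbox N \<epsilon> x) - measure (Q i) (hbox N \<epsilon> x))\<^sup>2) / \<epsilon> ^ N"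

lemma avg_measurable [measurable]: "avg \<epsilon> \<in> borel_measurable (BN N)"
proof -
  have "(\<lambda>p. indicator (hbox N \<epsilon> (fst p)) (snd p) :: real) \<in> borel_measurable (BN N \<Otimes>\<^sub>M BN N)"
    by (rule hbox_indicator_measurable) measurable
  then have [measurable]: "(\<lambda>(x, y). indicator (hbox N \<epsilon> x) y :: real) \<in> borel_measurable (BN N \<Otimes>\<^sub>M BN N)"
    by (simp add: split_beta)
  have "(\<lambda>x. \<integral>y. u y * indicator (hbox N \<epsilon> x) y \<partial>BN N) \<in> borel_measurable (BN N)"
    by measurable
  then have "(\<lambda>x. avg \<epsilon> x) \<in> borel_measurable (BN N)"
    unfolding avg_def by (intro borel_measurable_divide) auto
  then show ?thesis by simp
qed

lemma avg_grad_measurable [measurable]: "avg_grad \<epsilon> \<in> borel_measurable (BN N)"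
proof -
  have [measurable]: "(\<lambda>x. \<Sum>i<N. (measure (P i) (hbox N \<epsilon> x) - measure (Q i) (hbox N \<epsilon> x))\<^sup>2) \<in> borel_measurable (BN N)"
    by (intro borel_measurable_sum borel_measurable_power borel_measurable_diff measure_hbox_measurable)
      (use finP finQ P Q in \<open>auto simp: locfin_def\<close>)
  have "(\<lambda>x. avg_grad \<epsilon> x) \<in> borel_measurable (BN N)"
    unfolding avg_grad_def by measurable
  then show ?thesis by simp
qed

lemma integrable_hbox: "integrable (BN N) (\<lambda>y. u y * indicator (hbox N \<epsilon> x) y)"
  using hbox_subset_cube[of N \<epsilon> x]
  by (intro integrable_mult_bounded[where C=1 and K="(\<Sum>i<N. \<bar>x i\<bar>) + \<bar>\<epsilon>\<bar>"]) (auto simp: indicator_def)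

lemma avg_shift: "avg \<epsilon> (shift N z 1 x) = (\<integral>y. u (shift N z 1 y) * indicator (hbox N \<epsilon> x) y \<partial>BN N) / \<epsilon> ^ N"
proof -
  have "(\<integral>y. u y * indicator (hbox N \<epsilon> (shift N z 1 x)) y \<partial>BN N)
    = (\<integral>y. u (shift N z 1 y) * indicator (hbox N \<epsilon> (shift N z 1 x)) (shift N z 1 y) \<partial>BN N)"
    by (rule integral_shift[symmetric]) measurable
  also have "\<dots> = (\<integral>y. u (shift N z 1 y) * indicator (hbox N \<epsilon> x) y \<partial>BN N)"
  proof (rule Bochner_Integration.integral_cong[OF refl])
    fix y assume "y \<in> space (BN N)"
    then have "shift N z 1 y \<in> hbox N \<epsilon> (shift N z 1 x) \<longleftrightarrow> y \<in> hbox N \<epsilon> x"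
      using shift_mem_hbox[of "shift N z 1 y" N z 1 \<epsilon> x] by (simp add: shift_in_sp shift_shift shift_0 space_BN)
    then show "u (shift N z 1 y) * indicator (hbox N \<epsilon> (shift N z 1 x)) (shift N z 1 y) = u (shift N z 1 y) * indicator (hbox N \<epsilon> x) y"
      by (simp add: indicator_def)
  qed
  finally show ?thesis by (simp add: avg_def)
qed

lemma integrable_shift_hbox:
  assumes z: "z \<in> space (BN N)"
  shows "integrable (BN N) (\<lambda>y. u (shift N z 1 y) * indicator (hbox N \<epsilon> x) y)"
proof -
  have "integrable (BN N) (\<lambda>y. u (shift N z 1 y) * indicator (hbox N \<epsilon> (shift N z 1 x)) (shift N z 1 y))"
    by (rule integrable_shift[OF integrable_hbox])
  then show ?thesis
  proof (rule Bochner_Integration.integrable_cong[OF refl, THEN iffD1, rotated])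
    fix y assume "y \<in> space (BN N)"
    then have "shift N z 1 y \<in> hbox N \<epsilon> (shift N z 1 x) \<longleftrightarrow> y \<in> hbox N \<epsilon> x"
      using shift_mem_hbox[of "shift N z 1 y" N z 1 \<epsilon> x] by (simp add: shift_in_sp shift_shift shift_0 space_BN)
    then show "u (shift N z 1 y) * indicator (hbox N \<epsilon> (shift N z 1 x)) (shift N z 1 y) = u (shift N z 1 y) * indicator (hbox N \<epsilon> x) y"
      by (simp add: indicator_def)
  qed
qed

text \<open>The increment of the average is the average of the increment over the box, to which
  \<open>set_identity\<close> applies; \<open>smear_hbox\<close> then turns averaged measures into
  line integrals of box measures.\<close>

lemma avg_increment:
  assumes z [measurable]: "z \<in> space (BN N)" and x [measurable]: "x \<in> space (BN N)" and \<epsilon>: "\<epsilon> > 0"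
  shows "ennreal \<bar>avg \<epsilon> (shift N z 1 x) - avg \<epsilon> x\<bar>
    \<le> ennreal (nrm N z) * (\<integral>\<^sup>+r\<in>{0..1}. ennreal (avg_grad \<epsilon> (shift N z r x)) \<partial>lborel)"
proof -
  define a where "a = (\<lambda>i r. (measure (P i) (hbox N \<epsilon> (shift N z r x)) - measure (Q i) (hbox N \<epsilon> (shift N z r x))) / \<epsilon> ^ N)"
  have ia: "integrable unit01 (a i)" if i: "i < N" for i
    unfolding a_def
    by (intro integrable_divide Bochner_Integration.integrable_diff smear_hbox(2)[OF finP[OF i] P[OF i] z] smear_hbox(2)[OF finQ[OF i] Q[OF i] z])
  have "avg \<epsilon> (shift N z 1 x) - avg \<epsilon> x = (\<integral>y. (u (shift N z 1 y) - u y) * indicator (hbox N \<epsilon> x) y \<partial>BN N) / \<epsilon> ^ N"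
    unfolding avg_shift using integrable_shift_hbox[OF z] integrable_hbox
    by (simp add: avg_def left_diff_distrib diff_divide_distrib)
  also have "\<dots> = (\<Sum>i<N. z i * (measure (smear N z (P i)) (hbox N \<epsilon> x) - measure (smear N z (Q i)) (hbox N \<epsilon> x))) / \<epsilon> ^ N"
    using set_identity[OF z hbox_sets hbox_subset_cube] by simp
  also have "\<dots> = (\<Sum>i<N. z i * (\<integral>r. a i r \<partial>unit01))"
    unfolding sum_divide_distrib
  proof (rule sum.cong[OF refl])
    fix i assume "i \<in> {..<N}"
    then have i: "i < N" by simp
    show "z i * (measure (smear N z (P i)) (hbox N \<epsilon> x) - measure (smear N z (Q i)) (hbox N \<epsilon> x)) / \<epsilon> ^ N = z i * (\<integral>r. a i r \<partial>unit01)"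
      unfolding a_def using smear_hbox[OF finP[OF i] P[OF i] z] smear_hbox[OF finQ[OF i] Q[OF i] z] by simp
  qed
  finally have "ennreal \<bar>avg \<epsilon> (shift N z 1 x) - avg \<epsilon> x\<bar> \<le> ennreal (nrm N z) * (\<integral>\<^sup>+r. ennreal (sqrt (\<Sum>i<N. (a i r)\<^sup>2)) \<partial>unit01)"
    using line_average_bound[OF ia, where z=z] by simp
  also have "(\<lambda>r. sqrt (\<Sum>i<N. (a i r)\<^sup>2)) = (\<lambda>r. avg_grad \<epsilon> (shift N z r x))"
    using \<epsilon> by (simp add: a_def avg_grad_def power_divide sum_divide_distrib[symmetric] real_sqrt_divide)
  also have "(\<integral>\<^sup>+r. ennreal (avg_grad \<epsilon> (shift N z r x)) \<partial>unit01) = (\<integral>\<^sup>+r\<in>{0..1}. ennreal (avg_grad \<epsilon> (shift N z r x)) \<partial>lborel)"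
    by (rule nn_integral_unit01) measurable
  finally show ?thesis .
qed

text \<open>The translates of a half-open box by the lattice \<open>\<epsilon> Z^N\<close> are disjoint, so that the sum of
  \<open>avg_grad\<close> over a translate of the lattice is at most \<open>TV / \<epsilon>^N\<close>.\<close>

lemma nn_integral_avg_grad_le_TV:
  assumes \<epsilon>: "\<epsilon> > 0"
  shows "(\<integral>\<^sup>+x. ennreal (avg_grad \<epsilon> x) \<partial>BN N) \<le> TV N P Q"
proof (rule nn_integral_le_if_cubes_le)
  fix n :: nat
  \<comment> \<open>Lattice vectors with entries between -L and L reach every cell that meets the
    cube, and there are finitely many of them, as \<open>TV_upper\<close> requires.\<close>
  obtain L :: nat where L: "real n / \<epsilon> + 1 < real L" using reals_Archimedean2 by blast
  define T where "T = PiE {..<N} (\<lambda>_. {- int L..int L})"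
  have T: "finite T" unfolding T_def by (intro finite_PiE) auto
  define \<tau> where "\<tau> = (\<lambda>m :: nat \<Rightarrow> int. shift N (\<lambda>i. real_of_int (m i)))"
  define B where "B = hbox N \<epsilon> (\<lambda>_. 0)"
  have [measurable]: "B \<in> sets (BN N)" by (simp add: B_def)
  have [measurable]: "\<tau> m r \<in> measurable (BN N) (BN N)" for m r unfolding \<tau>_def by measurable
  have dis: "disjoint_family_on (\<lambda>m. hbox N \<epsilon> (\<tau> m \<epsilon> w)) T" for w
    unfolding disjoint_family_on_def
  proof (intro ballI impI)
    fix m m' assume m: "m \<in> T" "m' \<in> T" "m \<noteq> m'"
    then obtain i where i: "i < N" "m i \<noteq> m' i" unfolding T_def by (metis PiE_ext lessThan_iff)
    show "hbox N \<epsilon> (\<tau> m \<epsilon> w) \<inter> hbox N \<epsilon> (\<tau> m' \<epsilon> w) = {}"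
    proof (rule ccontr)
      assume "hbox N \<epsilon> (\<tau> m \<epsilon> w) \<inter> hbox N \<epsilon> (\<tau> m' \<epsilon> w) \<noteq> {}"
      then obtain y where y: "y \<in> hbox N \<epsilon> (\<tau> m \<epsilon> w)" "y \<in> hbox N \<epsilon> (\<tau> m' \<epsilon> w)" by blast
      have "w i + \<epsilon> * m i \<le> y i" "y i < w i + \<epsilon> * m i + \<epsilon>" "w i + \<epsilon> * m' i \<le> y i" "y i < w i + \<epsilon> * m' i + \<epsilon>"
        using y i(1) by (auto simp: mem_hbox \<tau>_def shift_def)
      then have "\<epsilon> * real_of_int (m i) < \<epsilon> * (real_of_int (m' i) + 1)" "\<epsilon> * real_of_int (m' i) < \<epsilon> * (real_of_int (m i) + 1)"
        by (simp_all add: distrib_left)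
      then show False using \<epsilon> i(2) by simp
    qed
  qed
  have cover: "indicator (cube N (real n)) x \<le> (\<Sum>m\<in>T. indicator B (\<tau> m (- \<epsilon>) x) :: ennreal)" for x
  proof (cases "x \<in> cube N (real n)")
    case True
    define m where "m = (\<lambda>i\<in>{..<N}. \<lfloor>x i / \<epsilon>\<rfloor>)"
    have "m \<in> T"
      unfolding T_def m_def
    proof (intro restrict_PiE_iff[THEN iffD2] ballI)
      fix i assume "i \<in> {..<N}"
      then have "\<bar>x i\<bar> \<le> real n" using True by (simp add: mem_cube)
      then have "\<bar>x i / \<epsilon>\<bar> \<le> real n / \<epsilon>" using \<epsilon> by (simp add: abs_divide divide_right_mono)
      then have "- real L \<le> x i / \<epsilon>" "x i / \<epsilon> \<le> real L" using L by linarith+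
      then show "\<lfloor>x i / \<epsilon>\<rfloor> \<in> {- int L..int L}" by (simp add: le_floor_iff floor_le_iff)
    qed
    moreover have "\<tau> m (- \<epsilon>) x \<in> B"
      unfolding B_def mem_hbox
    proof (intro conjI ballI)
      show "\<tau> m (- \<epsilon>) x \<in> sp N" by (simp add: \<tau>_def shift_in_sp)
      fix i assume i: "i \<in> {..<N}"
      have "real_of_int \<lfloor>x i / \<epsilon>\<rfloor> \<le> x i / \<epsilon>" "x i / \<epsilon> < real_of_int \<lfloor>x i / \<epsilon>\<rfloor> + 1" by linarith+
      then have "\<epsilon> * real_of_int \<lfloor>x i / \<epsilon>\<rfloor> \<le> x i" "x i < \<epsilon> * real_of_int \<lfloor>x i / \<epsilon>\<rfloor> + \<epsilon>"
      proof -
        have "\<epsilon> * real_of_int \<lfloor>x i / \<epsilon>\<rfloor> \<le> \<epsilon> * (x i / \<epsilon>)" "\<epsilon> * (x i / \<epsilon>) < \<epsilon> * (real_of_int \<lfloor>x i / \<epsilon>\<rfloor> + 1)"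
          using \<epsilon> by (intro mult_left_mono mult_strict_left_mono; linarith)+
        then show "\<epsilon> * real_of_int \<lfloor>x i / \<epsilon>\<rfloor> \<le> x i" "x i < \<epsilon> * real_of_int \<lfloor>x i / \<epsilon>\<rfloor> + \<epsilon>"
          using \<epsilon> by (simp_all add: distrib_left)
      qed
      then show "0 \<le> \<tau> m (- \<epsilon>) x i" "\<tau> m (- \<epsilon>) x i < 0 + \<epsilon>" using i by (auto simp: \<tau>_def shift_def m_def)
    qed
    ultimately have "indicator B (\<tau> m (- \<epsilon>) x) \<le> (\<Sum>m\<in>T. indicator B (\<tau> m (- \<epsilon>) x) :: ennreal)"
      by (intro member_le_sum T) auto
    then show ?thesis using True \<open>\<tau> m (- \<epsilon>) x \<in> B\<close> by simp
  qed simp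
  have "(\<integral>\<^sup>+x. ennreal (avg_grad \<epsilon> x) * indicator (cube N (real n)) x \<partial>BN N)
    \<le> (\<integral>\<^sup>+x. (\<Sum>m\<in>T. ennreal (avg_grad \<epsilon> x) * indicator B (\<tau> m (- \<epsilon>) x)) \<partial>BN N)"
    unfolding sum_distrib_left[symmetric] by (intro nn_integral_mono mult_left_mono cover) simp
  also have "\<dots> = (\<Sum>m\<in>T. \<integral>\<^sup>+x. ennreal (avg_grad \<epsilon> x) * indicator B (\<tau> m (- \<epsilon>) x) \<partial>BN N)"
    by (rule nn_integral_sum) measurable
  \<comment> \<open>The substitution x = w + \<epsilon> m folds the cube onto the single cell B,
    whose volume \<epsilon>^N later cancels the normalisation of \<open>avg_grad\<close>.\<close>
  also have "\<dots> = (\<Sum>m\<in>T. \<integral>\<^sup>+w. ennreal (avg_grad \<epsilon> (\<tau> m \<epsilon> w)) * indicator B w \<partial>BN N)"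
  proof (rule sum.cong[OF refl])
    fix m assume "m \<in> T"
    have "(\<integral>\<^sup>+x. ennreal (avg_grad \<epsilon> x) * indicator B (\<tau> m (- \<epsilon>) x) \<partial>BN N)
      = (\<integral>\<^sup>+w. ennreal (avg_grad \<epsilon> (\<tau> m \<epsilon> w)) * indicator B (\<tau> m (- \<epsilon>) (\<tau> m \<epsilon> w)) \<partial>BN N)"
      unfolding \<tau>_def by (rule nn_integral_shift[symmetric]) measurable
    also have "\<dots> = (\<integral>\<^sup>+w. ennreal (avg_grad \<epsilon> (\<tau> m \<epsilon> w)) * indicator B w \<partial>BN N)"
      by (rule nn_integral_cong) (simp add: \<tau>_def shift_shift shift_0 space_BN)
    finally show "(\<integral>\<^sup>+x. ennreal (avg_grad \<epsilon> x) * indicator B (\<tau> m (- \<epsilon>) x) \<partial>BN N) = (\<integral>\<^sup>+w. ennreal (avg_grad \<epsilon> (\<tau> m \<epsilon> w)) * indicator B w \<partial>BN N)" .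
  qed
  also have "\<dots> = (\<integral>\<^sup>+w. (\<Sum>m\<in>T. ennreal (avg_grad \<epsilon> (\<tau> m \<epsilon> w)) * indicator B w) \<partial>BN N)"
    by (rule nn_integral_sum[symmetric]) measurable
  also have "\<dots> \<le> (\<integral>\<^sup>+w. (ennreal (1 / \<epsilon> ^ N) * TV N P Q) * indicator B w \<partial>BN N)"
    unfolding sum_distrib_right[symmetric]
  proof (intro nn_integral_mono mult_right_mono)
    fix w
    have "(\<Sum>m\<in>T. ennreal (avg_grad \<epsilon> (\<tau> m \<epsilon> w))) = ennreal (\<Sum>m\<in>T. avg_grad \<epsilon> (\<tau> m \<epsilon> w))"
      using \<epsilon> by (intro sum_ennreal) (auto simp: avg_grad_def sum_nonneg)
    also have "(\<Sum>m\<in>T. avg_grad \<epsilon> (\<tau> m \<epsilon> w)) = (1 / \<epsilon> ^ N) *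
      (\<Sum>m\<in>T. sqrt (\<Sum>i<N. (measure (P i) (hbox N \<epsilon> (\<tau> m \<epsilon> w)) - measure (Q i) (hbox N \<epsilon> (\<tau> m \<epsilon> w)))\<^sup>2))"
      by (simp add: avg_grad_def sum_divide_distrib)
    also have "ennreal \<dots> = ennreal (1 / \<epsilon> ^ N) *
      ennreal (\<Sum>m\<in>T. sqrt (\<Sum>i<N. (measure (P i) (hbox N \<epsilon> (\<tau> m \<epsilon> w)) - measure (Q i) (hbox N \<epsilon> (\<tau> m \<epsilon> w)))\<^sup>2))"
      using \<epsilon> by (intro ennreal_mult sum_nonneg) (auto simp: sum_nonneg)
    also have "\<dots> \<le> ennreal (1 / \<epsilon> ^ N) * TV N P Q"
      by (intro mult_left_mono TV_upper T dis) auto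
    finally show "(\<Sum>m\<in>T. ennreal (avg_grad \<epsilon> (\<tau> m \<epsilon> w))) \<le> ennreal (1 / \<epsilon> ^ N) * TV N P Q" .
  qed simp
  also have "\<dots> = ennreal (1 / \<epsilon> ^ N) * TV N P Q * ennreal (\<epsilon> ^ N)"
    using \<epsilon> by (subst nn_integral_cmult_indicator) (auto simp: B_def emeasure_hbox)
  also have "\<dots> = (ennreal (1 / \<epsilon> ^ N) * ennreal (\<epsilon> ^ N)) * TV N P Q" by (simp only: mult_ac)
  also have "ennreal (1 / \<epsilon> ^ N) * ennreal (\<epsilon> ^ N) = 1" using \<epsilon> by (subst ennreal_mult[symmetric]) auto
  finally show "(\<integral>\<^sup>+x. ennreal (avg_grad \<epsilon> x) * indicator (cube N (real n)) x \<partial>BN N) \<le> TV N P Q" by simp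
qed measurable

text \<open>A crude bound for the total variation. It serves only the convergence of the averages
  and does not enter the final constant.\<close>

definition mass :: real where
  "mass = (\<Sum>i<N. measure (P i) (space (P i)) + measure (Q i) (space (Q i)))"

lemma mass_nonneg: "mass \<ge> 0"
  by (simp add: mass_def sum_nonneg)

text \<open>On a cube the L^1 norm is the integral of the increment over the set where it is
  nonnegative minus the integral over the rest. By \<open>set_identity\<close> each of the two is at
  most \<epsilon> * mass in modulus, hence the factor 2.\<close>

lemma increment_L1:
  assumes z [measurable]: "z \<in> space (BN N)" and \<epsilon>: "\<And>i. i < N \<Longrightarrow> \<bar>z i\<bar> \<le> \<epsilon>"
  shows "(\<integral>\<^sup>+x. ennreal \<bar>u (shift N z 1 x) - u x\<bar> \<partial>BN N) \<le> ennreal (2 * \<epsilon> * mass)"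
proof (rule nn_integral_le_if_cubes_le)
  fix n :: nat
  define D where "D = (\<lambda>x. u (shift N z 1 x) - u x)"
  have [measurable]: "D \<in> borel_measurable (BN N)" unfolding D_def by measurable
  have bd: "\<bar>\<integral>x. D x * indicator A x \<partial>BN N\<bar> \<le> \<epsilon> * mass" if A: "A \<in> sets (BN N)" "A \<subseteq> cube N (real n)" for A
  proof -
    have "\<bar>\<integral>x. D x * indicator A x \<partial>BN N\<bar> = \<bar>\<Sum>i<N. z i * (measure (smear N z (P i)) A - measure (smear N z (Q i)) A)\<bar>"
      using set_identity[OF z A] by (simp add: D_def)
    also have "\<dots> \<le> (\<Sum>i<N. \<bar>z i * (measure (smear N z (P i)) A - measure (smear N z (Q i)) A)\<bar>)" by (rule sum_abs)
    also have "\<dots> \<le> (\<Sum>i<N. \<epsilon> * (measure (P i) (space (P i)) + measure (Q i) (space (Q i))))"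
    proof (rule sum_mono)
      fix i assume "i \<in> {..<N}"
      then have i: "i < N" by simp
      have "\<bar>measure (smear N z (P i)) A - measure (smear N z (Q i)) A\<bar> \<le> measure (P i) (space (P i)) + measure (Q i) (space (Q i))"
        using measure_smear_le[OF finP[OF i] P[OF i] z, of A] measure_smear_le[OF finQ[OF i] Q[OF i] z, of A]
          measure_nonneg[of "smear N z (P i)" A] measure_nonneg[of "smear N z (Q i)" A] by linarith
      then show "\<bar>z i * (measure (smear N z (P i)) A - measure (smear N z (Q i)) A)\<bar> \<le> \<epsilon> * (measure (P i) (space (P i)) + measure (Q i) (space (Q i)))"
        unfolding abs_mult using \<epsilon>[OF i] by (intro mult_mono) auto
    qed
    finally show ?thesis by (simp add: mass_def sum_distrib_left)
  qed
  define A where "A = {x \<in> space (BN N). 0 \<le> D x} \<inter> cube N (real n)"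
  define A' where "A' = {x \<in> space (BN N). \<not> 0 \<le> D x} \<inter> cube N (real n)"
  have A: "A \<in> sets (BN N)" "A \<subseteq> cube N (real n)" and A': "A' \<in> sets (BN N)" "A' \<subseteq> cube N (real n)"
    unfolding A_def A'_def by auto
  have int: "integrable (BN N) (\<lambda>x. D x * indicator E x)" if "E \<in> sets (BN N)" "E \<subseteq> cube N (real n)" for E
  proof (rule Bochner_Integration.integrable_bound)
    show "integrable (BN N) (\<lambda>x. D x * indicator (cube N (real n)) x)" unfolding D_def by (rule integrable_increment[OF z])
  qed (use that in \<open>auto simp: indicator_def\<close>)
  have eq: "\<bar>D x\<bar> * indicator (cube N (real n)) x = D x * indicator A x - D x * indicator A' x" if "x \<in> space (BN N)" for x
    using that by (auto simp: A_def A'_def indicator_def)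
  have "(\<integral>\<^sup>+x. ennreal \<bar>D x\<bar> * indicator (cube N (real n)) x \<partial>BN N) = (\<integral>\<^sup>+x. ennreal (D x * indicator A x - D x * indicator A' x) \<partial>BN N)"
    by (rule nn_integral_cong, simp only: eq[symmetric], simp add: indicator_def)
  also have "\<dots> = ennreal (\<integral>x. D x * indicator A x - D x * indicator A' x \<partial>BN N)"
    using eq by (intro nn_integral_eq_integral Bochner_Integration.integrable_diff int A A' AE_I2) (simp add: eq[symmetric])
  also have "\<dots> \<le> ennreal (2 * \<epsilon> * mass)"
    using bd[OF A] bd[OF A'] int[OF A] int[OF A'] by (intro ennreal_leI) simp
  finally show "(\<integral>\<^sup>+x. ennreal \<bar>u (shift N z 1 x) - u x\<bar> * indicator (cube N (real n)) x \<partial>BN N) \<le> ennreal (2 * \<epsilon> * mass)"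
    by (simp add: D_def)
qed measurable

text \<open>The difference is the mean of u (x + z) - u x over z in the box B at the origin.
  Exchanging the integrals reduces the claim to \<open>increment_L1\<close>, as |z i| \<le>
  \<epsilon> on B.\<close>

lemma avg_L1:
  assumes \<epsilon>: "\<epsilon> > 0"
  shows "(\<integral>\<^sup>+x. ennreal \<bar>avg \<epsilon> x - u x\<bar> \<partial>BN N) \<le> ennreal (2 * \<epsilon> * mass)"
proof -
  define B where "B = hbox N \<epsilon> (\<lambda>_. 0)"
  have [measurable]: "B \<in> sets (BN N)" by (simp add: B_def)
  have vol: "emeasure (BN N) B = ennreal (\<epsilon> ^ N)" using \<epsilon> by (simp add: B_def emeasure_hbox)
  have pt: "ennreal \<bar>avg \<epsilon> x - u x\<bar> \<le> ennreal (1 / \<epsilon> ^ N) * (\<integral>\<^sup>+z. ennreal \<bar>u (shift N z 1 x) - u x\<bar> * indicator B z \<partial>BN N)"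
    if x [measurable]: "x \<in> space (BN N)" for x
  proof -
    have mem: "shift N z 1 x \<in> hbox N \<epsilon> x \<longleftrightarrow> z \<in> B" if "z \<in> space (BN N)" for z
      using that by (auto simp: B_def mem_hbox shift_in_sp space_BN) (auto simp: shift_def)
    have i1: "integrable (BN N) (\<lambda>z. u (shift N z 1 x) * indicator B z)"
      using integrable_shift[OF integrable_hbox[of \<epsilon> x], of x 1]
      by (rule Bochner_Integration.integrable_cong[OF refl, THEN iffD1, rotated]) (simp add: mem shift_commute[of N x] indicator_def)
    have i2: "integrable (BN N) (\<lambda>z. u x * indicator B z)"
      using vol by (intro integrable_mult_right integrable_real_indicator) auto
    have "(\<integral>y. u y * indicator (hbox N \<epsilon> x) y \<partial>BN N) = (\<integral>z. u (shift N x 1 z) * indicator (hbox N \<epsilon> x) (shift N x 1 z) \<partial>BN N)"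
      by (rule integral_shift[symmetric]) measurable
    also have "\<dots> = (\<integral>z. u (shift N z 1 x) * indicator B z \<partial>BN N)"
      by (rule Bochner_Integration.integral_cong) (auto simp: mem shift_commute[of N x] indicator_def)
    finally have "avg \<epsilon> x = (1 / \<epsilon> ^ N) * (\<integral>z. u (shift N z 1 x) * indicator B z \<partial>BN N)" by (simp add: avg_def)
    moreover have "u x = (1 / \<epsilon> ^ N) * (\<integral>z. u x * indicator B z \<partial>BN N)"
    proof -
      have "measure (BN N) B = \<epsilon> ^ N" using vol \<epsilon> by (simp add: measure_def)
      then show ?thesis using \<epsilon> sets.sets_into_space[of B "BN N"] by (simp add: Int_absorb2)
    qed
    ultimately have "avg \<epsilon> x - u x = (1 / \<epsilon> ^ N) * ((\<integral>z. u (shift N z 1 x) * indicator B z \<partial>BN N) - (\<integral>z. u x * indicator B z \<partial>BN N))"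
      by (metis right_diff_distrib)
    also have "(\<integral>z. u (shift N z 1 x) * indicator B z \<partial>BN N) - (\<integral>z. u x * indicator B z \<partial>BN N)
        = (\<integral>z. (u (shift N z 1 x) - u x) * indicator B z \<partial>BN N)"
      using i1 i2 by (simp only: left_diff_distrib Bochner_Integration.integral_diff)
    finally have e: "avg \<epsilon> x - u x = (1 / \<epsilon> ^ N) * (\<integral>z. (u (shift N z 1 x) - u x) * indicator B z \<partial>BN N)" .
    have "ennreal \<bar>avg \<epsilon> x - u x\<bar> = ennreal (1 / \<epsilon> ^ N) * ennreal (norm (\<integral>z. (u (shift N z 1 x) - u x) * indicator B z \<partial>BN N))"
      unfolding e abs_mult using \<epsilon> by (simp add: ennreal_mult'[symmetric])
    also have "\<dots> \<le> ennreal (1 / \<epsilon> ^ N) * (\<integral>\<^sup>+z. ennreal (norm ((u (shift N z 1 x) - u x) * indicator B z)) \<partial>BN N)"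
      using i1 i2 by (intro mult_left_mono integral_norm_bound_ennreal) (simp_all add: left_diff_distrib)
    also have "(\<integral>\<^sup>+z. ennreal (norm ((u (shift N z 1 x) - u x) * indicator B z)) \<partial>BN N) = (\<integral>\<^sup>+z. ennreal \<bar>u (shift N z 1 x) - u x\<bar> * indicator B z \<partial>BN N)"
      by (rule nn_integral_cong) (simp add: indicator_def abs_mult)
    finally show ?thesis .
  qed
  have "(\<integral>\<^sup>+x. ennreal \<bar>avg \<epsilon> x - u x\<bar> \<partial>BN N)
    \<le> (\<integral>\<^sup>+x. ennreal (1 / \<epsilon> ^ N) * (\<integral>\<^sup>+z. ennreal \<bar>u (shift N z 1 x) - u x\<bar> * indicator B z \<partial>BN N) \<partial>BN N)"
    by (rule nn_integral_mono) (rule pt)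
  also have "\<dots> = ennreal (1 / \<epsilon> ^ N) * (\<integral>\<^sup>+x. (\<integral>\<^sup>+z. ennreal \<bar>u (shift N z 1 x) - u x\<bar> * indicator B z \<partial>BN N) \<partial>BN N)"
    by (rule nn_integral_cmult) measurable
  also have "(\<integral>\<^sup>+x. (\<integral>\<^sup>+z. ennreal \<bar>u (shift N z 1 x) - u x\<bar> * indicator B z \<partial>BN N) \<partial>BN N)
    = (\<integral>\<^sup>+z. (\<integral>\<^sup>+x. ennreal \<bar>u (shift N z 1 x) - u x\<bar> * indicator B z \<partial>BN N) \<partial>BN N)"
    by (rule Fubini_BN_BN) measurable
  also have "\<dots> \<le> (\<integral>\<^sup>+z. ennreal (2 * \<epsilon> * mass) * indicator B z \<partial>BN N)"
  proof (rule nn_integral_mono)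
    fix z assume z [measurable]: "z \<in> space (BN N)"
    show "(\<integral>\<^sup>+x. ennreal \<bar>u (shift N z 1 x) - u x\<bar> * indicator B z \<partial>BN N) \<le> ennreal (2 * \<epsilon> * mass) * indicator B z"
    proof (cases "z \<in> B")
      case True
      have "\<bar>z i\<bar> \<le> \<epsilon>" if "i < N" for i
      proof -
        have "0 \<le> z i \<and> z i < 0 + \<epsilon>" using True that unfolding B_def mem_hbox by (meson lessThan_iff)
        then show ?thesis by simp
      qed
      from increment_L1[OF z this] True show ?thesis by simp
    qed simp
  qed
  also have "\<dots> = ennreal (2 * \<epsilon> * mass) * ennreal (\<epsilon> ^ N)"
    by (subst nn_integral_cmult_indicator) (auto simp: vol)
  finally have "(\<integral>\<^sup>+x. ennreal \<bar>avg \<epsilon> x - u x\<bar> \<partial>BN N) \<le> ennreal (1 / \<epsilon> ^ N) * (ennreal (2 * \<epsilon> * mass) * ennreal (\<epsilon> ^ N))"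
    by (simp add: mult_left_mono)
  also have "\<dots> = ennreal (2 * \<epsilon> * mass)"
    using \<epsilon> mass_nonneg by (simp add: ennreal_mult[symmetric])
  finally show ?thesis .
qed

text \<open>For \<epsilon> = 2^-n the L^1 errors are bounded by a geometric series. Hence the series
  of the pointwise errors is finite almost everywhere, and its terms tend to 0; this takes the place
  of a differentiation theorem.\<close>

lemma avg_tendsto: "AE x in BN N. (\<lambda>n. avg ((1 / 2) ^ n) x) \<longlonglongrightarrow> u x"
proof -
  have sm: "summable (\<lambda>n. 2 * (1 / 2) ^ n * mass)"
    by (intro summable_mult2 summable_mult summable_geometric) simp
  have "(\<integral>\<^sup>+x. (\<Sum>n. ennreal \<bar>avg ((1 / 2) ^ n) x - u x\<bar>) \<partial>BN N) = (\<Sum>n. \<integral>\<^sup>+x. ennreal \<bar>avg ((1 / 2) ^ n) x - u x\<bar> \<partial>BN N)"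
    by (rule nn_integral_suminf) measurable
  also have "\<dots> \<le> (\<Sum>n. ennreal (2 * (1 / 2) ^ n * mass))"
    by (intro suminf_le avg_L1 summableI) simp
  also have "\<dots> = ennreal (\<Sum>n. 2 * (1 / 2) ^ n * mass)"
    by (rule suminf_ennreal2[OF _ sm]) (simp add: mass_nonneg)
  finally have "(\<integral>\<^sup>+x. (\<Sum>n. ennreal \<bar>avg ((1 / 2) ^ n) x - u x\<bar>) \<partial>BN N) \<noteq> \<infinity>"
    by (auto simp: top_unique)
  then have "AE x in BN N. (\<Sum>n. ennreal \<bar>avg ((1 / 2) ^ n) x - u x\<bar>) \<noteq> \<infinity>"
    by (intro nn_integral_PInf_AE) measurable
  then show ?thesis
  proof eventually_elim
    fix x assume "(\<Sum>n. ennreal \<bar>avg ((1 / 2) ^ n) x - u x\<bar>) \<noteq> \<infinity>"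
    then have "summable (\<lambda>n. \<bar>avg ((1 / 2) ^ n) x - u x\<bar>)"
      by (intro summable_suminf_not_top) auto
    then have "(\<lambda>n. \<bar>avg ((1 / 2) ^ n) x - u x\<bar>) \<longlonglongrightarrow> 0" by (rule summable_LIMSEQ_zero)
    then show "(\<lambda>n. avg ((1 / 2) ^ n) x) \<longlonglongrightarrow> u x"
      by (simp add: tendsto_rabs_zero_iff LIM_zero_iff)
  qed
qed

text \<open>The averages satisfy \<open>level_energy_bound\<close> for p = 1 with a right side that
  does not depend on \<epsilon>, and Fatou's lemma carries the bound over to u at the fixed level
  lam.\<close>

lemma level_energy_le_TV:
  assumes N: "N \<ge> 1" and lb: "line_bound \<gamma> c" and lam: "lam > 0"
  shows "ennreal lam * level_energy N \<gamma> \<gamma> lam u \<le> ennreal (4 * exp 1 * sphere_area N) * c * TV N P Q"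
proof -
  define B where "B = ennreal (4 * exp 1 * sphere_area N) * c * TV N P Q"
  have bound: "ennreal lam * level_energy N \<gamma> \<gamma> lam (avg \<epsilon>) \<le> B" if \<epsilon>: "\<epsilon> > 0" for \<epsilon>
  proof -
    have "ennreal (lam powr 1) * level_energy N \<gamma> (\<gamma> / 1) lam (avg \<epsilon>)
      \<le> ennreal (4 * exp 1 * sphere_area N) * c * (\<integral>\<^sup>+x. ennreal (avg_grad \<epsilon> x) \<partial>BN N)"
    proof (rule level_energy_bound[OF _ _ N lb _ lam])
      fix z assume z: "z \<in> space (BN N)"
      show "AE x in BN N. ennreal (\<bar>avg \<epsilon> (shift N z 1 x) - avg \<epsilon> x\<bar> powr 1)
        \<le> ennreal (nrm N z powr 1) * (\<integral>\<^sup>+r\<in>{0..1}. ennreal (avg_grad \<epsilon> (shift N z r x)) \<partial>lborel)"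
        using avg_increment[OF z _ \<epsilon>] nrm_nonneg[of N z] by (intro AE_I2) simp
    qed auto
    also have "\<dots> \<le> B" unfolding B_def by (intro mult_left_mono nn_integral_avg_grad_le_TV \<epsilon>) simp
    finally show ?thesis using lam by simp
  qed
  have le: "level_energy N \<gamma> \<gamma> lam (avg ((1 / 2) ^ n)) \<le> ennreal (1 / lam) * B" for n
  proof -
    have "ennreal (1 / lam) * (ennreal lam * level_energy N \<gamma> \<gamma> lam (avg ((1 / 2) ^ n))) \<le> ennreal (1 / lam) * B"
      by (intro mult_left_mono bound) auto
    then show ?thesis using lam by (simp add: mult.assoc[symmetric] ennreal_mult[symmetric])
  qed
  have "level_energy N \<gamma> \<gamma> lam u \<le> liminf (\<lambda>n. level_energy N \<gamma> \<gamma> lam (avg ((1 / 2) ^ n)))"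
    by (rule level_energy_Fatou) (auto intro: avg_tendsto)
  also have "\<dots> \<le> limsup (\<lambda>n. level_energy N \<gamma> \<gamma> lam (avg ((1 / 2) ^ n)))" by (rule Liminf_le_Limsup) simp
  also have "\<dots> \<le> ennreal (1 / lam) * B" by (rule Limsup_bounded) (simp add: le)
  finally have "ennreal lam * level_energy N \<gamma> \<gamma> lam u \<le> ennreal lam * (ennreal (1 / lam) * B)"
    by (rule mult_left_mono) simp
  then show ?thesis using lam by (simp add: mult.assoc[symmetric] ennreal_mult[symmetric] B_def)
qed

end

lemma BV_level_bound:
  assumes BV: "BVgrad N u P Q" and N: "N \<ge> 1" and lb: "line_bound \<gamma> c" and lam: "lam > 0"
  shows "ennreal lam * nu N \<gamma> (Elev N u lam \<gamma>) \<le> ennreal (4 * exp 1 * sphere_area N) * c * TV N P Q"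
proof -
  have loc: "locint N u" using BV by (simp add: BVgrad_def)
  obtain u' where u': "u' \<in> borel_measurable (BN N)" "AE x in BN N. u x = u' x" "\<And>K. set_integrable (BN N) (cube N K) u'"
    and uint: "\<And>f. f \<in> borel_measurable (BN N) \<Longrightarrow> (\<integral>x. u x * f x \<partial>LN N) = (\<integral>x. u' x * f x \<partial>BN N)"
    by (rule locint_representative[OF loc], rule that)
  have fin: "finite_measure (P i)" "finite_measure (Q i)" "sets (P i) = sets (BN N)" "sets (Q i) = sets (BN N)" if "i < N" for i
    using BV that by (auto simp: BVgrad_def)
  have lf: "locfin N M" if "finite_measure M" "sets M = sets (BN N)" for M
    using that finite_measure.emeasure_finite[OF that(1)] by (auto simp: locfin_def less_top)
  interpret finite_measure_gradient N u' P Q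
  proof (intro finite_measure_gradient.intro measure_gradient.intro finite_measure_gradient_axioms.intro)
    show "u' \<in> borel_measurable (BN N)" by fact
    show "set_integrable (BN N) (cube N K) u'" for K by fact
    show "locfin N (P i)" "locfin N (Q i)" "finite_measure (P i)" "finite_measure (Q i)" if "i < N" for i
      using fin[OF that] lf by auto
    fix R i assume R: "bumpseq N R" and i: "i < N"
    have bm: "bumpfun N R m \<in> borel_measurable (BN N)" for m
      using bumpfun_measurable[OF R measurable_ident, of m] by simp
    have "(\<integral>x. u' x * bumpfun N R (e1 i) x \<partial>BN N) = (\<integral>x. u x * pd i (bumpfun N R (\<lambda>_. 0)) x \<partial>LN N)"
      unfolding pd_bumpfun[OF R i] by (rule uint[symmetric, OF bm])
    also have "\<dots> = - ((\<integral>x. bumpfun N R (\<lambda>_. 0) x \<partial>P i) - (\<integral>x. bumpfun N R (\<lambda>_. 0) x \<partial>Q i))"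
      using BV test_bumpfun[OF R, of "\<lambda>_. 0"] i unfolding BVgrad_def by blast
    finally show "(\<integral>x. u' x * bumpfun N R (e1 i) x \<partial>BN N)
      = - ((\<integral>x. bumpfun N R (\<lambda>_. 0) x \<partial>P i) - (\<integral>x. bumpfun N R (\<lambda>_. 0) x \<partial>Q i))" .
  qed
  have "ennreal lam * nu N \<gamma> (Elev N u lam \<gamma>) \<le> ennreal lam * level_energy N \<gamma> \<gamma> lam u'"
    by (intro mult_left_mono nu_le_level_energy u') simp
  also have "\<dots> \<le> ennreal (4 * exp 1 * sphere_area N) * c * TV N P Q"
    by (rule level_energy_le_TV[OF N lb lam])
  finally show ?thesis .
qed

section \<open>The constants for the two ranges of \<gamma>\<close>

lemma line_bound_pos: "\<gamma> > 0 \<Longrightarrow> line_bound \<gamma> (ennreal (5 * 5 powr \<gamma> / \<gamma>))"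
  unfolding line_bound_def by (intro allI impI one_dim_pos)

lemma line_bound_neg: "\<gamma> < -1 \<Longrightarrow> line_bound \<gamma> (ennreal (2 / \<bar>\<gamma>\<bar> * (1 + 1 / \<bar>\<gamma> + 1\<bar>)))"
  unfolding line_bound_def by (intro allI impI one_dim_neg)

lemma sphere_area_nonneg: "N \<ge> 1 \<Longrightarrow> sphere_area N \<ge> 0"
  by (auto simp: sphere_area_def intro!: divide_nonneg_pos Gamma_real_pos)

lemma constant_pos:
  assumes "N \<ge> 1" "\<gamma> > 0"
  shows "ennreal (4 * exp 1 * sphere_area N) * ennreal (5 * 5 powr \<gamma> / \<gamma>) = ennreal (20 * exp 1 * sphere_area N * 5 powr \<gamma> / \<gamma>)"
  using assms sphere_area_nonneg by (subst ennreal_mult[symmetric]) auto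

text \<open>The product on the left has the factor 8 e. The common constant 20 e = 4 e * 5 is
  dictated by \<open>constant_pos\<close>, where 5 comes from the Vitali enlargement.\<close>

lemma constant_neg:
  assumes "N \<ge> 1" "\<gamma> < -1"
  shows "ennreal (4 * exp 1 * sphere_area N) * ennreal (2 / \<bar>\<gamma>\<bar> * (1 + 1 / \<bar>\<gamma> + 1\<bar>))
    \<le> ennreal (20 * exp 1 * sphere_area N / \<bar>\<gamma>\<bar> * (1 + 1 / \<bar>\<gamma> + 1\<bar>))"
proof -
  define X where "X = exp 1 * sphere_area N / \<bar>\<gamma>\<bar> * (1 + 1 / \<bar>\<gamma> + 1\<bar>)"
  have X: "X \<ge> 0" unfolding X_def using sphere_area_nonneg[OF assms(1)] by (intro mult_nonneg_nonneg divide_nonneg_nonneg) auto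
  have "(4 * exp 1 * sphere_area N) * (2 / \<bar>\<gamma>\<bar> * (1 + 1 / \<bar>\<gamma> + 1\<bar>)) = 8 * X" by (simp add: X_def)
  moreover have "20 * exp 1 * sphere_area N / \<bar>\<gamma>\<bar> * (1 + 1 / \<bar>\<gamma> + 1\<bar>) = 20 * X" by (simp add: X_def)
  moreover have "ennreal (4 * exp 1 * sphere_area N) * ennreal (2 / \<bar>\<gamma>\<bar> * (1 + 1 / \<bar>\<gamma> + 1\<bar>))
      = ennreal ((4 * exp 1 * sphere_area N) * (2 / \<bar>\<gamma>\<bar> * (1 + 1 / \<bar>\<gamma> + 1\<bar>)))"
    using sphere_area_nonneg[OF assms(1)] by (intro ennreal_mult[symmetric]) auto
  ultimately show ?thesis using X by (simp only:) (intro ennreal_leI, simp)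
qed

theorem theorem2p2:
  shows "\<exists>C>0.
   (\<forall>(N::nat) (p::real) u g. 1 \<le> N \<and> 1 \<le> p \<and> W1p N p u g \<longrightarrow>
      (\<forall>\<gamma>>0. (SUP lam\<in>{0<..}. ennreal (lam powr p) * nu N \<gamma> (Elev N u lam (\<gamma> / p)))
               \<le> ennreal (C * sphere_area N * 5 powr \<gamma> / \<gamma>) * gradnorm N p g) \<and>
      (\<forall>\<gamma> < -1. (SUP lam\<in>{0<..}. ennreal (lam powr p) * nu N \<gamma> (Elev N u lam (\<gamma> / p)))
               \<le> ennreal (C * sphere_area N / \<bar>\<gamma>\<bar> * (1 + 1 / \<bar>\<gamma> + 1\<bar>)) * gradnorm N p g)) \<and>
   (\<forall>(N::nat) u P Q. 1 \<le> N \<and> BVgrad N u P Q \<longrightarrow>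
      (\<forall>\<gamma>>0. (SUP lam\<in>{0<..}. ennreal lam * nu N \<gamma> (Elev N u lam \<gamma>))
               \<le> ennreal (C * sphere_area N * 5 powr \<gamma> / \<gamma>) * TV N P Q) \<and>
      (\<forall>\<gamma> < -1. (SUP lam\<in>{0<..}. ennreal lam * nu N \<gamma> (Elev N u lam \<gamma>))
               \<le> ennreal (C * sphere_area N / \<bar>\<gamma>\<bar> * (1 + 1 / \<bar>\<gamma> + 1\<bar>)) * TV N P Q))"
proof (intro exI[of _ "20 * exp 1"] conjI allI impI SUP_least)
  show "0 < 20 * exp (1::real)" by simp
next
  fix N :: nat and p :: real and u g and \<gamma> lam :: real
  assume a: "1 \<le> N \<and> 1 \<le> p \<and> W1p N p u g" and \<gamma>: "0 < \<gamma>" and lam: "lam \<in> {0<..}"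
  show "ennreal (lam powr p) * nu N \<gamma> (Elev N u lam (\<gamma> / p)) \<le> ennreal (20 * exp 1 * sphere_area N * 5 powr \<gamma> / \<gamma>) * gradnorm N p g"
    using W1p_level_bound[OF _ _ _ line_bound_pos[OF \<gamma>], of N p u g lam] a lam constant_pos[of N \<gamma>] \<gamma> by simp
next
  fix N :: nat and p :: real and u g and \<gamma> lam :: real
  assume a: "1 \<le> N \<and> 1 \<le> p \<and> W1p N p u g" and \<gamma>: "\<gamma> < -1" and lam: "lam \<in> {0<..}"
  show "ennreal (lam powr p) * nu N \<gamma> (Elev N u lam (\<gamma> / p)) \<le> ennreal (20 * exp 1 * sphere_area N / \<bar>\<gamma>\<bar> * (1 + 1 / \<bar>\<gamma> + 1\<bar>)) * gradnorm N p g"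
  proof (rule order_trans)
    show "ennreal (lam powr p) * nu N \<gamma> (Elev N u lam (\<gamma> / p))
      \<le> ennreal (4 * exp 1 * sphere_area N) * ennreal (2 / \<bar>\<gamma>\<bar> * (1 + 1 / \<bar>\<gamma> + 1\<bar>)) * gradnorm N p g"
      using a lam by (intro W1p_level_bound line_bound_neg \<gamma>) simp_all
  qed (use a in \<open>intro mult_right_mono constant_neg \<gamma>; simp\<close>)
next
  fix N :: nat and u P Q and \<gamma> lam :: real
  assume a: "1 \<le> N \<and> BVgrad N u P Q" and \<gamma>: "0 < \<gamma>" and lam: "lam \<in> {0<..}"
  show "ennreal lam * nu N \<gamma> (Elev N u lam \<gamma>) \<le> ennreal (20 * exp 1 * sphere_area N * 5 powr \<gamma> / \<gamma>) * TV N P Q"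
    using BV_level_bound[OF _ _ line_bound_pos[OF \<gamma>], of N u P Q lam] a lam constant_pos[of N \<gamma>] \<gamma> by simp
next
  fix N :: nat and u P Q and \<gamma> lam :: real
  assume a: "1 \<le> N \<and> BVgrad N u P Q" and \<gamma>: "\<gamma> < -1" and lam: "lam \<in> {0<..}"
  show "ennreal lam * nu N \<gamma> (Elev N u lam \<gamma>) \<le> ennreal (20 * exp 1 * sphere_area N / \<bar>\<gamma>\<bar> * (1 + 1 / \<bar>\<gamma> + 1\<bar>)) * TV N P Q"
  proof (rule order_trans)
    show "ennreal lam * nu N \<gamma> (Elev N u lam \<gamma>)
      \<le> ennreal (4 * exp 1 * sphere_area N) * ennreal (2 / \<bar>\<gamma>\<bar> * (1 + 1 / \<bar>\<gamma> + 1\<bar>)) * TV N P Q"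
      using a lam by (intro BV_level_bound line_bound_neg \<gamma>) simp_all
  qed (use a in \<open>intro mult_right_mono constant_neg \<gamma>; simp\<close>)
qed

end
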